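(* Let $n\ge 2$, $p>1$, $\Omega\subset\mathbb{R}^n$ a bounded open set, $\{w_1,w_2,\dots\}$ a Schauder basis of $W^{1,p}_0(\Omega)$, $m\ge1$, $1<\alpha<p$, and $f\in L^{p'}(\Omega)$ with $\frac1p+\frac1{p'}=1$ and $f\neq0$ in $\Omega$. Let $\Phi_m:W_m\to\mathbb{R}$, $\Phi_m(u)=\frac1p\mathcal{E}_{p,\Omega}^p(u)-\frac1\alpha\|u\|_{L^\alpha(\Omega)}^\alpha-\int_\Omega f u\,dx$. Then there exists a nontrivial $u\in W_m$ with $\Phi_m'(u)=0$, i.e. $a(u,\varphi)-\int_\Omega|u|^{\alpha-2}u\varphi\,dx-\int_\Omega f\varphi\,dx=0$ for all $\varphi\in W_m$.
   Context: $W_m$ is the linear span of $w_1,\dots,w_m$ in $W^{1,p}_0(\Omega)$. For $u\in W^{1,p}_0(\Omega)$ and $\xi\in\mathbb{S}^{n-1}$, $\nabla_\xi u=\nabla u\cdot\xi$. The affine $L^p$ energy is $\mathcal{E}_{p,\Omega}(u)=\gamma_{n,p}\left(\int_{\mathbb{S}^{n-1}}\|\nabla_\xi u\|_{L^p(\Omega)}^{-n}\,d\sigma(\xi)\right)^{-1/n}$, where $\sigma$ is the surface measure on $\mathbb{S}^{n-1}$, $\gamma_{n,p}=(2\omega_{n+p-2})^{-1}(n\omega_n\omega_{p-1})(n\omega_n)^{p/n}$, $\omega_\kappa$ is the volume of the unit Euclidean ball in $\mathbb{R}^\kappa$, and $\mathcal{E}_{p,\Omega}(0)=0$. For $t\in\mathbb{R}$,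 $\{t\}^{p-1}=|t|^{p-1}\operatorname{sgn}(t)$. For $u\neq0$, $a(u,\varphi)=\gamma_{n,p}^{-n}\,\mathcal{E}_{p,\Omega}^{n+p}(u)\int_{\mathbb{S}^{n-1}}\|\nabla_\xi u\|_{L^p(\Omega)}^{-n-p}\int_\Omega\{\nabla_\xi u\}^{p-1}\langle\nabla\varphi,\xi\rangle\,dx\,d\sigma(\xi)$, the Gâteaux derivative of $\frac1p\mathcal{E}^p_{p,\Omega}$ at $u$ in direction $\varphi$; thus $\Phi_m'(u)$ denotes the Gâteaux derivative of $\Phi_m$ on $W_m$, given by the displayed expression. *)

theory Defs
  imports "HOL-Analysis.Analysis"
begin

coinductive smooth_fn :: "('a::euclidean_space \<Rightarrow> real) \<Rightarrow> bool" where
  "(\<forall>x. f differentiable (at x)) \<Longrightarrow>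
   (\<forall>b\<in>Basis. smooth_fn (\<lambda>x. frechet_derivative f (at x) b)) \<Longrightarrow> smooth_fn f"

definition cgrad :: "('a::euclidean_space \<Rightarrow> real) \<Rightarrow> 'a \<Rightarrow> 'a" where
  "cgrad f x = (\<Sum>b\<in>Basis. frechet_derivative f (at x) b *\<^sub>R b)"

definition test_fn :: "'a::euclidean_space set \<Rightarrow> ('a \<Rightarrow> real) \<Rightarrow> bool" where
  "test_fn \<Omega> \<phi> \<longleftrightarrow> smooth_fn \<phi> \<and> compact (closure {x. \<phi> x \<noteq> 0})
      \<and> closure {x. \<phi> x \<noteq> 0} \<subseteq> \<Omega>"

definition Lp_norm :: "'a::euclidean_space set \<Rightarrow> real \<Rightarrow> ('a \<Rightarrow> real) \<Rightarrow> real" where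
  "Lp_norm \<Omega> p v = (enn2real (\<integral>\<^sup>+x\<in>\<Omega>. ennreal (\<bar>v x\<bar> powr p) \<partial>lborel)) powr (1 / p)"

definition in_Lp :: "'a::euclidean_space set \<Rightarrow> real \<Rightarrow> ('a \<Rightarrow> real) \<Rightarrow> bool" where
  "in_Lp \<Omega> p v \<longleftrightarrow> v \<in> borel_measurable lborel \<and>
     (\<integral>\<^sup>+x\<in>\<Omega>. ennreal (\<bar>v x\<bar> powr p) \<partial>lborel) < \<infinity>"

text \<open>\<open>sob0_pair \<Omega> p u g\<close>: \<open>u\<close> lies in the W^{1,p}-closure of the test functions on \<Omega>
  (i.e. in W^{1,p}_0(\<Omega>)) and \<open>g\<close> is its (weak) gradient.\<close>
definition sob0_pair :: "'a::euclidean_space set \<Rightarrow> real \<Rightarrow> ('a \<Rightarrow> real) \<Rightarrow> ('a \<Rightarrow> 'a) \<Rightarrow> bool" where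
  "sob0_pair \<Omega> p u g \<longleftrightarrow> u \<in> borel_measurable lborel \<and> g \<in> borel_measurable lborel \<and>
     (\<exists>\<phi>. (\<forall>k. test_fn \<Omega> (\<phi> k)) \<and>
        (\<lambda>k. \<integral>\<^sup>+x. ennreal (\<bar>\<phi> k x - u x\<bar> powr p) \<partial>lborel) \<longlonglongrightarrow> 0 \<and>
        (\<lambda>k. \<integral>\<^sup>+x. ennreal (norm (cgrad (\<phi> k) x - g x) powr p) \<partial>lborel) \<longlonglongrightarrow> 0)"

definition W0 :: "'a::euclidean_space set \<Rightarrow> real \<Rightarrow> ('a \<Rightarrow> real) set" where
  "W0 \<Omega> p = {u. \<exists>g. sob0_pair \<Omega> p u g}"

definition wgrad :: "'a::euclidean_space set \<Rightarrow> real \<Rightarrow> ('a \<Rightarrow> real) \<Rightarrow> 'a \<Rightarrow> 'a" where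
  "wgrad \<Omega> p u = (SOME g. sob0_pair \<Omega> p u g)"

definition sob_norm :: "'a::euclidean_space set \<Rightarrow> real \<Rightarrow> ('a \<Rightarrow> real) \<Rightarrow> real" where
  "sob_norm \<Omega> p u = Lp_norm \<Omega> p u + Lp_norm \<Omega> p (\<lambda>x. norm (wgrad \<Omega> p u x))"

text \<open>Schauder basis \<open>w 1, w 2, ...\<close> of W^{1,p}_0(\<Omega>) (index 0 unused).\<close>
definition schauder_basis :: "'a::euclidean_space set \<Rightarrow> real \<Rightarrow> (nat \<Rightarrow> 'a \<Rightarrow> real) \<Rightarrow> bool" where
  "schauder_basis \<Omega> p w \<longleftrightarrow> (\<forall>k\<ge>1. w k \<in> W0 \<Omega> p) \<and>
     (\<forall>u\<in>W0 \<Omega> p. \<exists>!c::nat \<Rightarrow> real. c 0 = 0 \<and>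
        (\<lambda>N. sob_norm \<Omega> p (\<lambda>x. u x - (\<Sum>k\<in>{1..N}. c k * w k x))) \<longlonglongrightarrow> 0)"

definition Wm :: "(nat \<Rightarrow> 'a \<Rightarrow> real) \<Rightarrow> nat \<Rightarrow> ('a \<Rightarrow> real) set" where
  "Wm w m = {u. \<exists>c::nat \<Rightarrow> real. u = (\<lambda>x. \<Sum>k\<in>{1..m}. c k * w k x)}"

text \<open>Cone measure: \<open>\<sigma>(A) = n \<cdot> \<lambda>({t x | 0 < t \<le> 1, x \<in> A})\<close>, which is the surface measure.\<close>
definition sphere_measure :: "'a::euclidean_space measure" where
  "sphere_measure = measure_of (sphere 0 1) (sets (restrict_space borel (sphere (0::'a) 1)))
     (\<lambda>A. of_nat DIM('a) * emeasure lborel {t *\<^sub>R x | t x. t \<in> {0<..1} \<and> x \<in> A})"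

definition gamma_np :: "nat \<Rightarrow> real \<Rightarrow> real" where
  "gamma_np n p = (n * unit_ball_vol n * unit_ball_vol (p - 1)) * (n * unit_ball_vol n) powr (p / n)
      / (2 * unit_ball_vol (n + p - 2))"

definition dir_grad :: "'a::euclidean_space set \<Rightarrow> real \<Rightarrow> ('a \<Rightarrow> real) \<Rightarrow> 'a \<Rightarrow> 'a \<Rightarrow> real" where
  "dir_grad \<Omega> p u \<xi> x = wgrad \<Omega> p u x \<bullet> \<xi>"

definition affine_energy :: "'a::euclidean_space set \<Rightarrow> real \<Rightarrow> ('a \<Rightarrow> real) \<Rightarrow> real" where
  "affine_energy \<Omega> p u = (if sob_norm \<Omega> p u = 0 then 0 else
     gamma_np DIM('a) p * (\<integral>\<xi>. Lp_norm \<Omega> p (dir_grad \<Omega> p u \<xi>) powr (- real DIM('a))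
        \<partial>sphere_measure) powr (- 1 / real DIM('a)))"

definition sgnpow :: "real \<Rightarrow> real \<Rightarrow> real" where
  "sgnpow t q = \<bar>t\<bar> powr q * sgn t"

definition a_form :: "'a::euclidean_space set \<Rightarrow> real \<Rightarrow> ('a \<Rightarrow> real) \<Rightarrow> ('a \<Rightarrow> real) \<Rightarrow> real" where
  "a_form \<Omega> p u \<phi> = gamma_np DIM('a) p powr (- real DIM('a)) *
     affine_energy \<Omega> p u powr (real DIM('a) + p) *
     (\<integral>\<xi>. Lp_norm \<Omega> p (dir_grad \<Omega> p u \<xi>) powr (- real DIM('a) - p) *
        (LINT x:\<Omega>|lborel. sgnpow (dir_grad \<Omega> p u \<xi> x) (p - 1) * (wgrad \<Omega> p \<phi> x \<bullet> \<xi>))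
      \<partial>sphere_measure)"

end

theory Submission
  imports Defs
begin

text \<open>The functional \<open>\<Phi>\<^sub>m\<close> is coercive on the finite-dimensional space \<open>W\<^sub>m\<close> and negative at small multiples
  of a suitable direction, because \<open>\<alpha> < p\<close>; hence it attains its minimum at some \<open>u \<noteq> 0\<close>, where it is
  differentiable. Everything rests on a lower bound \<open>\<parallel>\<nabla>\<^sub>\<xi> u\<parallel>\<^sub>p \<ge> \<delta> |c|\<close>, uniform in \<open>\<xi>\<close>, where \<open>c\<close> are the
  coefficients of \<open>u\<close>. By compactness it suffices that \<open>\<nabla>\<^sub>\<xi> u = 0\<close> for a single \<open>\<xi>\<close> forces \<open>u = 0\<close>. This is
  the \<open>L\<^sup>1\<close> Poincare inequality in direction \<open>\<xi>\<close>: translating \<open>u\<close> along \<open>\<xi>\<close> by more than the diameter of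
  \<open>\<Omega>\<close> makes the two supports disjoint.\<close>

subsection \<open>Test functions\<close>

text \<open>Two obstacles shape the argument. First, \<open>wgrad\<close> is an arbitrary choice
  among the L^p limits of gradients of approximating test functions, so it can be computed on linear
  combinations only once the gradient is known to be unique almost everywhere. Uniqueness is
  extracted from the approximating sequence itself, with shifted difference quotients in place of
  integration by parts. The same quotients give the Poincare inequality. Both are carried out in
  L^1, which is enough because on a bounded \<Omega> convergence in L^p implies convergence in L^1.
  Second, the energy contains negative powers of directional norms, so dominated convergence needs
  these norms to stay away from 0. The uniform lower bound provides this for c \<noteq> 0; at c = 0
  continuity comes from comparing the p-th power of the energy with that of |c|. Linear independence
  modulo null functions, the other input of the compactness argument, comes from uniqueness of
  Schauder expansions. The variational part is stated for abstract finite families and coefficient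
  functions, so no Sobolev space occurs in it.\<close>

lemma compact_closure_subset:
  fixes K :: "'a::t2_space set"
  assumes "compact K" "closure A \<subseteq> K"
  shows "compact (closure A)"
  using compact_Int_closed[OF assms(1), of "closure A"] assms(2) by (simp add: inf_absorb2)

lemma smooth_fn_differentiable: "smooth_fn f \<Longrightarrow> f differentiable (at x)"
  by (erule smooth_fn.cases) auto

lemma smooth_fn_deriv: "smooth_fn f \<Longrightarrow> b \<in> Basis \<Longrightarrow> smooth_fn (\<lambda>x. frechet_derivative f (at x) b)"
  by (erule smooth_fn.cases) auto

lemma frechet_derivative_lincomb:
  fixes f g :: "'a::euclidean_space \<Rightarrow> real"
  assumes "f differentiable (at x)" "g differentiable (at x)"
  shows "frechet_derivative (\<lambda>x. a * f x + b * g x) (at x)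
    = (\<lambda>v. a * frechet_derivative f (at x) v + b * frechet_derivative g (at x) v)"
proof -
  have "((\<lambda>x. a * f x + b * g x) has_derivative
     (\<lambda>v. a * frechet_derivative f (at x) v + b * frechet_derivative g (at x) v)) (at x)"
    using assms by (auto simp: frechet_derivative_works intro!: derivative_eq_intros)
  from frechet_derivative_at[OF this] show ?thesis by simp
qed

text \<open>The coinduction runs over all pairs of smooth functions: a partial derivative of the
  combination is the same combination of partial derivatives, so the class of such combinations is
  closed under differentiation.\<close>

lemma smooth_fn_lincomb:
  assumes "smooth_fn f" "smooth_fn g"
  shows "smooth_fn (\<lambda>x. a * f x + b * g x)"
  using assms
proof (coinduction arbitrary: f g)
  case smooth_fn
  then have d: "\<And>x. f differentiable (at x)" "\<And>x. g differentiable (at x)"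
    by (auto intro: smooth_fn_differentiable)
  then have "\<forall>x. (\<lambda>x. a * f x + b * g x) differentiable (at x)"
    by simp
  moreover have "\<exists>f' g'. (\<lambda>x. frechet_derivative (\<lambda>x. a * f x + b * g x) (at x) c) =
       (\<lambda>x. a * f' x + b * g' x) \<and> smooth_fn f' \<and> smooth_fn g'" if "c \<in> Basis" for c
    using d smooth_fn that
    by (intro exI[of _ "\<lambda>x. frechet_derivative f (at x) c"] exI[of _ "\<lambda>x. frechet_derivative g (at x) c"])
       (simp add: frechet_derivative_lincomb smooth_fn_deriv)
  ultimately show ?case by blast
qed

lemma smooth_fn_continuous: "smooth_fn f \<Longrightarrow> continuous_on UNIV f"
  by (simp add: continuous_at_imp_continuous_on differentiable_imp_continuous_within smooth_fn_differentiable)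

lemma cgrad_inner:
  assumes "f differentiable (at x)"
  shows "cgrad f x \<bullet> v = frechet_derivative f (at x) v"
proof -
  have l: "linear (frechet_derivative f (at x))" using assms by (rule linear_frechet_derivative)
  have "frechet_derivative f (at x) v = frechet_derivative f (at x) (\<Sum>b\<in>Basis. (v \<bullet> b) *\<^sub>R b)"
    by (simp add: euclidean_representation)
  also have "\<dots> = (\<Sum>b\<in>Basis. (v \<bullet> b) * frechet_derivative f (at x) b)"
    by (simp add: linear_sum[OF l] linear_cmul[OF l])
  finally show ?thesis by (simp add: cgrad_def inner_sum_left inner_commute[of v] mult.commute)
qed

lemma smooth_fn_has_derivative:
  assumes "smooth_fn f" shows "(f has_derivative (\<lambda>h. cgrad f x \<bullet> h)) (at x)"
  using smooth_fn_differentiable[OF assms, of x] frechet_derivative_works[of f "at x"]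
  by (simp add: cgrad_inner)

lemma cgrad_lincomb:
  assumes "smooth_fn f" "smooth_fn g"
  shows "cgrad (\<lambda>x. a * f x + b * g x) x = a *\<^sub>R cgrad f x + b *\<^sub>R cgrad g x"
  unfolding cgrad_def
    frechet_derivative_lincomb[OF assms[THEN smooth_fn_differentiable]]
  by (simp add: scaleR_add_left sum.distrib scaleR_sum_right)

lemma smooth_fn_cgrad_continuous:
  assumes "smooth_fn f" shows "continuous_on UNIV (cgrad f)"
  unfolding cgrad_def[abs_def]
  by (intro continuous_intros smooth_fn_continuous smooth_fn_deriv assms)

lemma test_fn_lincomb:
  assumes "test_fn \<Omega> f" "test_fn \<Omega> g"
  shows "test_fn \<Omega> (\<lambda>x. a * f x + b * g x)"
proof -
  have "closure {x. a * f x + b * g x \<noteq> 0} \<subseteq> closure ({x. f x \<noteq> 0} \<union> {x. g x \<noteq> 0})"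
    by (rule closure_mono) auto
  then have *: "closure {x. a * f x + b * g x \<noteq> 0} \<subseteq> closure {x. f x \<noteq> 0} \<union> closure {x. g x \<noteq> 0}"
    by (simp add: closure_Un)
  have "compact (closure {x. f x \<noteq> 0} \<union> closure {x. g x \<noteq> 0})"
    using assms unfolding test_fn_def by (intro compact_Un) simp_all
  then have "compact (closure {x. a * f x + b * g x \<noteq> 0})"
    using * by (rule compact_closure_subset)
  then show ?thesis using assms * smooth_fn_lincomb[of f g a b]
    by (auto simp: test_fn_def)
qed

lemma frechet_derivative_zero_off_support:
  fixes f :: "'a::euclidean_space \<Rightarrow> real"
  assumes "x \<notin> closure {x. f x \<noteq> 0}"
  shows "frechet_derivative f (at x) = (\<lambda>_. 0)"
proof -
  have "((\<lambda>_. 0::real) has_derivative (\<lambda>_. 0)) (at x)" by simp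
  then have "(f has_derivative (\<lambda>_. 0)) (at x)"
    by (rule has_derivative_transform_within_open[of _ _ _ _ "- closure {x. f x \<noteq> 0}"])
       (use assms closure_subset[of "{x. f x \<noteq> 0}"] in auto)
  then show ?thesis by (simp add: frechet_derivative_at[symmetric])
qed

lemma test_fn_deriv:
  assumes "test_fn \<Omega> f" "b \<in> Basis"
  shows "test_fn \<Omega> (\<lambda>x. frechet_derivative f (at x) b)"
proof -
  have "{x. frechet_derivative f (at x) b \<noteq> 0} \<subseteq> closure {x. f x \<noteq> 0}"
    using frechet_derivative_zero_off_support by fastforce
  then have *: "closure {x. frechet_derivative f (at x) b \<noteq> 0} \<subseteq> closure {x. f x \<noteq> 0}"
    by (rule closure_minimal) simp
  then have "compact (closure {x. frechet_derivative f (at x) b \<noteq> 0})"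
    using assms(1) * compact_closure_subset by (metis test_fn_def)
  then show ?thesis using assms * smooth_fn_deriv[of f b] by (auto simp: test_fn_def)
qed

lemma test_fn_zero_outside: "test_fn \<Omega> f \<Longrightarrow> x \<notin> \<Omega> \<Longrightarrow> f x = 0"
  unfolding test_fn_def using closure_subset[of "{x. f x \<noteq> 0}"] by blast

lemma test_fn_cgrad_zero_outside: "test_fn \<Omega> f \<Longrightarrow> x \<notin> \<Omega> \<Longrightarrow> cgrad f x = 0"
  by (auto simp: cgrad_def test_fn_zero_outside[OF test_fn_deriv])

lemma test_fn_bounded:
  assumes "test_fn \<Omega> f" obtains B where "B \<ge> 0" "\<And>x. \<bar>f x\<bar> \<le> B"
proof -
  let ?K = "closure {x. f x \<noteq> 0}"
  have "bounded (f ` ?K)"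
    using assms smooth_fn_continuous unfolding test_fn_def
    by (meson compact_continuous_image compact_imp_bounded continuous_on_subset top_greatest)
  then obtain B where B: "\<And>x. x \<in> ?K \<Longrightarrow> \<bar>f x\<bar> \<le> B" by (auto simp: bounded_iff)
  have "\<bar>f x\<bar> \<le> max B 0" for x
    using B[of x] closure_subset[of "{x. f x \<noteq> 0}"] by (cases "f x = 0") (auto simp: le_max_iff_disj)
  then show thesis using that[of "max B 0"] by auto
qed

lemma test_fn_cgrad_bounded:
  assumes "test_fn \<Omega> f" obtains B where "B \<ge> 0" "\<And>x. norm (cgrad f x) \<le> B"
proof -
  have "\<forall>b\<in>Basis. \<exists>B\<ge>0. \<forall>x. \<bar>frechet_derivative f (at x) b\<bar> \<le> B"
    using test_fn_bounded[OF test_fn_deriv[OF assms]] by metis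
  then obtain B where B: "\<And>b. b \<in> Basis \<Longrightarrow> B b \<ge> 0 \<and> (\<forall>x. \<bar>frechet_derivative f (at x) b\<bar> \<le> B b)"
    by metis
  show thesis
  proof (rule that[of "\<Sum>b\<in>(Basis::'a set). B b"])
    show "(\<Sum>b\<in>(Basis::'a set). B b) \<ge> 0" using B by (auto intro: sum_nonneg)
    show "norm (cgrad f x) \<le> (\<Sum>b\<in>Basis. B b)" for x
      unfolding cgrad_def using B by (intro sum_norm_le) auto
  qed
qed

lemma test_fn_lipschitz:
  assumes "test_fn \<Omega> f" obtains L where "L \<ge> 0" "\<And>x y. \<bar>f x - f y\<bar> \<le> L * norm (x - y)"
proof -
  obtain B where B: "B \<ge> 0" "\<And>x. norm (cgrad f x) \<le> B" using test_fn_cgrad_bounded[OF assms] by metis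
  have "\<bar>f x - f y\<bar> \<le> B * norm (x - y)" for x y
  proof -
    have "norm (f x - f y) \<le> B * norm (x - y)"
    proof (rule differentiable_bound[where S=UNIV and f'="\<lambda>x h. cgrad f x \<bullet> h"])
      show "\<And>x. (f has_derivative (\<bullet>) (cgrad f x)) (at x)"
        using assms smooth_fn_has_derivative by (auto simp: test_fn_def)
      show "onorm ((\<bullet>) (cgrad f x)) \<le> B" for x
      proof (rule onorm_bound[OF B(1)])
        show "norm (cgrad f x \<bullet> h) \<le> B * norm h" for h
          using Cauchy_Schwarz_ineq2[of "cgrad f x" h] mult_right_mono[OF B(2)[of x], of "norm h"]
          by simp
      qed
    qed auto
    then show ?thesis by simp
  qed
  then show thesis using that B by blast
qed

lemma test_fn_measurable [measurable_dest]:
  assumes "test_fn \<Omega> f"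
  shows "f \<in> borel_measurable borel" "cgrad f \<in> borel_measurable borel"
  using assms unfolding test_fn_def
  by (metis borel_measurable_continuous_onI smooth_fn_continuous smooth_fn_cgrad_continuous)+

section \<open>Translations, difference quotients and the directional Poincare inequality\<close>

lemma integrable_bounded_support:
  fixes h :: "'a::euclidean_space \<Rightarrow> real"
  assumes "h \<in> borel_measurable borel" "bounded S" "\<And>x. x \<notin> S \<Longrightarrow> h x = 0" "\<And>x. \<bar>h x\<bar> \<le> B"
  shows "integrable lborel h"
proof -
  obtain R where R: "S \<subseteq> cball 0 R" using assms(2) bounded_subset_ballD[of S 0] ball_subset_cball by blast
  show ?thesis
  proof (rule integrableI_bounded_set[where A="cball 0 R" and B=B])
    show "emeasure lborel (cball (0::'a) R) < \<infinity>"
      by (rule emeasure_lborel_cball_finite)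
    show "AE x in lborel. x \<in> cball 0 R \<longrightarrow> norm (h x) \<le> B"
      using assms(4) by (intro AE_I2) simp
    show "AE x in lborel. x \<notin> cball 0 R \<longrightarrow> h x = 0"
      using R assms(3) by (intro AE_I2) blast
  qed (use assms(1) in simp_all)
qed

lemma lborel_integral_shift:
  fixes h :: "'a::euclidean_space \<Rightarrow> real"
  assumes [measurable]: "h \<in> borel_measurable borel"
  shows "(\<integral>x. h (x + v) \<partial>lborel) = (\<integral>x. h x \<partial>lborel)"
proof -
  have "(\<integral>x. h x \<partial>lborel) = (\<integral>x. h x \<partial>distr lborel borel ((+) v))" by (simp add: lborel_distr_plus)
  also have "\<dots> = (\<integral>x. h (x + v) \<partial>lborel)" by (subst integral_distr) (auto simp: add.commute)
  finally show ?thesis by simp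
qed

lemma integrable_shift:
  fixes h :: "'a::euclidean_space \<Rightarrow> real"
  assumes "integrable lborel h"
  shows "integrable lborel (\<lambda>x. h (x + v))"
proof -
  have "integrable (distr lborel borel ((+) v)) h" using assms by (simp add: lborel_distr_plus)
  then show ?thesis by (subst (asm) integrable_distr_eq) (use assms in \<open>auto simp: add.commute\<close>)
qed

lemma test_fn_integrable:
  assumes "test_fn \<Omega> f" "bounded \<Omega>"
  shows "integrable lborel f"
proof -
  obtain B where "\<And>x. \<bar>f x\<bar> \<le> B" using test_fn_bounded[OF assms(1)] by metis
  then show ?thesis
    using assms test_fn_zero_outside test_fn_measurable(1)
    by (intro integrable_bounded_support[where S=\<Omega>]) blast+
qed

lemma test_fn_cgrad_integrable:
  assumes "test_fn \<Omega> f" "bounded \<Omega>"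
  shows "integrable lborel (\<lambda>x. cgrad f x \<bullet> v)"
proof -
  obtain B where B: "\<And>x. norm (cgrad f x) \<le> B" using test_fn_cgrad_bounded[OF assms(1)] by metis
  note [measurable] = test_fn_measurable(2)[OF assms(1)]
  have "\<bar>cgrad f x \<bullet> v\<bar> \<le> B * norm v" for x
    using Cauchy_Schwarz_ineq2[of "cgrad f x" v] mult_right_mono[OF B[of x], of "norm v"] by simp
  then show ?thesis
    using assms(2) test_fn_cgrad_zero_outside[OF assms(1)]
    by (intro integrable_bounded_support[where S=\<Omega> and B="B * norm v"]) auto
qed

text \<open>Provides one integrable majorant for all steps up to 1, so that limits of difference
  quotients can be taken under the integral.\<close>

lemma test_fn_quotient_dominated:
  assumes "test_fn \<Omega> f" "bounded \<Omega>"
  obtains w where "integrable lborel w"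
    "\<And>t x. \<bar>t\<bar> \<le> 1 \<Longrightarrow> \<bar>(f (x + t *\<^sub>R v) - f x) / t\<bar> \<le> w x"
proof -
  obtain L where L: "L \<ge> 0" "\<And>x y. \<bar>f x - f y\<bar> \<le> L * norm (x - y)"
    using test_fn_lipschitz[OF assms(1)] by metis
  obtain R where R: "\<Omega> \<subseteq> ball 0 R" using bounded_subset_ballD[OF assms(2)] by blast
  \<comment> \<open>A shift by \<open>t *\<^sub>R v\<close> with |t| \<le> 1 moves a point by at
    most \<open>norm v\<close>; outside the enlarged ball both x and its shift therefore miss
    \<Omega>.\<close>
  let ?w = "\<lambda>x. L * norm v * indicator (cball 0 (R + norm v)) x"
  show thesis
  proof
    show "integrable lborel ?w"
      by (intro integrable_mult_right integrable_real_indicator emeasure_lborel_cball_finite) simp_all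
    fix t :: real and x assume t: "\<bar>t\<bar> \<le> 1"
    show "\<bar>(f (x + t *\<^sub>R v) - f x) / t\<bar> \<le> ?w x"
    proof (cases "x \<in> cball 0 (R + norm v)")
      case True
      have "\<bar>f (x + t *\<^sub>R v) - f x\<bar> \<le> (L * norm v) * \<bar>t\<bar>"
        using L(2)[of "x + t *\<^sub>R v" x] by (simp add: mult_ac)
      moreover have "0 \<le> L * norm v" using L by simp
      \<comment> \<open>For t = 0 the quotient is 0 by the convention on division.\<close>
      ultimately show ?thesis using True
        by (cases "t = 0") (simp_all add: divide_le_eq)
    next
      case False
      have "norm (t *\<^sub>R v) \<le> norm v" using mult_right_mono[OF t, of "norm v"] by simp
      then have "norm x - norm v \<le> norm (x + t *\<^sub>R v)"
        using norm_diff_ineq[of x "t *\<^sub>R v"] by linarith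
      then have "\<not> norm (x + t *\<^sub>R v) < R" "\<not> norm x < R"
        using False norm_ge_zero[of v] unfolding mem_cball_0 by linarith+
      then have "x + t *\<^sub>R v \<notin> \<Omega>" "x \<notin> \<Omega>" using R by auto
      then show ?thesis using test_fn_zero_outside[OF assms(1)] False by simp
    qed
  qed
qed

lemma test_fn_quotient_tendsto:
  assumes "test_fn \<Omega> f" "t \<longlonglongrightarrow> 0" "\<And>j. t j \<noteq> (0::real)"
  shows "(\<lambda>j. (f (x + t j *\<^sub>R v) - f x) / t j) \<longlonglongrightarrow> cgrad f x \<bullet> v"
proof -
  have "((\<lambda>s. f (x + s *\<^sub>R v)) has_derivative (\<lambda>h. cgrad f (x + 0 *\<^sub>R v) \<bullet> (h *\<^sub>R v))) (at 0)"
    by (rule has_derivative_compose[where f="\<lambda>s. x + s *\<^sub>R v" and g=f])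
       (use assms(1) smooth_fn_has_derivative in \<open>auto simp: test_fn_def intro!: derivative_eq_intros\<close>)
  then have "((\<lambda>s. f (x + s *\<^sub>R v)) has_field_derivative cgrad f x \<bullet> v) (at 0)"
    by (simp add: has_field_derivative_def mult.commute[of _ "cgrad f x \<bullet> v"])
  then have "((\<lambda>s. (f (x + s *\<^sub>R v) - f x) / s) \<longlongrightarrow> cgrad f x \<bullet> v) (at 0)"
    by (simp add: has_field_derivative_iff)
  moreover have "filterlim t (at 0) sequentially"
    using assms(2,3) by (simp add: filterlim_at)
  ultimately show ?thesis by (rule filterlim_compose)
qed

lemma inverse_Suc_tendsto: "(\<lambda>j. 1 / real (Suc j)) \<longlonglongrightarrow> 0"
  using LIMSEQ_inverse_real_of_nat by (simp add: inverse_eq_divide)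

text \<open>Discrete integration by parts: a change of variables moves the difference quotient from
  \<open>f\<close> to \<open>\<psi>\<close>, where the Lipschitz constant bounds it. No derivative
  of \<open>\<psi>\<close> occurs, so truncations are admissible multipliers, and the right-hand
  side tends to 0 with the L^1 norm of \<open>f\<close>.\<close>

lemma weak_gradient_bound:
  fixes \<psi> :: "'a::euclidean_space \<Rightarrow> real"
  assumes f: "test_fn \<Omega> f" "bounded \<Omega>"
    and \<psi>[measurable]: "\<psi> \<in> borel_measurable borel" and C: "\<And>x. \<bar>\<psi> x\<bar> \<le> C"
    and L: "\<And>x y. \<bar>\<psi> x - \<psi> y\<bar> \<le> L * norm (x - y)"
  shows "\<bar>\<integral>x. (cgrad f x \<bullet> v) * \<psi> x \<partial>lborel\<bar> \<le> L * norm v * (\<integral>x. \<bar>f x\<bar> \<partial>lborel)"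
proof -
  note [measurable] = test_fn_measurable[OF f(1)]
  have int: "integrable lborel f" using test_fn_integrable[OF f] .
  obtain w where w: "integrable lborel w" "\<And>t x. \<bar>t\<bar> \<le> 1 \<Longrightarrow> \<bar>(f (x + t *\<^sub>R v) - f x) / t\<bar> \<le> w x"
    using test_fn_quotient_dominated[OF f, of v] by metis
  have C0: "C \<ge> 0" using C[of 0] by linarith
  define t where "t j = 1 / real (Suc j)" for j
  have t: "t \<longlonglongrightarrow> 0" "\<And>j. t j > 0" "\<And>j. \<bar>t j\<bar> \<le> 1"
    using inverse_Suc_tendsto by (auto simp: t_def[abs_def])
  have lim: "(\<lambda>j. \<integral>x. (f (x + t j *\<^sub>R v) - f x) / t j * \<psi> x \<partial>lborel)
      \<longlonglongrightarrow> (\<integral>x. (cgrad f x \<bullet> v) * \<psi> x \<partial>lborel)"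
  proof (rule integral_dominated_convergence[where w="\<lambda>x. w x * C"])
    show "AE x in lborel. (\<lambda>j. (f (x + t j *\<^sub>R v) - f x) / t j * \<psi> x) \<longlonglongrightarrow> cgrad f x \<bullet> v * \<psi> x"
      using t by (intro AE_I2 tendsto_mult tendsto_const test_fn_quotient_tendsto[OF f(1)]) (auto simp: less_imp_neq[symmetric])
    show "AE x in lborel. norm ((f (x + t j *\<^sub>R v) - f x) / t j * \<psi> x) \<le> w x * C" for j
    proof (rule AE_I2)
      fix x
      have "\<bar>(f (x + t j *\<^sub>R v) - f x) / t j\<bar> * \<bar>\<psi> x\<bar> \<le> w x * C"
        using w(2)[OF t(3), of x j] C[of x] by (intro mult_mono) linarith+
      then show "norm ((f (x + t j *\<^sub>R v) - f x) / t j * \<psi> x) \<le> w x * C"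
        by (simp only: real_norm_def abs_mult)
    qed
    show "integrable lborel (\<lambda>x. w x * C)" using w by simp
  qed measurable
  have bnd: "\<bar>\<integral>x. (f (x + t j *\<^sub>R v) - f x) / t j * \<psi> x \<partial>lborel\<bar> \<le> L * norm v * (\<integral>x. \<bar>f x\<bar> \<partial>lborel)" for j
  proof -
    have i1: "integrable lborel (\<lambda>x. f x * \<psi> (x + u))" for u
      by (rule Bochner_Integration.integrable_bound[OF integrable_mult_left[OF int, of C]])
         (use C0 C in \<open>auto simp: abs_mult intro!: mult_left_mono\<close>)
    have i2: "integrable lborel (\<lambda>x. f (x + t j *\<^sub>R v) * \<psi> x)"
      using integrable_shift[OF i1[of "- t j *\<^sub>R v"], of "t j *\<^sub>R v"] by simp
    have sh: "(\<integral>x. f (x + t j *\<^sub>R v) * \<psi> x \<partial>lborel) = (\<integral>x. f x * \<psi> (x + (- t j *\<^sub>R v)) \<partial>lborel)"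
      using lborel_integral_shift[of "\<lambda>x. f x * \<psi> (x + (- t j *\<^sub>R v))" "t j *\<^sub>R v"] by simp
    \<comment> \<open>The argument is written \<open>x + 0\<close> so that \<open>i1\<close> applies
      at shift 0 as well as at the shift by \<open>- t j *\<^sub>R v\<close>.\<close>
    have "(\<integral>x. (f (x + t j *\<^sub>R v) - f x) / t j * \<psi> x \<partial>lborel)
       = (\<integral>x. (f (x + t j *\<^sub>R v) * \<psi> x - f x * \<psi> (x + 0)) / t j \<partial>lborel)"
      by (simp add: field_simps)
    also have "\<dots> = ((\<integral>x. f (x + t j *\<^sub>R v) * \<psi> x \<partial>lborel) - (\<integral>x. f x * \<psi> (x + 0) \<partial>lborel)) / t j"
      using Bochner_Integration.integral_diff[OF i2 i1[of 0]] by simp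
    also have "\<dots> = (\<integral>x. (f x * \<psi> (x + (- t j *\<^sub>R v)) - f x * \<psi> (x + 0)) / t j \<partial>lborel)"
      using Bochner_Integration.integral_diff[OF i1[of "- t j *\<^sub>R v"] i1[of 0]] by (simp add: sh)
    also have "\<bar>\<dots>\<bar> \<le> (\<integral>x. L * norm v * \<bar>f x\<bar> \<partial>lborel)"
    proof (rule order_trans[OF integral_abs_bound], rule integral_mono)
      show "integrable lborel (\<lambda>x. \<bar>(f x * \<psi> (x + (- t j *\<^sub>R v)) - f x * \<psi> (x + 0)) / t j\<bar>)"
        by (intro integrable_abs integrable_divide Bochner_Integration.integrable_diff i1)
      show "integrable lborel (\<lambda>x. L * norm v * \<bar>f x\<bar>)" using int by simp
      fix x
      have "\<bar>f x * \<psi> (x + (- t j *\<^sub>R v)) - f x * \<psi> (x + 0)\<bar> = \<bar>f x\<bar> * \<bar>\<psi> (x + (- t j *\<^sub>R v)) - \<psi> x\<bar>"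
        by (simp add: abs_mult[symmetric] right_diff_distrib)
      also have "\<dots> \<le> \<bar>f x\<bar> * (L * (t j * norm v))"
        using L[of "x + (- t j *\<^sub>R v)" x] t(2)[of j] by (intro mult_left_mono) auto
      finally show "\<bar>(f x * \<psi> (x + (- t j *\<^sub>R v)) - f x * \<psi> (x + 0)) / t j\<bar> \<le> L * norm v * \<bar>f x\<bar>"
        using t(2)[of j] by (simp add: abs_divide divide_le_eq mult_ac)
    qed
    finally show ?thesis by simp
  qed
  show ?thesis
    by (rule LIMSEQ_le_const2[OF tendsto_rabs[OF lim]]) (use bnd in blast)
qed

text \<open>Instead of integrating the gradient along a segment, the shift by \<open>v\<close> is
  cut into equal short shifts. By translation invariance each contributes the same L^1 amount, so
  the total is bounded by the L^1 norm of a difference quotient, which converges to the right-hand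
  side.\<close>

lemma translate_L1_bound:
  assumes f: "test_fn \<Omega> f" "bounded \<Omega>"
  shows "(\<integral>x. \<bar>f (x + v) - f x\<bar> \<partial>lborel) \<le> (\<integral>x. \<bar>cgrad f x \<bullet> v\<bar> \<partial>lborel)"
proof -
  note [measurable] = test_fn_measurable[OF f(1)]
  have int: "integrable lborel f" using test_fn_integrable[OF f] .
  obtain w where w: "integrable lborel w" "\<And>t x. \<bar>t\<bar> \<le> 1 \<Longrightarrow> \<bar>(f (x + t *\<^sub>R v) - f x) / t\<bar> \<le> w x"
    using test_fn_quotient_dominated[OF f, of v] by metis
  define t where "t j = 1 / real (Suc j)" for j
  have t: "t \<longlonglongrightarrow> 0" "\<And>j. t j > 0" "\<And>j. \<bar>t j\<bar> \<le> 1"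
    using inverse_Suc_tendsto by (auto simp: t_def[abs_def])
  have lim: "(\<lambda>j. \<integral>x. \<bar>(f (x + t j *\<^sub>R v) - f x) / t j\<bar> \<partial>lborel) \<longlonglongrightarrow> (\<integral>x. \<bar>cgrad f x \<bullet> v\<bar> \<partial>lborel)"
  proof (rule integral_dominated_convergence[where w=w])
    show "AE x in lborel. (\<lambda>j. \<bar>(f (x + t j *\<^sub>R v) - f x) / t j\<bar>) \<longlonglongrightarrow> \<bar>cgrad f x \<bullet> v\<bar>"
      using t by (intro AE_I2 tendsto_rabs test_fn_quotient_tendsto[OF f(1)]) (auto simp: less_imp_neq[symmetric])
    show "AE x in lborel. norm \<bar>(f (x + t j *\<^sub>R v) - f x) / t j\<bar> \<le> w x" for j
      using w(2)[OF t(3)] by (intro AE_I2) simp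
  qed (use w in measurable)
  have step: "(\<integral>x. \<bar>f (x + real i *\<^sub>R u) - f x\<bar> \<partial>lborel) \<le> real i * (\<integral>x. \<bar>f (x + u) - f x\<bar> \<partial>lborel)" for i u
  proof (induction i)
    case (Suc i)
    have I: "integrable lborel (\<lambda>x. \<bar>f (x + a) - f (x + b)\<bar>)" for a b
      by (intro integrable_abs Bochner_Integration.integrable_diff integrable_shift int)
    have "(\<integral>x. \<bar>f (x + real (Suc i) *\<^sub>R u) - f x\<bar> \<partial>lborel)
       \<le> (\<integral>x. \<bar>f (x + real (Suc i) *\<^sub>R u) - f (x + real i *\<^sub>R u)\<bar> + \<bar>f (x + real i *\<^sub>R u) - f (x + 0)\<bar> \<partial>lborel)"
      using I[of "real (Suc i) *\<^sub>R u" 0] by (intro integral_mono Bochner_Integration.integrable_add I) auto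
    also have "\<dots> = (\<integral>x. \<bar>f (x + real (Suc i) *\<^sub>R u) - f (x + real i *\<^sub>R u)\<bar> \<partial>lborel)
       + (\<integral>x. \<bar>f (x + real i *\<^sub>R u) - f (x + 0)\<bar> \<partial>lborel)"
      by (intro Bochner_Integration.integral_add I)
    also have "(\<integral>x. \<bar>f (x + real (Suc i) *\<^sub>R u) - f (x + real i *\<^sub>R u)\<bar> \<partial>lborel)
       = (\<integral>x. \<bar>f (x + u) - f x\<bar> \<partial>lborel)"
      using lborel_integral_shift[of "\<lambda>x. \<bar>f (x + u) - f x\<bar>" "real i *\<^sub>R u"]
      by (simp add: algebra_simps)
    finally show ?case using Suc by (simp add: algebra_simps)
  qed simp
  have "(\<integral>x. \<bar>f (x + v) - f x\<bar> \<partial>lborel) \<le> (\<integral>x. \<bar>(f (x + t j *\<^sub>R v) - f x) / t j\<bar> \<partial>lborel)" for j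
  proof -
    \<comment> \<open>With t j = 1/(j+1), exactly \<open>Suc j\<close> short shifts make up
      \<open>v\<close>, and multiplying by their number is the same as dividing by the step.\<close>
    have "real (Suc j) *\<^sub>R (t j *\<^sub>R v) = v" by (simp add: t_def)
    with step[of "Suc j" "t j *\<^sub>R v"]
    have "(\<integral>x. \<bar>f (x + v) - f x\<bar> \<partial>lborel) \<le> real (Suc j) * (\<integral>x. \<bar>f (x + t j *\<^sub>R v) - f x\<bar> \<partial>lborel)"
      by simp
    also have "\<dots> = (\<integral>x. \<bar>f (x + t j *\<^sub>R v) - f x\<bar> / t j \<partial>lborel)"
      by (simp add: t_def)
    also have "\<dots> = (\<integral>x. \<bar>(f (x + t j *\<^sub>R v) - f x) / t j\<bar> \<partial>lborel)"
      using t(2)[of j] by simp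
    finally show ?thesis .
  qed
  then show ?thesis by (intro LIMSEQ_le_const[OF lim]) blast
qed

lemma directional_poincare_L1:
  assumes f: "test_fn \<Omega> f" "bounded \<Omega>" and R: "\<Omega> \<subseteq> ball 0 R" "2 * R \<le> norm v"
  shows "2 * (\<integral>x. \<bar>f x\<bar> \<partial>lborel) \<le> (\<integral>x. \<bar>cgrad f x \<bullet> v\<bar> \<partial>lborel)"
proof -
  note [measurable] = test_fn_measurable[OF f(1)]
  have int: "integrable lborel f" using test_fn_integrable[OF f] .
  \<comment> \<open>Two points of the open ball of radius R are less than 2R apart. Hence at most
    one of the two values of \<open>f\<close> below is nonzero, which is where the factor 2 comes
    from.\<close>
  have "x \<notin> \<Omega> \<or> x + v \<notin> \<Omega>" for x
  proof (rule ccontr)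
    assume "\<not> (x \<notin> \<Omega> \<or> x + v \<notin> \<Omega>)"
    then have "norm x < R" "norm (x + v) < R" using R(1) by auto
    then show False using R(2) norm_triangle_ineq4[of "x + v" x] by simp
  qed
  then have "\<bar>f (x + v) - f x\<bar> = \<bar>f (x + v)\<bar> + \<bar>f x\<bar>" for x
    using test_fn_zero_outside[OF f(1)] by (metis abs_0 abs_minus_cancel add.right_neutral add_0 diff_0 diff_zero)
  then have "(\<integral>x. \<bar>f (x + v) - f x\<bar> \<partial>lborel) = (\<integral>x. \<bar>f (x + v)\<bar> \<partial>lborel) + (\<integral>x. \<bar>f x\<bar> \<partial>lborel)"
    using Bochner_Integration.integral_add[OF integrable_abs[OF integrable_shift[OF int, of v]] integrable_abs[OF int]]
    by simp
  also have "(\<integral>x. \<bar>f (x + v)\<bar> \<partial>lborel) = (\<integral>x. \<bar>f x\<bar> \<partial>lborel)"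
    by (rule lborel_integral_shift) simp
  finally show ?thesis using translate_L1_bound[OF f, of v] by simp
qed

subsection \<open>Functions in the zero-trace Sobolev space\<close>

text \<open>An elementary substitute for the Hoelder inequality: on a set of finite measure the
  constant term costs little for small \<open>e\<close>, and the remainder is controlled by the p-th
  power.\<close>

lemma linear_le_powr:
  fixes y e p :: real
  assumes "0 < e" "1 \<le> p" "0 \<le> y"
  shows "y \<le> e + e powr (1 - p) * y powr p"
proof (cases "y \<le> e")
  case False
  then have "y powr (1 - p) \<le> e powr (1 - p)" using assms by (intro powr_mono2') auto
  then have "y powr (1 - p) * y powr p \<le> e powr (1 - p) * y powr p" by (intro mult_right_mono) auto
  moreover have "y powr (1 - p) * y powr p = y" using False assms by (simp add: powr_add[symmetric])
  ultimately show ?thesis using assms by linarith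
qed (use assms in \<open>simp add: add_increasing2\<close>)

lemma powr_add_le:
  fixes a b p :: real
  assumes "0 \<le> a" "0 \<le> b" "0 \<le> p"
  shows "(a + b) powr p \<le> 2 powr p * (a powr p + b powr p)"
proof -
  have "(a + b) powr p \<le> (2 * max a b) powr p" using assms by (intro powr_mono2) auto
  also have "\<dots> = 2 powr p * max a b powr p" using assms by (simp add: powr_mult)
  also have "max a b powr p \<le> a powr p + b powr p" by (auto simp: max_def)
  finally show ?thesis by simp
qed

lemma Lp_tendsto_imp_L1_tendsto:
  fixes h :: "nat \<Rightarrow> 'a \<Rightarrow> real"
  assumes p: "1 \<le> p" and A: "A \<in> sets M" "emeasure M A < \<infinity>"
    and h[measurable]: "\<And>k. h k \<in> borel_measurable M" and h0: "\<And>k x. 0 \<le> h k x"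
    and hA: "\<And>k. AE x in M. x \<notin> A \<longrightarrow> h k x = 0"
    and lim: "(\<lambda>k. \<integral>\<^sup>+x. ennreal (h k x powr p) \<partial>M) \<longlonglongrightarrow> 0"
  shows "(\<lambda>k. \<integral>\<^sup>+x. ennreal (h k x) \<partial>M) \<longlonglongrightarrow> 0"
proof (rule tendsto_zero_ennreal)
  fix r :: real assume r: "0 < r"
  define m where "m = measure M A"
  have mA: "emeasure M A = ennreal m" using A(2) by (simp add: m_def emeasure_eq_ennreal_measure)
  have m0: "m \<ge> 0" by (simp add: m_def)
  \<comment> \<open>Half of the tolerance r is spent on the constant term over A and half on the
    p-th powers; the summand 1 covers m = 0.\<close>
  define e where "e = r / (2 * (m + 1))"
  have e: "0 < e" "e * m < r / 2" using r m0 by (auto simp: e_def field_simps)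
  define d where "d = (r / 2) / (e powr (1 - p))"
  have d: "0 < d" "e powr (1 - p) * d = r / 2" using r e by (auto simp: d_def)
  have "eventually (\<lambda>k. (\<integral>\<^sup>+x. ennreal (h k x powr p) \<partial>M) < ennreal d) sequentially"
    using d by (intro order_tendstoD(2)[OF lim]) (auto simp: ennreal_less_iff)
  then show "eventually (\<lambda>k. (\<integral>\<^sup>+x. ennreal (h k x) \<partial>M) < ennreal r) sequentially"
  proof eventually_elim
    case (elim k)
    have "(\<integral>\<^sup>+x. ennreal (h k x) \<partial>M)
        \<le> (\<integral>\<^sup>+x. ennreal e * indicator A x + ennreal (e powr (1 - p)) * ennreal (h k x powr p) \<partial>M)"
    proof (rule nn_integral_mono_AE)
      show "AE x in M. ennreal (h k x) \<le> ennreal e * indicator A x + ennreal (e powr (1 - p)) * ennreal (h k x powr p)"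
        using hA[of k]
      proof eventually_elim
        case (elim x)
        show ?case
        proof (cases "x \<in> A")
          case True
          have "ennreal (h k x) \<le> ennreal (e + e powr (1 - p) * h k x powr p)"
            by (intro ennreal_leI linear_le_powr e p h0)
          then show ?thesis using True e by (simp add: ennreal_plus ennreal_mult)
        qed (use elim in simp)
      qed
    qed
    also have "\<dots> = ennreal (e * m) + ennreal (e powr (1 - p)) * (\<integral>\<^sup>+x. ennreal (h k x powr p) \<partial>M)"
      using A(1) e m0 by (subst nn_integral_add) (auto simp: nn_integral_cmult nn_integral_cmult_indicator mA ennreal_mult)
    also have "\<dots> \<le> ennreal (e * m) + ennreal (e powr (1 - p)) * ennreal d"
      using elim by (intro add_left_mono mult_left_mono) auto
    also have "\<dots> = ennreal (e * m + r / 2)"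
      using e m0 d r by (simp add: ennreal_plus ennreal_mult[symmetric])
    also have "\<dots> < ennreal r" using e r m0 by (intro ennreal_lessI) auto
    finally show ?case .
  qed
qed

lemma Lp_limit_zero_outside:
  fixes F :: "nat \<Rightarrow> 'a \<Rightarrow> 'b::euclidean_space"
  assumes [measurable]: "\<And>k. F k \<in> borel_measurable M" "u \<in> borel_measurable M" "\<Omega> \<in> sets M"
    and F0: "\<And>k x. x \<notin> \<Omega> \<Longrightarrow> F k x = 0"
    and lim: "(\<lambda>k. \<integral>\<^sup>+x. ennreal (norm (F k x - u x) powr p) \<partial>M) \<longlonglongrightarrow> 0"
  shows "AE x in M. x \<notin> \<Omega> \<longrightarrow> u x = 0"
proof -
  let ?I = "\<integral>\<^sup>+x. ennreal (norm (u x) powr p) * indicator (space M - \<Omega>) x \<partial>M"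
  have "?I \<le> (\<integral>\<^sup>+x. ennreal (norm (F k x - u x) powr p) \<partial>M)" for k
    by (intro nn_integral_mono) (auto split: split_indicator simp: F0)
  then have "?I \<le> 0" by (intro LIMSEQ_le_const[OF lim]) blast
  then have "?I = 0" by simp
  then have "AE x in M. ennreal (norm (u x) powr p) * indicator (space M - \<Omega>) x = 0"
    by (subst (asm) nn_integral_0_iff_AE) auto
  with AE_space show ?thesis
    by eventually_elim (auto split: split_indicator_asm)
qed

text \<open>One approximant at distance below 1 suffices, with \<open>powr_add_le\<close> in the
  role of the triangle inequality.\<close>

lemma Lp_limit_integrable_powr:
  fixes F :: "nat \<Rightarrow> 'a \<Rightarrow> 'b::euclidean_space"
  assumes p: "0 \<le> p"
    and [measurable]: "\<And>k. F k \<in> borel_measurable M" "u \<in> borel_measurable M"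
    and F: "\<And>k. integrable M (\<lambda>x. norm (F k x) powr p)"
    and lim: "(\<lambda>k. \<integral>\<^sup>+x. ennreal (norm (F k x - u x) powr p) \<partial>M) \<longlonglongrightarrow> 0"
  shows "integrable M (\<lambda>x. norm (u x) powr p)"
proof -
  have "eventually (\<lambda>k. (\<integral>\<^sup>+x. ennreal (norm (F k x - u x) powr p) \<partial>M) < 1) sequentially"
    by (rule order_tendstoD(2)[OF lim]) simp
  then obtain k where k: "(\<integral>\<^sup>+x. ennreal (norm (F k x - u x) powr p) \<partial>M) < 1"
    by (auto simp: eventually_sequentially)
  have "integrable M (\<lambda>x. norm (F k x - u x) powr p)"
    using k by (intro integrableI_nonneg) (auto simp: less_trans[OF _ ennreal_one_less_top])
  then have "integrable M (\<lambda>x. 2 powr p * (norm (F k x - u x) powr p + norm (F k x) powr p))"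
    using F by simp
  then show ?thesis
  proof (rule Bochner_Integration.integrable_bound)
    have "norm (u x) powr p \<le> 2 powr p * (norm (F k x - u x) powr p + norm (F k x) powr p)" for x
    proof -
      have "norm (u x) powr p \<le> (norm (F k x - u x) + norm (F k x)) powr p"
        using p norm_triangle_sub[of "u x" "F k x"]
        by (intro powr_mono2) (auto simp: norm_minus_commute add.commute)
      then show ?thesis using powr_add_le[of "norm (F k x - u x)" "norm (F k x)" p] p by simp
    qed
    then show "AE x in M. norm (norm (u x) powr p) \<le> norm (2 powr p * (norm (F k x - u x) powr p + norm (F k x) powr p))"
      by (intro AE_I2) (simp add: add_nonneg_nonneg)
  qed measurable
qed

lemma integrable_of_powr:
  fixes u :: "'a \<Rightarrow> 'b::euclidean_space"
  assumes p: "1 \<le> p" and A: "A \<in> sets M" "emeasure M A < \<infinity>"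
    and u[measurable]: "u \<in> borel_measurable M" and uA: "AE x in M. x \<notin> A \<longrightarrow> u x = 0"
    and int: "integrable M (\<lambda>x. norm (u x) powr p)"
  shows "integrable M u"
proof (rule Bochner_Integration.integrable_bound[OF _ u])
  show "integrable M (\<lambda>x. indicator A x + norm (u x) powr p)"
    using A int by (intro Bochner_Integration.integrable_add) auto
  show "AE x in M. norm (u x) \<le> norm (indicator A x + norm (u x) powr p)"
    using uA
  proof eventually_elim
    case (elim x)
    then show ?case using linear_le_powr[of 1 p "norm (u x)"] p
      by (cases "x \<in> A") auto
  qed
qed

lemma integrable_powr_bounded_support:
  fixes F :: "'a::euclidean_space \<Rightarrow> 'b::euclidean_space"
  assumes [measurable]: "F \<in> borel_measurable borel" and p: "0 < p"
    and "bounded \<Omega>" "\<And>x. x \<notin> \<Omega> \<Longrightarrow> F x = 0" "\<And>x. norm (F x) \<le> B"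
  shows "integrable lborel (\<lambda>x. norm (F x) powr p)"
proof (rule integrable_bounded_support[where S=\<Omega> and B="B powr p"])
  show "\<bar>norm (F x) powr p\<bar> \<le> B powr p" for x
    using assms(5)[of x] p by (simp add: powr_mono2)
qed (use assms in auto)

text \<open>The gradient is a free parameter rather than \<open>wgrad\<close>, so that the results
  apply to explicit linear combinations and to the zero function paired with the difference of two
  candidate gradients.\<close>

locale sobolev_pair =
  fixes \<Omega> :: "'a::euclidean_space set" and p u g
  assumes p: "1 < p" and \<Omega>: "bounded \<Omega>" "open \<Omega>" and pair: "sob0_pair \<Omega> p u g"
begin

lemma measurable_u [measurable]: "u \<in> borel_measurable borel"
  and measurable_g [measurable]: "g \<in> borel_measurable borel"
  using pair by (auto simp: sob0_pair_def)

lemma \<Omega>_sets [measurable]: "\<Omega> \<in> sets borel"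
  using \<Omega> by simp

lemma \<Omega>_emeasure: "emeasure lborel \<Omega> < \<infinity>"
  using emeasure_bounded_finite[OF \<Omega>(1)] .

definition \<phi> :: "nat \<Rightarrow> 'a \<Rightarrow> real" where
  "\<phi> = (SOME \<phi>. (\<forall>k. test_fn \<Omega> (\<phi> k)) \<and>
        (\<lambda>k. \<integral>\<^sup>+x. ennreal (\<bar>\<phi> k x - u x\<bar> powr p) \<partial>lborel) \<longlonglongrightarrow> 0 \<and>
        (\<lambda>k. \<integral>\<^sup>+x. ennreal (norm (cgrad (\<phi> k) x - g x) powr p) \<partial>lborel) \<longlonglongrightarrow> 0)"

lemma \<phi>: "test_fn \<Omega> (\<phi> k)"
    "(\<lambda>k. \<integral>\<^sup>+x. ennreal (norm (\<phi> k x - u x) powr p) \<partial>lborel) \<longlonglongrightarrow> 0"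
    "(\<lambda>k. \<integral>\<^sup>+x. ennreal (norm (cgrad (\<phi> k) x - g x) powr p) \<partial>lborel) \<longlonglongrightarrow> 0"
proof -
  have "\<exists>\<phi>. (\<forall>k. test_fn \<Omega> (\<phi> k)) \<and>
        (\<lambda>k. \<integral>\<^sup>+x. ennreal (\<bar>\<phi> k x - u x\<bar> powr p) \<partial>lborel) \<longlonglongrightarrow> 0 \<and>
        (\<lambda>k. \<integral>\<^sup>+x. ennreal (norm (cgrad (\<phi> k) x - g x) powr p) \<partial>lborel) \<longlonglongrightarrow> 0"
    using pair by (simp add: sob0_pair_def)
  from someI_ex[OF this, folded \<phi>_def]
  show "test_fn \<Omega> (\<phi> k)"
    "(\<lambda>k. \<integral>\<^sup>+x. ennreal (norm (\<phi> k x - u x) powr p) \<partial>lborel) \<longlonglongrightarrow> 0"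
    "(\<lambda>k. \<integral>\<^sup>+x. ennreal (norm (cgrad (\<phi> k) x - g x) powr p) \<partial>lborel) \<longlonglongrightarrow> 0" by simp_all
qed

lemma \<phi>_measurable [measurable]: "\<phi> k \<in> borel_measurable borel" "cgrad (\<phi> k) \<in> borel_measurable borel"
  using test_fn_measurable[OF \<phi>(1)] by auto

lemma u_zero_outside: "AE x in lborel. x \<notin> \<Omega> \<longrightarrow> u x = 0"
  by (rule Lp_limit_zero_outside[OF _ _ _ _ \<phi>(2)]) (use test_fn_zero_outside[OF \<phi>(1)] in auto)

lemma g_zero_outside: "AE x in lborel. x \<notin> \<Omega> \<longrightarrow> g x = 0"
  by (rule Lp_limit_zero_outside[OF _ _ _ _ \<phi>(3)]) (use test_fn_cgrad_zero_outside[OF \<phi>(1)] in auto)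

lemma u_powr_integrable: "integrable lborel (\<lambda>x. \<bar>u x\<bar> powr p)"
proof -
  have "integrable lborel (\<lambda>x. norm (\<phi> k x) powr p)" for k
  proof -
    obtain B where B: "\<And>x. \<bar>\<phi> k x\<bar> \<le> B" using test_fn_bounded[OF \<phi>(1)] by metis
    show ?thesis
      by (rule integrable_powr_bounded_support[where \<Omega>=\<Omega> and B=B])
         (use p \<Omega> B test_fn_zero_outside[OF \<phi>(1)] in auto)
  qed
  then show ?thesis using Lp_limit_integrable_powr[OF _ _ _ _ \<phi>(2)] p by simp
qed

lemma g_powr_integrable: "integrable lborel (\<lambda>x. norm (g x) powr p)"
proof -
  have "integrable lborel (\<lambda>x. norm (cgrad (\<phi> k) x) powr p)" for k
  proof -
    obtain B where B: "\<And>x. norm (cgrad (\<phi> k) x) \<le> B" using test_fn_cgrad_bounded[OF \<phi>(1)] by metis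
    show ?thesis
      by (rule integrable_powr_bounded_support[where \<Omega>=\<Omega> and B=B])
         (use p \<Omega> B test_fn_cgrad_zero_outside[OF \<phi>(1)] in auto)
  qed
  then show ?thesis using Lp_limit_integrable_powr[OF _ _ _ _ \<phi>(3)] p by simp
qed

lemma u_integrable: "integrable lborel u"
  using integrable_of_powr[where p=p, OF _ _ \<Omega>_emeasure _ u_zero_outside] u_powr_integrable p by simp

lemma g_integrable: "integrable lborel g"
  using integrable_of_powr[where p=p, OF _ _ \<Omega>_emeasure _ g_zero_outside] g_powr_integrable p by simp

lemma \<phi>_tendsto_L1: "(\<lambda>k. \<integral>\<^sup>+x. ennreal (norm (\<phi> k x - u x)) \<partial>lborel) \<longlonglongrightarrow> 0"
proof (rule Lp_tendsto_imp_L1_tendsto[OF _ _ \<Omega>_emeasure _ _ _ \<phi>(2)])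
  show "AE x in lborel. x \<notin> \<Omega> \<longrightarrow> norm (\<phi> k x - u x) = 0" for k
    using u_zero_outside by eventually_elim (simp add: test_fn_zero_outside[OF \<phi>(1)])
qed (use p in simp_all)

lemma cgrad_tendsto_L1: "(\<lambda>k. \<integral>\<^sup>+x. ennreal (norm (cgrad (\<phi> k) x - g x)) \<partial>lborel) \<longlonglongrightarrow> 0"
proof (rule Lp_tendsto_imp_L1_tendsto[OF _ _ \<Omega>_emeasure _ _ _ \<phi>(3)])
  show "AE x in lborel. x \<notin> \<Omega> \<longrightarrow> norm (cgrad (\<phi> k) x - g x) = 0" for k
    using g_zero_outside by eventually_elim (simp add: test_fn_cgrad_zero_outside[OF \<phi>(1)])
qed (use p in simp_all)

lemma abs_\<phi>_integral_tendsto: "(\<lambda>k. \<integral>x. \<bar>\<phi> k x\<bar> \<partial>lborel) \<longlonglongrightarrow> (\<integral>x. \<bar>u x\<bar> \<partial>lborel)"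
proof (rule tendsto_L1_int)
  show "(\<lambda>k. \<integral>\<^sup>+x. ennreal (norm (\<bar>\<phi> k x\<bar> - \<bar>u x\<bar>)) \<partial>lborel) \<longlonglongrightarrow> 0"
    by (rule tendsto_sandwich[OF _ _ tendsto_const \<phi>_tendsto_L1])
       (auto intro!: nn_integral_mono always_eventually ennreal_leI)
qed (use u_integrable test_fn_integrable[OF \<phi>(1) \<Omega>(1)] in auto)

lemma directional_tendsto_L1:
  "(\<lambda>k. \<integral>\<^sup>+x. ennreal (norm (cgrad (\<phi> k) x \<bullet> v - g x \<bullet> v)) \<partial>lborel) \<longlonglongrightarrow> 0"
proof (rule tendsto_sandwich[OF _ _ tendsto_const])
  have "(\<lambda>k. ennreal (norm v) * (\<integral>\<^sup>+x. ennreal (norm (cgrad (\<phi> k) x - g x)) \<partial>lborel)) \<longlonglongrightarrow> ennreal (norm v) * 0"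
    by (intro ennreal_tendsto_cmult cgrad_tendsto_L1) simp
  then show "(\<lambda>k. ennreal (norm v) * (\<integral>\<^sup>+x. ennreal (norm (cgrad (\<phi> k) x - g x)) \<partial>lborel)) \<longlonglongrightarrow> 0"
    by simp
  show "\<forall>\<^sub>F k in sequentially. (\<integral>\<^sup>+x. ennreal (norm (cgrad (\<phi> k) x \<bullet> v - g x \<bullet> v)) \<partial>lborel)
    \<le> ennreal (norm v) * (\<integral>\<^sup>+x. ennreal (norm (cgrad (\<phi> k) x - g x)) \<partial>lborel)"
  proof (intro always_eventually allI)
    fix k
    have "(\<integral>\<^sup>+x. ennreal (norm (cgrad (\<phi> k) x \<bullet> v - g x \<bullet> v)) \<partial>lborel)
      \<le> (\<integral>\<^sup>+x. ennreal (norm v) * ennreal (norm (cgrad (\<phi> k) x - g x)) \<partial>lborel)"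
    proof (rule nn_integral_mono)
      fix x
      show "ennreal (norm (cgrad (\<phi> k) x \<bullet> v - g x \<bullet> v)) \<le> ennreal (norm v) * ennreal (norm (cgrad (\<phi> k) x - g x))"
        using Cauchy_Schwarz_ineq2[of "cgrad (\<phi> k) x - g x" v]
        by (auto simp: ennreal_mult[symmetric] inner_diff_left mult.commute intro!: ennreal_leI)
    qed
    then show "(\<integral>\<^sup>+x. ennreal (norm (cgrad (\<phi> k) x \<bullet> v - g x \<bullet> v)) \<partial>lborel)
      \<le> ennreal (norm v) * (\<integral>\<^sup>+x. ennreal (norm (cgrad (\<phi> k) x - g x)) \<partial>lborel)"
      by (simp add: nn_integral_cmult)
  qed
qed simp

lemma g_inner_integrable: "integrable lborel (\<lambda>x. g x \<bullet> v)"
  using g_integrable by simp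

text \<open>The truncation of a partial derivative of an approximating test function is a bounded Lipschitz
  multiplier; in the limit it tests the weak gradient against its own truncation.\<close>
lemma gradient_zero:
  assumes u0: "AE x in lborel. u x = 0"
  shows "AE x in lborel. g x = 0"
proof -
  define clamp where "clamp y = max (-1) (min 1 y)" for y :: real
  have clamp_le: "\<bar>clamp y\<bar> \<le> 1" "\<bar>clamp y - clamp z\<bar> \<le> \<bar>y - z\<bar>" for y z by (auto simp: clamp_def)
  have clamp_cont: "continuous_on UNIV clamp" unfolding clamp_def by (intro continuous_intros)
  then have [measurable]: "clamp \<in> borel_measurable borel" by (rule borel_measurable_continuous_onI)
  have "AE x in lborel. g x \<bullet> b = 0" if b: "b \<in> Basis" for b
  proof -
    \<comment> \<open>The multiplier is frozen at index j while the approximants run through k. Its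
      Lipschitz constant L depends on j only, so the bound L |b| times the L^1 norm of
      \<open>\<phi> k\<close> tends to 0; only afterwards does j go to infinity.\<close>
    have orth: "(\<integral>x. (g x \<bullet> b) * clamp (cgrad (\<phi> j) x \<bullet> b) \<partial>lborel) = 0" for j
    proof -
      let ?\<psi> = "\<lambda>x. clamp (cgrad (\<phi> j) x \<bullet> b)"
      have "cgrad (\<phi> j) x \<bullet> b = frechet_derivative (\<phi> j) (at x) b" for x
        using \<phi>(1) by (intro cgrad_inner smooth_fn_differentiable) (auto simp: test_fn_def)
      then obtain L where L: "\<And>x y. \<bar>cgrad (\<phi> j) x \<bullet> b - cgrad (\<phi> j) y \<bullet> b\<bar> \<le> L * norm (x - y)"
        using test_fn_lipschitz[OF test_fn_deriv[OF \<phi>(1) b]] by metis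
      have lim: "(\<lambda>k. \<integral>x. (cgrad (\<phi> k) x \<bullet> b) * ?\<psi> x \<partial>lborel) \<longlonglongrightarrow> (\<integral>x. (g x \<bullet> b) * ?\<psi> x \<partial>lborel)"
      proof (rule tendsto_L1_int)
        show "integrable lborel (\<lambda>x. cgrad (\<phi> k) x \<bullet> b * ?\<psi> x)" for k
          by (rule Bochner_Integration.integrable_bound[OF test_fn_cgrad_integrable[OF \<phi>(1) \<Omega>(1), of k b]])
             (use clamp_le in \<open>auto simp: abs_mult intro!: mult_left_le\<close>)
        show "integrable lborel (\<lambda>x. g x \<bullet> b * ?\<psi> x)"
          by (rule Bochner_Integration.integrable_bound[OF g_inner_integrable[of b]])
             (use clamp_le in \<open>auto simp: abs_mult intro!: mult_left_le\<close>)
        show "(\<lambda>k. \<integral>\<^sup>+x. ennreal (norm (cgrad (\<phi> k) x \<bullet> b * ?\<psi> x - g x \<bullet> b * ?\<psi> x)) \<partial>lborel) \<longlonglongrightarrow> 0"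
        proof (rule tendsto_sandwich[OF _ _ tendsto_const directional_tendsto_L1[of b]])
          show "\<forall>\<^sub>F k in sequentially. (\<integral>\<^sup>+x. ennreal (norm (cgrad (\<phi> k) x \<bullet> b * ?\<psi> x - g x \<bullet> b * ?\<psi> x)) \<partial>lborel)
            \<le> (\<integral>\<^sup>+x. ennreal (norm (cgrad (\<phi> k) x \<bullet> b - g x \<bullet> b)) \<partial>lborel)"
            using clamp_le(1)
            by (intro always_eventually allI nn_integral_mono ennreal_leI)
               (auto simp: left_diff_distrib[symmetric] abs_mult intro!: mult_left_le)
        qed simp
      qed
      have "(\<lambda>k. L * norm b * (\<integral>x. \<bar>\<phi> k x\<bar> \<partial>lborel)) \<longlonglongrightarrow> L * norm b * (\<integral>x. \<bar>u x\<bar> \<partial>lborel)"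
        by (intro tendsto_intros abs_\<phi>_integral_tendsto)
      moreover have "(\<integral>x. \<bar>u x\<bar> \<partial>lborel) = 0" using u0 by (subst integral_cong_AE[where g="\<lambda>_. 0"]) auto
      ultimately have z: "(\<lambda>k. L * norm b * (\<integral>x. \<bar>\<phi> k x\<bar> \<partial>lborel)) \<longlonglongrightarrow> 0" by simp
      have "\<bar>\<integral>x. (cgrad (\<phi> k) x \<bullet> b) * ?\<psi> x \<partial>lborel\<bar> \<le> L * norm b * (\<integral>x. \<bar>\<phi> k x\<bar> \<partial>lborel)" for k
        using clamp_le order_trans[OF clamp_le(2) L]
        by (intro weak_gradient_bound[OF \<phi>(1) \<Omega>(1), where C=1]) auto
      then have "(\<lambda>k. \<integral>x. (cgrad (\<phi> k) x \<bullet> b) * ?\<psi> x \<partial>lborel) \<longlonglongrightarrow> 0"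
        by (intro Lim_null_comparison[OF _ z] always_eventually) simp
      with lim show ?thesis by (rule LIMSEQ_unique)
    qed
    have "(\<lambda>k. \<integral>x. norm (cgrad (\<phi> k) x \<bullet> b - g x \<bullet> b) \<partial>lborel) \<longlonglongrightarrow> (\<integral>x. (0::real) \<partial>(lborel::'a measure))"
      by (rule tendsto_L1_int)
         (use directional_tendsto_L1[of b] test_fn_cgrad_integrable[OF \<phi>(1) \<Omega>(1)] g_inner_integrable in auto)
    \<comment> \<open>L^1 convergence gives pointwise convergence almost everywhere along a
      subsequence, which is what passing to the limit inside \<open>clamp\<close> requires.\<close>
    then obtain r :: "nat \<Rightarrow> nat" where r: "AE x in lborel. (\<lambda>n. cgrad (\<phi> (r n)) x \<bullet> b - g x \<bullet> b) \<longlonglongrightarrow> 0"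
      using tendsto_L1_AE_subseq[of lborel "\<lambda>k x. cgrad (\<phi> k) x \<bullet> b - g x \<bullet> b"]
        test_fn_cgrad_integrable[OF \<phi>(1) \<Omega>(1)] g_inner_integrable by auto
    have "(\<lambda>n. \<integral>x. (g x \<bullet> b) * clamp (cgrad (\<phi> (r n)) x \<bullet> b) \<partial>lborel) \<longlonglongrightarrow> (\<integral>x. (g x \<bullet> b) * clamp (g x \<bullet> b) \<partial>lborel)"
    proof (rule integral_dominated_convergence[where w="\<lambda>x. \<bar>g x \<bullet> b\<bar>"])
      show "AE x in lborel. (\<lambda>n. (g x \<bullet> b) * clamp (cgrad (\<phi> (r n)) x \<bullet> b)) \<longlonglongrightarrow> (g x \<bullet> b) * clamp (g x \<bullet> b)"
        using r
      proof eventually_elim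
        case (elim x)
        then have "(\<lambda>n. cgrad (\<phi> (r n)) x \<bullet> b) \<longlonglongrightarrow> g x \<bullet> b" by (simp add: LIM_zero_iff)
        then show ?case
          by (intro tendsto_mult tendsto_const continuous_on_tendsto_compose[OF clamp_cont]) auto
      qed
      show "AE x in lborel. norm ((g x \<bullet> b) * clamp (cgrad (\<phi> (r n)) x \<bullet> b)) \<le> \<bar>g x \<bullet> b\<bar>" for n
        using clamp_le(1) by (auto simp: abs_mult intro!: mult_left_le)
    qed (use g_inner_integrable in auto)
    then have zero: "(\<integral>x. (g x \<bullet> b) * clamp (g x \<bullet> b) \<partial>lborel) = 0"
      unfolding orth by (simp add: LIMSEQ_const_iff)
    have "integrable lborel (\<lambda>x. (g x \<bullet> b) * clamp (g x \<bullet> b))"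
      by (rule Bochner_Integration.integrable_bound[OF g_inner_integrable[of b]])
         (use clamp_le in \<open>auto simp: abs_mult intro!: mult_left_le\<close>)
    \<comment> \<open>The product of y with its truncation is nonnegative and vanishes only at y =
      0, so a zero integral forces the component of the gradient to vanish.\<close>
    moreover have "0 \<le> y * clamp y" for y by (auto simp: clamp_def zero_le_mult_iff)
    ultimately have "AE x in lborel. (g x \<bullet> b) * clamp (g x \<bullet> b) = 0"
      using zero by (subst (asm) integral_nonneg_eq_0_iff_AE) auto
    then show ?thesis by eventually_elim (auto simp: clamp_def max_def min_def split: if_splits)
  qed
  then have "AE x in lborel. \<forall>b\<in>Basis. g x \<bullet> b = 0" by (intro AE_finite_allI) auto
  then show ?thesis by eventually_elim (simp add: euclidean_all_zero_iff)
qed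

lemma zero_if_directional_zero:
  assumes v: "v \<noteq> 0" and g0: "AE x in lborel. g x \<bullet> v = 0"
  shows "AE x in lborel. u x = 0"
proof -
  obtain R where R: "\<Omega> \<subseteq> ball 0 R" using bounded_subset_ballD[OF \<Omega>(1)] by blast
  \<comment> \<open>The hypothesis is invariant under scaling, so v is stretched to length 2|R|, the
    length at which the Poincare inequality applies.\<close>
  define v' where "v' = (2 * \<bar>R\<bar> / norm v) *\<^sub>R v"
  have "2 * R \<le> norm v'" using v by (simp add: v'_def)
  then have le: "2 * (\<integral>x. \<bar>\<phi> k x\<bar> \<partial>lborel) \<le> (\<integral>x. \<bar>cgrad (\<phi> k) x \<bullet> v'\<bar> \<partial>lborel)" for k
    using directional_poincare_L1[OF \<phi>(1) \<Omega>(1) R] by simp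
  have "(\<lambda>k. \<integral>x. \<bar>cgrad (\<phi> k) x \<bullet> v'\<bar> \<partial>lborel) \<longlonglongrightarrow> (\<integral>x. \<bar>g x \<bullet> v'\<bar> \<partial>lborel)"
  proof (rule tendsto_L1_int)
    show "(\<lambda>k. \<integral>\<^sup>+x. ennreal (norm (\<bar>cgrad (\<phi> k) x \<bullet> v'\<bar> - \<bar>g x \<bullet> v'\<bar>)) \<partial>lborel) \<longlonglongrightarrow> 0"
      by (rule tendsto_sandwich[OF _ _ tendsto_const directional_tendsto_L1[of v']])
         (auto intro!: nn_integral_mono always_eventually ennreal_leI)
  qed (use test_fn_cgrad_integrable[OF \<phi>(1) \<Omega>(1)] g_inner_integrable in auto)
  moreover have "(\<integral>x. \<bar>g x \<bullet> v'\<bar> \<partial>lborel) = 0"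
    using g0 by (subst integral_cong_AE[where g="\<lambda>_. 0"]) (auto simp: v'_def)
  ultimately have "2 * (\<integral>x. \<bar>u x\<bar> \<partial>lborel) \<le> 0"
    using le by (intro LIMSEQ_le[OF tendsto_mult[OF tendsto_const abs_\<phi>_integral_tendsto]]) auto
  moreover have "0 \<le> (\<integral>x. \<bar>u x\<bar> \<partial>lborel)" by simp
  ultimately have "(\<integral>x. \<bar>u x\<bar> \<partial>lborel) = 0" by linarith
  then show ?thesis
    using u_integrable by (subst (asm) integral_nonneg_eq_0_iff_AE) auto
qed

end

section \<open>Linearity, uniqueness of the gradient and independence of the basis\<close>

lemma powr_norm_tendsto_lincomb:
  fixes F G :: "nat \<Rightarrow> 'a \<Rightarrow> 'b::euclidean_space"
  assumes p: "0 \<le> p"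
    and [measurable]: "\<And>k. F k \<in> borel_measurable M" "\<And>k. G k \<in> borel_measurable M"
    and F: "(\<lambda>k. \<integral>\<^sup>+x. ennreal (norm (F k x) powr p) \<partial>M) \<longlonglongrightarrow> 0"
    and G: "(\<lambda>k. \<integral>\<^sup>+x. ennreal (norm (G k x) powr p) \<partial>M) \<longlonglongrightarrow> 0"
  shows "(\<lambda>k. \<integral>\<^sup>+x. ennreal (norm (a *\<^sub>R F k x + b *\<^sub>R G k x) powr p) \<partial>M) \<longlonglongrightarrow> 0"
proof (rule tendsto_sandwich[OF _ _ tendsto_const])
  let ?A = "2 powr p * \<bar>a\<bar> powr p" and ?B = "2 powr p * \<bar>b\<bar> powr p"
  let ?R = "\<lambda>k. ennreal ?A * (\<integral>\<^sup>+x. ennreal (norm (F k x) powr p) \<partial>M)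
       + ennreal ?B * (\<integral>\<^sup>+x. ennreal (norm (G k x) powr p) \<partial>M)"
  have "?R \<longlonglongrightarrow> ennreal ?A * 0 + ennreal ?B * 0"
    by (intro tendsto_add ennreal_tendsto_cmult F G) auto
  then show "?R \<longlonglongrightarrow> 0" by simp
  show "\<forall>\<^sub>F k in sequentially. (\<integral>\<^sup>+x. ennreal (norm (a *\<^sub>R F k x + b *\<^sub>R G k x) powr p) \<partial>M) \<le> ?R k"
  proof (intro always_eventually allI)
    fix k
    have "(\<integral>\<^sup>+x. ennreal (norm (a *\<^sub>R F k x + b *\<^sub>R G k x) powr p) \<partial>M)
      \<le> (\<integral>\<^sup>+x. ennreal ?A * ennreal (norm (F k x) powr p) + ennreal ?B * ennreal (norm (G k x) powr p) \<partial>M)"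
    proof (rule nn_integral_mono)
      fix x
      have "norm (a *\<^sub>R F k x + b *\<^sub>R G k x) powr p \<le> (\<bar>a\<bar> * norm (F k x) + \<bar>b\<bar> * norm (G k x)) powr p"
        using p norm_triangle_ineq[of "a *\<^sub>R F k x" "b *\<^sub>R G k x"] by (intro powr_mono2) auto
      also have "\<dots> \<le> 2 powr p * ((\<bar>a\<bar> * norm (F k x)) powr p + (\<bar>b\<bar> * norm (G k x)) powr p)"
        using p by (intro powr_add_le) auto
      also have "\<dots> = ?A * norm (F k x) powr p + ?B * norm (G k x) powr p"
        by (simp add: powr_mult algebra_simps)
      finally have "ennreal (norm (a *\<^sub>R F k x + b *\<^sub>R G k x) powr p)
          \<le> ennreal (?A * norm (F k x) powr p + ?B * norm (G k x) powr p)" by (rule ennreal_leI)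
      then show "ennreal (norm (a *\<^sub>R F k x + b *\<^sub>R G k x) powr p)
          \<le> ennreal ?A * ennreal (norm (F k x) powr p) + ennreal ?B * ennreal (norm (G k x) powr p)"
        by (simp add: ennreal_plus ennreal_mult)
    qed
    also have "\<dots> = ?R k" by (simp add: nn_integral_add nn_integral_cmult)
    finally show "(\<integral>\<^sup>+x. ennreal (norm (a *\<^sub>R F k x + b *\<^sub>R G k x) powr p) \<partial>M) \<le> ?R k" .
  qed
qed simp

lemma sob0_pair_lincomb:
  assumes p: "0 \<le> p" and 1: "sob0_pair \<Omega> p u g" and 2: "sob0_pair \<Omega> p v h"
  shows "sob0_pair \<Omega> p (\<lambda>x. a * u x + b * v x) (\<lambda>x. a *\<^sub>R g x + b *\<^sub>R h x)"
proof -
  obtain \<phi> where \<phi>: "\<And>k. test_fn \<Omega> (\<phi> k)"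
        "(\<lambda>k. \<integral>\<^sup>+x. ennreal (norm (\<phi> k x - u x) powr p) \<partial>lborel) \<longlonglongrightarrow> 0"
        "(\<lambda>k. \<integral>\<^sup>+x. ennreal (norm (cgrad (\<phi> k) x - g x) powr p) \<partial>lborel) \<longlonglongrightarrow> 0"
    using 1 by (auto simp: sob0_pair_def)
  obtain \<psi> where \<psi>: "\<And>k. test_fn \<Omega> (\<psi> k)"
        "(\<lambda>k. \<integral>\<^sup>+x. ennreal (norm (\<psi> k x - v x) powr p) \<partial>lborel) \<longlonglongrightarrow> 0"
        "(\<lambda>k. \<integral>\<^sup>+x. ennreal (norm (cgrad (\<psi> k) x - h x) powr p) \<partial>lborel) \<longlonglongrightarrow> 0"
    using 2 by (auto simp: sob0_pair_def)
  note [measurable] = test_fn_measurable[OF \<phi>(1)] test_fn_measurable[OF \<psi>(1)]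
  have [measurable]: "u \<in> borel_measurable borel" "v \<in> borel_measurable borel"
    "g \<in> borel_measurable borel" "h \<in> borel_measurable borel"
    using 1 2 by (auto simp: sob0_pair_def)
  have "(\<lambda>k. \<integral>\<^sup>+x. ennreal (norm (a *\<^sub>R (\<phi> k x - u x) + b *\<^sub>R (\<psi> k x - v x)) powr p) \<partial>lborel) \<longlonglongrightarrow> 0"
    by (intro powr_norm_tendsto_lincomb p \<phi> \<psi>) measurable
  then have A: "(\<lambda>k. \<integral>\<^sup>+x. ennreal (\<bar>(a * \<phi> k x + b * \<psi> k x) - (a * u x + b * v x)\<bar> powr p) \<partial>lborel) \<longlonglongrightarrow> 0"
    by (simp add: algebra_simps)
  have "(\<lambda>k. \<integral>\<^sup>+x. ennreal (norm (a *\<^sub>R (cgrad (\<phi> k) x - g x) + b *\<^sub>R (cgrad (\<psi> k) x - h x)) powr p) \<partial>lborel) \<longlonglongrightarrow> 0"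
    by (intro powr_norm_tendsto_lincomb p \<phi> \<psi>) measurable
  then have B: "(\<lambda>k. \<integral>\<^sup>+x. ennreal (norm (cgrad (\<lambda>x. a * \<phi> k x + b * \<psi> k x) x - (a *\<^sub>R g x + b *\<^sub>R h x)) powr p) \<partial>lborel) \<longlonglongrightarrow> 0"
    using \<phi>(1) \<psi>(1) by (simp add: test_fn_def cgrad_lincomb algebra_simps)
  show ?thesis unfolding sob0_pair_def
    using A B \<phi>(1) \<psi>(1)
    by (intro conjI exI[of _ "\<lambda>k x. a * \<phi> k x + b * \<psi> k x"]) (auto intro: test_fn_lincomb)
qed

lemma smooth_fn_zero: "smooth_fn (\<lambda>_. 0)"
  by (coinduction) (simp add: frechet_derivative_const)

lemma sob0_pair_zero: "sob0_pair \<Omega> p (\<lambda>_. 0) (\<lambda>_. 0)"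
  unfolding sob0_pair_def
  by (intro conjI exI[of _ "\<lambda>_ _. 0"]) (auto simp: test_fn_def smooth_fn_zero cgrad_def frechet_derivative_const)

lemma sob0_pair_sum:
  assumes "0 \<le> p" "finite I" "\<And>k. k \<in> I \<Longrightarrow> sob0_pair \<Omega> p (w k) (G k)"
  shows "sob0_pair \<Omega> p (\<lambda>x. \<Sum>k\<in>I. c k * w k x) (\<lambda>x. \<Sum>k\<in>I. c k *\<^sub>R G k x)"
  using assms(2,3)
proof (induction I rule: finite_induct)
  case (insert i I)
  then have "sob0_pair \<Omega> p (\<lambda>x. c i * w i x + 1 * (\<Sum>k\<in>I. c k * w k x))
      (\<lambda>x. c i *\<^sub>R G i x + 1 *\<^sub>R (\<Sum>k\<in>I. c k *\<^sub>R G k x))"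
    by (intro sob0_pair_lincomb assms(1)) auto
  with insert(1,2) show ?case by simp
qed (simp add: sob0_pair_zero)

lemma sob0_pair_wgrad: "u \<in> W0 \<Omega> p \<Longrightarrow> sob0_pair \<Omega> p u (wgrad \<Omega> p u)"
  unfolding W0_def wgrad_def mem_Collect_eq by (erule someI_ex)

text \<open>The difference of two gradients of u is a gradient of u - u = 0, and
  \<open>gradient_zero\<close> applies to it.\<close>

lemma wgrad_AE_eq:
  assumes "1 < p" "bounded \<Omega>" "open \<Omega>" "sob0_pair \<Omega> p u g"
  shows "AE x in lborel. wgrad \<Omega> p u x = g x"
proof -
  have "sob0_pair \<Omega> p u (wgrad \<Omega> p u)" using assms(4) by (intro sob0_pair_wgrad) (auto simp: W0_def)
  then have "sob0_pair \<Omega> p (\<lambda>x. 1 * u x + (- 1) * u x) (\<lambda>x. 1 *\<^sub>R wgrad \<Omega> p u x + (-1) *\<^sub>R g x)"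
    using assms by (intro sob0_pair_lincomb) auto
  then interpret sobolev_pair \<Omega> p "\<lambda>x. 0" "\<lambda>x. wgrad \<Omega> p u x - g x"
    using assms by unfold_locales auto
  show ?thesis using gradient_zero by simp
qed

lemma Lp_norm_AE_zero:
  fixes u :: "'a::euclidean_space \<Rightarrow> real"
  assumes "AE x in lborel. u x = 0"
  shows "Lp_norm \<Omega> p u = 0"
proof -
  have "(\<integral>\<^sup>+x\<in>\<Omega>. ennreal (\<bar>u x\<bar> powr p) \<partial>lborel) = (\<integral>\<^sup>+x. 0 \<partial>(lborel::'a measure))"
    by (rule nn_integral_cong_AE) (use assms in \<open>eventually_elim, simp\<close>)
  then show ?thesis by (simp add: Lp_norm_def)
qed

text \<open>For a null function the chosen gradient could a priori be nonzero;
  \<open>gradient_zero\<close> excludes this.\<close>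

lemma sob_norm_AE_zero:
  assumes "1 < p" "bounded \<Omega>" "open \<Omega>" "u \<in> W0 \<Omega> p" "AE x in lborel. u x = 0"
  shows "sob_norm \<Omega> p u = 0"
proof -
  interpret sobolev_pair \<Omega> p u "wgrad \<Omega> p u"
    using assms sob0_pair_wgrad by unfold_locales auto
  have "AE x in lborel. norm (wgrad \<Omega> p u x) = 0" using gradient_zero[OF assms(5)] by simp
  then show ?thesis using assms(5) by (simp add: sob_norm_def Lp_norm_AE_zero)
qed

text \<open>Both the zero sequence and the truncation of c are expansions of the zero function, and
  a Schauder expansion is unique.\<close>

lemma schauder_basis_independent:
  assumes "1 < p" "bounded \<Omega>" "open \<Omega>" and basis: "schauder_basis \<Omega> p w"
    and zero: "AE x in lborel. (\<Sum>k\<in>{1..m}. c k * w k x) = 0" and i: "i \<in> {1..m}"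
  shows "c i = 0"
proof -
  define P where "P c \<longleftrightarrow> c 0 = 0 \<and> (\<lambda>N. sob_norm \<Omega> p (\<lambda>x. 0 - (\<Sum>k\<in>{1..N}. c k * w k x))) \<longlonglongrightarrow> 0"
    for c :: "nat \<Rightarrow> real"
  \<comment> \<open>Index 0 lies outside \<open>{1..m}\<close>, so c' also satisfies the
    normalisation at 0 demanded by uniqueness.\<close>
  define c' where "c' k = (if k \<in> {1..m} then c k else 0)" for k
  have W: "\<And>k. 1 \<le> k \<Longrightarrow> w k \<in> W0 \<Omega> p" using basis by (simp add: schauder_basis_def)
  have Z: "sob_norm \<Omega> p (\<lambda>x. 0 - (\<Sum>k\<in>{1..N}. a k * w k x)) = 0"
    if "AE x in lborel. (\<Sum>k\<in>{1..N}. a k * w k x) = 0" for a N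
  proof (rule sob_norm_AE_zero[OF assms(1-3)])
    have "sob0_pair \<Omega> p (\<lambda>x. 0 * 0 + (-1) * (\<Sum>k\<in>{1..N}. a k * w k x))
      (\<lambda>x. 0 *\<^sub>R 0 + (-1) *\<^sub>R (\<Sum>k\<in>{1..N}. a k *\<^sub>R wgrad \<Omega> p (w k) x))"
      using assms(1) W by (intro sob0_pair_lincomb sob0_pair_zero sob0_pair_sum sob0_pair_wgrad) auto
    then show "(\<lambda>x. 0 - (\<Sum>k\<in>{1..N}. a k * w k x)) \<in> W0 \<Omega> p" by (auto simp: W0_def)
    show "AE x in lborel. 0 - (\<Sum>k\<in>{1..N}. a k * w k x) = 0" using that by simp
  qed
  have P0: "P (\<lambda>_. 0)" unfolding P_def by (subst Z) simp_all
  have "sob_norm \<Omega> p (\<lambda>x. 0 - (\<Sum>k\<in>{1..N}. c' k * w k x)) = 0" if "m \<le> N" for N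
  proof (rule Z)
    have "(\<Sum>k\<in>{1..N}. c' k * w k x) = (\<Sum>k\<in>{1..m}. c k * w k x)" for x
      using that by (intro sum.mono_neutral_cong_right) (auto simp: c'_def)
    then show "AE x in lborel. (\<Sum>k\<in>{1..N}. c' k * w k x) = 0" using zero by simp
  qed
  \<comment> \<open>Partial sums with N < m may be nonzero; the limit does not see them.\<close>
  then have "\<forall>\<^sub>F N in sequentially. sob_norm \<Omega> p (\<lambda>x. 0 - (\<Sum>k\<in>{1..N}. c' k * w k x)) = 0"
    unfolding eventually_sequentially by blast
  then have Pc: "P c'" by (simp add: P_def c'_def tendsto_eventually)
  have "(\<lambda>_. 0) \<in> W0 \<Omega> p" using sob0_pair_zero by (auto simp: W0_def)
  moreover have "\<exists>!c. c 0 = 0 \<and> (\<lambda>N. sob_norm \<Omega> p (\<lambda>x. u x - (\<Sum>k\<in>{1..N}. c k * w k x))) \<longlonglongrightarrow> 0"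
    if "u \<in> W0 \<Omega> p" for u
    using basis that by (simp add: schauder_basis_def)
  ultimately have "\<exists>!c. P c" unfolding P_def by blast
  then have "c' = (\<lambda>_. 0)" using P0 Pc by blast
  then show ?thesis using i by (metis c'_def)
qed

lemma integrable_restrict_spaceI:
  fixes h :: "'a \<Rightarrow> 'b::{banach, second_countable_topology}"
  assumes "integrable M h" "\<Omega> \<in> sets M"
  shows "integrable (restrict_space M \<Omega>) h"
  using integrable_mult_indicator[OF assms(2,1)] assms(2)
  by (simp add: integrable_restrict_space)

text \<open>These are the two nondegeneracy facts behind the minimisation. A vanishing integral
  would make u a null function, in the first case through the Poincare argument, against
  independence of the basis.\<close>

lemma directional_norm_positive:
  assumes "1 < p" "bounded \<Omega>" "open \<Omega>" and basis: "schauder_basis \<Omega> p w"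
    and c: "\<exists>k\<in>{1..m}. c k \<noteq> 0" and \<xi>: "\<xi> \<noteq> 0"
  shows "0 < (\<integral>x. \<bar>(\<Sum>k\<in>{1..m}. c k *\<^sub>R wgrad \<Omega> p (w k) x) \<bullet> \<xi>\<bar> powr p \<partial>restrict_space lborel \<Omega>)"
    and "0 < q \<Longrightarrow> integrable (restrict_space lborel \<Omega>) (\<lambda>x. \<bar>\<Sum>k\<in>{1..m}. c k * w k x\<bar> powr q) \<Longrightarrow>
      0 < (\<integral>x. \<bar>\<Sum>k\<in>{1..m}. c k * w k x\<bar> powr q \<partial>restrict_space lborel \<Omega>)"
proof -
  let ?u = "\<lambda>x. \<Sum>k\<in>{1..m}. c k * w k x" and ?g = "\<lambda>x. \<Sum>k\<in>{1..m}. c k *\<^sub>R wgrad \<Omega> p (w k) x"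
  have W: "\<And>k. 1 \<le> k \<Longrightarrow> w k \<in> W0 \<Omega> p" using basis by (simp add: schauder_basis_def)
  interpret sobolev_pair \<Omega> p ?u ?g
    using assms W by unfold_locales (auto intro!: sob0_pair_sum sob0_pair_wgrad)
  have not0: "\<not> (AE x in lborel. ?u x = 0)"
    using schauder_basis_independent[OF assms(1-4)] c by blast
  \<comment> \<open>The integrals see only \<Omega>; since u and its gradient vanish almost
    everywhere outside, a zero on \<Omega> is a zero on the whole space.\<close>
  have AE_R: "AE x in lborel. h x = 0"
    if "AE x in restrict_space lborel \<Omega>. \<bar>h x\<bar> powr r = 0" "AE x in lborel. x \<notin> \<Omega> \<longrightarrow> h x = 0" for h and r :: real
    using that by (subst (asm) AE_restrict_space_iff) (auto elim: eventually_elim2)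
  {
    have "integrable lborel (\<lambda>x. \<bar>?g x \<bullet> \<xi>\<bar> powr p)"
    proof (rule Bochner_Integration.integrable_bound)
      show "integrable lborel (\<lambda>x. norm \<xi> powr p * norm (?g x) powr p)" using g_powr_integrable by simp
      show "AE x in lborel. norm (\<bar>?g x \<bullet> \<xi>\<bar> powr p) \<le> norm (norm \<xi> powr p * norm (?g x) powr p)"
      proof (rule AE_I2)
        fix x
        have "\<bar>?g x \<bullet> \<xi>\<bar> powr p \<le> (norm \<xi> * norm (?g x)) powr p"
          using Cauchy_Schwarz_ineq2[of "?g x" \<xi>] p by (intro powr_mono2) (auto simp: mult.commute)
        then show "norm (\<bar>?g x \<bullet> \<xi>\<bar> powr p) \<le> norm (norm \<xi> powr p * norm (?g x) powr p)"
          by (simp add: powr_mult)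
      qed
      show "(\<lambda>x. \<bar>?g x \<bullet> \<xi>\<bar> powr p) \<in> borel_measurable lborel"
        unfolding measurable_lborel2
        by (rule measurable_compose[OF measurable_g, where g="\<lambda>v. \<bar>v \<bullet> \<xi>\<bar> powr p"]) simp
    qed
    then have i: "integrable (restrict_space lborel \<Omega>) (\<lambda>x. \<bar>?g x \<bullet> \<xi>\<bar> powr p)"
      using \<Omega>_sets by (intro integrable_restrict_spaceI) simp_all
    show "0 < (\<integral>x. \<bar>?g x \<bullet> \<xi>\<bar> powr p \<partial>restrict_space lborel \<Omega>)"
    proof (rule ccontr)
      assume "\<not> ?thesis"
      moreover have "0 \<le> (\<integral>x. \<bar>?g x \<bullet> \<xi>\<bar> powr p \<partial>restrict_space lborel \<Omega>)" by simp
      ultimately have "(\<integral>x. \<bar>?g x \<bullet> \<xi>\<bar> powr p \<partial>restrict_space lborel \<Omega>) = 0" by linarith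
      then have "AE x in restrict_space lborel \<Omega>. \<bar>?g x \<bullet> \<xi>\<bar> powr p = 0"
        using i by (subst (asm) integral_nonneg_eq_0_iff_AE) auto
      then have "AE x in lborel. ?g x \<bullet> \<xi> = 0"
        by (rule AE_R) (use g_zero_outside in \<open>eventually_elim, simp\<close>)
      then have "AE x in lborel. ?u x = 0" by (rule zero_if_directional_zero[OF \<xi>])
      then show False using not0 by blast
    qed
  }
  assume i: "integrable (restrict_space lborel \<Omega>) (\<lambda>x. \<bar>?u x\<bar> powr q)"
  show "0 < (\<integral>x. \<bar>?u x\<bar> powr q \<partial>restrict_space lborel \<Omega>)"
  proof (rule ccontr)
    assume "\<not> ?thesis"
    moreover have "0 \<le> (\<integral>x. \<bar>?u x\<bar> powr q \<partial>restrict_space lborel \<Omega>)" by simp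
    ultimately have "(\<integral>x. \<bar>?u x\<bar> powr q \<partial>restrict_space lborel \<Omega>) = 0" by linarith
    then have "AE x in restrict_space lborel \<Omega>. \<bar>?u x\<bar> powr q = 0"
      using i by (subst (asm) integral_nonneg_eq_0_iff_AE) auto
    then have "AE x in lborel. ?u x = 0"
      by (rule AE_R) (rule u_zero_outside)
    then show False using not0 by blast
  qed
qed

subsection \<open>Powers and differentiation under the integral\<close>

lemma has_real_derivative_abs_powr:
  fixes q y :: real
  assumes q: "1 < q"
  shows "((\<lambda>y. \<bar>y\<bar> powr q) has_real_derivative q * sgnpow y (q - 1)) (at y)"
proof -
  consider "y > 0" | "y < 0" | "y = 0" by linarith
  then show ?thesis
  proof cases
    case 1
    have "((\<lambda>y. y powr q) has_real_derivative q * y powr (q - 1)) (at y)"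
      using 1 by (intro has_real_derivative_powr) auto
    then have "((\<lambda>y. \<bar>y\<bar> powr q) has_real_derivative q * y powr (q - 1)) (at y)"
      by (rule has_field_derivative_transform_within_open[of _ _ _ "{0<..}"]) (use 1 in auto)
    then show ?thesis using 1 by (simp add: sgnpow_def)
  next
    case 2
    have "((\<lambda>y. (- y) powr q) has_real_derivative (q * (- y) powr (q - 1)) * (- 1)) (at y)"
      using 2 DERIV_chain2[where f="\<lambda>z. z powr q" and g="\<lambda>y. - y" and x=y,
          OF has_real_derivative_powr DERIV_minus[OF DERIV_ident]] by simp
    then have "((\<lambda>y. \<bar>y\<bar> powr q) has_real_derivative (q * (- y) powr (q - 1)) * (- 1)) (at y)"
      by (rule has_field_derivative_transform_within_open[of _ _ _ "{..<0}"]) (use 2 in auto)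
    then show ?thesis using 2 by (simp add: sgnpow_def)
  next
    case 3
    have "((\<lambda>h::real. \<bar>h\<bar> powr (q - 1)) \<longlongrightarrow> \<bar>0\<bar> powr (q - 1)) (at 0)"
      using q by (intro tendsto_powr'[OF tendsto_rabs[OF tendsto_ident_at] tendsto_const]) auto
    then have "((\<lambda>h::real. \<bar>h\<bar> powr (q - 1)) \<longlongrightarrow> 0) (at 0)" by simp
    \<comment> \<open>At the origin the difference quotient is of order |h|^(q-1), which tends to 0
      because q > 1.\<close>
    moreover have "norm (\<bar>h\<bar> powr q / h) \<le> \<bar>h\<bar> powr (q - 1)" for h :: real
      by (cases "h = 0") (simp_all add: powr_diff)
    then have "eventually (\<lambda>h. norm (\<bar>h\<bar> powr q / h) \<le> \<bar>h\<bar> powr (q - 1)) (at (0::real))"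
      by simp
    ultimately have "((\<lambda>h::real. \<bar>h\<bar> powr q / h) \<longlongrightarrow> 0) (at 0)"
      by (rule Lim_null_comparison[rotated])
    then show ?thesis using 3 q by (simp add: has_field_derivative_iff sgnpow_def)
  qed
qed

lemma abs_powr_diff_le:
  fixes y z K q :: real
  assumes q: "1 < q" and "\<bar>y\<bar> \<le> K" "\<bar>z\<bar> \<le> K"
  shows "\<bar>\<bar>y\<bar> powr q - \<bar>z\<bar> powr q\<bar> \<le> q * K powr (q - 1) * \<bar>y - z\<bar>"
proof -
  have "norm (\<bar>y\<bar> powr q - \<bar>z\<bar> powr q) \<le> (q * K powr (q - 1)) * norm (y - z)"
  proof (rule field_differentiable_bound[where S="{-K..K}" and f'="\<lambda>y. q * sgnpow y (q - 1)"])
    show "((\<lambda>y. \<bar>y\<bar> powr q) has_field_derivative q * sgnpow x (q - 1)) (at x within {-K..K})" for x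
      using has_real_derivative_abs_powr[OF q] has_field_derivative_at_within by blast
    show "norm (q * sgnpow x (q - 1)) \<le> q * K powr (q - 1)" if "x \<in> {-K..K}" for x
    proof -
      have "\<bar>x\<bar> powr (q - 1) \<le> K powr (q - 1)" using that q by (intro powr_mono2) auto
      then show ?thesis using q by (cases "x = 0") (simp_all add: sgnpow_def abs_mult abs_sgn_eq)
    qed
  qed (use assms in auto)
  then show ?thesis by simp
qed

text \<open>For nonpositive exponents the Lipschitz constant is governed by the lower bound
  \<open>e\<close>; the uniform bound on directional norms will supply it.\<close>

lemma powr_lipschitz_away_from_zero:
  fixes x y e q :: real
  assumes "0 < e" "e \<le> x" "e \<le> y" "q \<le> 0"
  shows "\<bar>x powr q - y powr q\<bar> \<le> \<bar>q\<bar> * e powr (q - 1) * \<bar>x - y\<bar>"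
proof -
  have "norm (x powr q - y powr q) \<le> (\<bar>q\<bar> * e powr (q - 1)) * norm (x - y)"
  proof (rule field_differentiable_bound[where S="{e..}" and f'="\<lambda>x. q * x powr (q - 1)"])
    show "((\<lambda>x. x powr q) has_field_derivative q * z powr (q - 1)) (at z within {e..})" if "z \<in> {e..}" for z
      by (rule has_field_derivative_at_within, rule has_real_derivative_powr) (use that assms(1) in simp)
    show "norm (q * z powr (q - 1)) \<le> \<bar>q\<bar> * e powr (q - 1)" if "z \<in> {e..}" for z
    proof -
      have "z powr (q - 1) \<le> e powr (q - 1)" using that assms by (intro powr_mono2') auto
      then show ?thesis by (simp add: abs_mult mult_left_mono)
    qed
  qed (use assms in simp_all)
  then show ?thesis by simp
qed

lemma sgnpow_measurable [measurable]: "(\<lambda>y. sgnpow y q) \<in> borel_measurable borel"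
  unfolding sgnpow_def by measurable

text \<open>Differentiation under the integral at a single point: only increments from t = 0 have to
  be dominated, so nothing is asked of derivatives at other parameters. Measurability of
  \<open>F'\<close> is a conclusion, not a hypothesis.\<close>

lemma has_real_derivative_integral:
  fixes F :: "real \<Rightarrow> 'a \<Rightarrow> real"
  assumes r: "0 < r" and int: "\<And>t. \<bar>t\<bar> < r \<Longrightarrow> integrable M (F t)"
    and deriv: "\<And>x. x \<in> space M \<Longrightarrow> ((\<lambda>t. F t x) has_real_derivative F' x) (at 0)"
    and lip: "\<And>t x. \<bar>t\<bar> < r \<Longrightarrow> x \<in> space M \<Longrightarrow> \<bar>F t x - F 0 x\<bar> \<le> g x * \<bar>t\<bar>"
    and g: "integrable M g"
  shows "((\<lambda>t. \<integral>x. F t x \<partial>M) has_real_derivative (\<integral>x. F' x \<partial>M)) (at 0)"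
    and "integrable M F'"
proof -
  have lim: "(\<lambda>n. (F (s n) x - F 0 x) / s n) \<longlonglongrightarrow> F' x"
    if "x \<in> space M" "s \<longlonglongrightarrow> 0" "\<And>n. s n \<noteq> 0" for s x
  proof -
    have "((\<lambda>t. (F t x - F 0 x) / t) \<longlongrightarrow> F' x) (at 0)"
      using deriv[OF that(1)] by (simp add: has_field_derivative_iff)
    moreover have "filterlim s (at 0) sequentially" using that by (simp add: filterlim_at)
    ultimately show ?thesis by (rule filterlim_compose)
  qed
  have bnd: "\<bar>(F t x - F 0 x) / t\<bar> \<le> g x" if "\<bar>t\<bar> < r" "t \<noteq> 0" "x \<in> space M" for t x
    using lip[OF that(1,3)] that(2) by (simp add: abs_divide divide_le_eq)
  have int': "integrable M (\<lambda>x. (F t x - F 0 x) / t)" if "\<bar>t\<bar> < r" for t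
    using int[OF that] int[of 0] r by (intro integrable_divide Bochner_Integration.integrable_diff) auto
  \<comment> \<open>A sequence of nonzero admissible parameters tending to 0. Along it
    \<open>F'\<close> is a pointwise limit of measurable quotients bounded by \<open>g\<close>,
    hence measurable and integrable.\<close>
  define s where "s n = r / 2 / real (Suc n)" for n
  have s: "s \<longlonglongrightarrow> 0" "\<And>n. s n \<noteq> 0" "\<And>n. \<bar>s n\<bar> < r"
  proof -
    have "s = (\<lambda>n. (r / 2) * inverse (real (Suc n)))" by (rule ext) (simp only: s_def divide_inverse)
    moreover have "(\<lambda>n. (r / 2) * inverse (real (Suc n))) \<longlonglongrightarrow> (r / 2) * 0"
      by (intro tendsto_mult tendsto_const LIMSEQ_inverse_real_of_nat)
    ultimately show "s \<longlonglongrightarrow> 0" by simp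
    show "s n \<noteq> 0" for n using r by (simp add: s_def)
    have "0 < s n" "s n \<le> r / 2" for n
      unfolding s_def using r divide_left_mono[of 1 "real (Suc n)" "r / 2"] by simp_all
    moreover have "r / 2 < r" using r by simp
    ultimately show "\<bar>s n\<bar> < r" for n
      by (metis abs_of_pos le_less_trans)
  qed
  have F'_meas [measurable]: "F' \<in> borel_measurable M"
  proof (rule borel_measurable_LIMSEQ_real)
    show "(\<lambda>n. (F (s n) x - F 0 x) / s n) \<longlonglongrightarrow> F' x" if "x \<in> space M" for x
      using lim[OF that s(1,2)] .
    show "(\<lambda>x. (F (s n) x - F 0 x) / s n) \<in> borel_measurable M" for n
      using int'[OF s(3)] by (rule borel_measurable_integrable)
  qed
  show "integrable M F'"
  proof (rule integrable_dominated_convergence[OF F'_meas _ g])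
    show "AE x in M. (\<lambda>n. (F (s n) x - F 0 x) / s n) \<longlonglongrightarrow> F' x"
      using lim[OF _ s(1,2)] by (intro AE_I2)
    show "(\<lambda>x. (F (s n) x - F 0 x) / s n) \<in> borel_measurable M" for n
      using int'[OF s(3)] by (rule borel_measurable_integrable)
    show "AE x in M. norm ((F (s n) x - F 0 x) / s n) \<le> g x" for n
      using bnd[OF s(3,2)] by (intro AE_I2) simp
  qed
  have "((\<lambda>t. ((\<integral>x. F t x \<partial>M) - (\<integral>x. F 0 x \<partial>M)) / t) \<longlongrightarrow> (\<integral>x. F' x \<partial>M)) (at 0)"
    unfolding tendsto_at_iff_sequentially comp_def
  proof (intro allI impI)
    fix X :: "nat \<Rightarrow> real" assume X: "\<forall>i. X i \<in> UNIV - {0}" "X \<longlonglongrightarrow> 0"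
    have "eventually (\<lambda>n. \<bar>X n\<bar> < r) sequentially"
      using tendsto_rabs[OF X(2)] r by (intro order_tendstoD(2)[of _ 0]) auto
    then obtain N where N: "\<And>n. n \<ge> N \<Longrightarrow> \<bar>X n\<bar> < r" by (auto simp: eventually_sequentially)
    \<comment> \<open>An arbitrary null sequence may start outside the admissible interval, so its
      first N terms are dropped.\<close>
    let ?Y = "\<lambda>n. X (n + N)"
    have Y: "?Y \<longlonglongrightarrow> 0" "\<And>n. ?Y n \<noteq> 0" "\<And>n. \<bar>?Y n\<bar> < r"
      using LIMSEQ_ignore_initial_segment[OF X(2)] X(1) N by simp_all
    have "(\<lambda>n. \<integral>x. (F (?Y n) x - F 0 x) / ?Y n \<partial>M) \<longlonglongrightarrow> (\<integral>x. F' x \<partial>M)"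
    proof (rule integral_dominated_convergence[OF F'_meas _ g])
      show "AE x in M. (\<lambda>n. (F (?Y n) x - F 0 x) / ?Y n) \<longlonglongrightarrow> F' x"
        using lim[OF _ Y(1,2)] by (intro AE_I2)
      show "(\<lambda>x. (F (?Y n) x - F 0 x) / ?Y n) \<in> borel_measurable M" for n
        using int'[OF Y(3)] by (rule borel_measurable_integrable)
      show "AE x in M. norm ((F (?Y n) x - F 0 x) / ?Y n) \<le> g x" for n
        using bnd[OF Y(3,2)] by (intro AE_I2) simp
    qed
    note lim' = this
    have *: "(\<integral>x. (F (?Y n) x - F 0 x) / ?Y n \<partial>M) = ((\<integral>x. F (?Y n) x \<partial>M) - (\<integral>x. F 0 x \<partial>M)) / ?Y n" for n
      using Bochner_Integration.integral_diff[OF int[OF Y(3), of n] int[of 0]] r by simp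
    from lim' have "(\<lambda>n. ((\<integral>x. F (X (n + N)) x \<partial>M) - (\<integral>x. F 0 x \<partial>M)) / X (n + N)) \<longlonglongrightarrow> (\<integral>x. F' x \<partial>M)"
      unfolding * .
    then show "(\<lambda>n. ((\<integral>x. F (X n) x \<partial>M) - (\<integral>x. F 0 x \<partial>M)) / X n) \<longlonglongrightarrow> (\<integral>x. F' x \<partial>M)"
      by (rule LIMSEQ_offset)
  qed
  then show "((\<lambda>t. \<integral>x. F t x \<partial>M) has_real_derivative (\<integral>x. F' x \<partial>M)) (at 0)"
    by (simp add: has_field_derivative_iff)
qed

lemma abs_powr_integrable_bound:
  fixes a h :: "'a \<Rightarrow> real"
  assumes "0 \<le> q" and [measurable]: "a \<in> borel_measurable M" and "\<And>x. x \<in> space M \<Longrightarrow> \<bar>a x\<bar> \<le> K * h x"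
    and "0 \<le> K" and h: "integrable M (\<lambda>x. h x powr q)"
    and "\<And>x. x \<in> space M \<Longrightarrow> 0 \<le> h x"
  shows "integrable M (\<lambda>x. \<bar>a x\<bar> powr q)"
    and "(\<integral>x. \<bar>a x\<bar> powr q \<partial>M) \<le> K powr q * (\<integral>x. h x powr q \<partial>M)"
proof -
  have le: "\<bar>a x\<bar> powr q \<le> K powr q * h x powr q" if "x \<in> space M" for x
  proof -
    have "\<bar>a x\<bar> powr q \<le> (K * h x) powr q" using assms that by (intro powr_mono2) auto
    then show ?thesis using assms that by (simp add: powr_mult)
  qed
  show int: "integrable M (\<lambda>x. \<bar>a x\<bar> powr q)"
    by (rule Bochner_Integration.integrable_bound[OF integrable_mult_right[OF h, of "K powr q"]])
       (use le in \<open>auto intro!: AE_I2\<close>)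
  have "(\<integral>x. \<bar>a x\<bar> powr q \<partial>M) \<le> (\<integral>x. K powr q * h x powr q \<partial>M)"
    using le h int by (intro integral_mono) auto
  then show "(\<integral>x. \<bar>a x\<bar> powr q \<partial>M) \<le> K powr q * (\<integral>x. h x powr q \<partial>M)" by simp
qed

lemma abs_powr_integral_tendsto:
  fixes a :: "nat \<Rightarrow> 'a \<Rightarrow> real" and h :: "'a \<Rightarrow> real"
  assumes q: "0 < q" and [measurable]: "\<And>j. a j \<in> borel_measurable M" "b \<in> borel_measurable M"
    and bnd: "\<And>j x. x \<in> space M \<Longrightarrow> \<bar>a j x\<bar> \<le> K * h x"
    and "0 \<le> K" and h: "integrable M (\<lambda>x. h x powr q)"
    and "\<And>x. x \<in> space M \<Longrightarrow> 0 \<le> h x"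
    and lim: "\<And>x. x \<in> space M \<Longrightarrow> (\<lambda>j. a j x) \<longlonglongrightarrow> b x"
  shows "(\<lambda>j. \<integral>x. \<bar>a j x\<bar> powr q \<partial>M) \<longlonglongrightarrow> (\<integral>x. \<bar>b x\<bar> powr q \<partial>M)"
proof (rule integral_dominated_convergence[where w="\<lambda>x. K powr q * h x powr q"])
  show "AE x in M. (\<lambda>j. \<bar>a j x\<bar> powr q) \<longlonglongrightarrow> \<bar>b x\<bar> powr q"
    using q by (intro AE_I2 tendsto_powr' tendsto_rabs lim tendsto_const) auto
  show "AE x in M. norm (\<bar>a j x\<bar> powr q) \<le> K powr q * h x powr q" for j
  proof (rule AE_I2)
    fix x assume x: "x \<in> space M"
    have "\<bar>a j x\<bar> powr q \<le> (K * h x) powr q" using bnd[OF x] q by (intro powr_mono2) auto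
    then show "norm (\<bar>a j x\<bar> powr q) \<le> K powr q * h x powr q" using assms(5,7) x by (simp add: powr_mult)
  qed
qed (use h in auto)

text \<open>The constant of the second estimate depends on \<open>a\<close> and \<open>b\<close>
  only through the majorant \<open>h\<close>. This uniformity in the direction is needed later, when
  the result is differentiated once more under the integral over the sphere.\<close>

lemma abs_powr_integral_deriv:
  fixes a b h :: "'a \<Rightarrow> real"
  assumes q: "1 < q" and [measurable]: "a \<in> borel_measurable M" "b \<in> borel_measurable M"
    and a: "\<And>x. x \<in> space M \<Longrightarrow> \<bar>a x\<bar> \<le> h x" and b: "\<And>x. x \<in> space M \<Longrightarrow> \<bar>b x\<bar> \<le> h x"
    and h: "integrable M (\<lambda>x. h x powr q)"
  shows "((\<lambda>t. \<integral>x. \<bar>a x + t * b x\<bar> powr q \<partial>M) has_real_derivative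
      q * (\<integral>x. sgnpow (a x) (q - 1) * b x \<partial>M)) (at 0)"
    and "\<bar>t\<bar> \<le> 1 \<Longrightarrow> \<bar>(\<integral>x. \<bar>a x + t * b x\<bar> powr q \<partial>M) - (\<integral>x. \<bar>a x\<bar> powr q \<partial>M)\<bar>
      \<le> (q * 2 powr (q - 1) * (\<integral>x. h x powr q \<partial>M)) * \<bar>t\<bar>"
proof -
  \<comment> \<open>For |t| \<le> 1 both \<open>a x\<close> and \<open>a x + t * b x\<close> are at
    most 2 h in absolute value; this is the mean value bound at K = 2 h, multiplied by the factor h
    bounding \<open>b x\<close>.\<close>
  let ?g = "\<lambda>x. q * 2 powr (q - 1) * h x powr q"
  have h0: "0 \<le> h x" if "x \<in> space M" for x using a[OF that] by linarith
  have tb: "\<bar>t * b x\<bar> \<le> \<bar>t\<bar> * h x" if "x \<in> space M" for t x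
    using b[OF that] by (simp add: abs_mult mult_left_mono)
  have bnd: "\<bar>a x + t * b x\<bar> \<le> 2 * h x" if "x \<in> space M" "\<bar>t\<bar> \<le> 1" for t x
    using a[OF that(1)] tb[OF that(1), of t] mult_right_mono[OF that(2) h0[OF that(1)]] by linarith
  have lip: "\<bar>\<bar>a x + t * b x\<bar> powr q - \<bar>a x + 0 * b x\<bar> powr q\<bar> \<le> ?g x * \<bar>t\<bar>" if "\<bar>t\<bar> \<le> 1" "x \<in> space M" for t x
  proof -
    have "\<bar>\<bar>a x + t * b x\<bar> powr q - \<bar>a x\<bar> powr q\<bar> \<le> q * (2 * h x) powr (q - 1) * \<bar>t * b x\<bar>"
      using abs_powr_diff_le[OF q bnd[OF that(2,1)], of "a x"] a[OF that(2)] h0[OF that(2)] by simp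
    also have "\<dots> \<le> q * (2 * h x) powr (q - 1) * (\<bar>t\<bar> * h x)"
      using q by (intro mult_left_mono tb that) auto
    also have "\<dots> = q * 2 powr (q - 1) * (h x powr (q - 1) * h x) * \<bar>t\<bar>"
      using h0[OF that(2)] by (simp add: powr_mult)
    also have "h x powr (q - 1) * h x = h x powr q"
      using h0[OF that(2)] q by (cases "h x = 0") (simp_all add: powr_diff)
    finally show ?thesis by simp
  qed
  have int: "integrable M (\<lambda>x. \<bar>a x + t * b x\<bar> powr q)" if "\<bar>t\<bar> \<le> 1" for t
    using bnd that h h0 q by (intro abs_powr_integrable_bound(1)[where K=2 and h=h]) auto
  have g: "integrable M ?g" using h by simp
  have "((\<lambda>t. \<integral>x. \<bar>a x + t * b x\<bar> powr q \<partial>M) has_real_derivative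
      (\<integral>x. q * sgnpow (a x) (q - 1) * b x \<partial>M)) (at 0)"
  proof (rule has_real_derivative_integral(1)[OF _ _ _ _ g, of 1])
    show "((\<lambda>t. \<bar>a x + t * b x\<bar> powr q) has_real_derivative q * sgnpow (a x) (q - 1) * b x) (at 0)" for x
    proof (rule DERIV_chain2[OF has_real_derivative_abs_powr[OF q], THEN DERIV_cong])
      show "((\<lambda>t. a x + t * b x) has_real_derivative b x) (at 0)" by (auto intro!: derivative_eq_intros)
    qed simp
  qed (use int lip in auto)
  then show "((\<lambda>t. \<integral>x. \<bar>a x + t * b x\<bar> powr q \<partial>M) has_real_derivative
      q * (\<integral>x. sgnpow (a x) (q - 1) * b x \<partial>M)) (at 0)"
    by (simp add: mult.assoc)
  assume t: "\<bar>t\<bar> \<le> 1"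
  have "(\<integral>x. \<bar>a x + t * b x\<bar> powr q \<partial>M) - (\<integral>x. \<bar>a x\<bar> powr q \<partial>M)
    = (\<integral>x. \<bar>a x + t * b x\<bar> powr q - \<bar>a x + 0 * b x\<bar> powr q \<partial>M)"
    using Bochner_Integration.integral_diff[OF int[OF t] int[of 0]] by simp
  also have "\<bar>\<dots>\<bar> \<le> (\<integral>x. ?g x * \<bar>t\<bar> \<partial>M)"
  proof (rule order_trans[OF integral_abs_bound], rule integral_mono)
    show "integrable M (\<lambda>x. \<bar>\<bar>a x + t * b x\<bar> powr q - \<bar>a x + 0 * b x\<bar> powr q\<bar>)"
      using t by (intro integrable_abs Bochner_Integration.integrable_diff int) auto
    show "integrable M (\<lambda>x. ?g x * \<bar>t\<bar>)" using g by (rule integrable_mult_left)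
  qed (use lip t in auto)
  finally show "\<bar>(\<integral>x. \<bar>a x + t * b x\<bar> powr q \<partial>M) - (\<integral>x. \<bar>a x\<bar> powr q \<partial>M)\<bar>
      \<le> (q * 2 powr (q - 1) * (\<integral>x. h x powr q \<partial>M)) * \<bar>t\<bar>" by simp
qed

subsection \<open>The surface measure\<close>

text \<open>The set function in \<open>measure_of\<close> counts only if it is countably additive.
  Recognising it as a scaled push-forward of Lebesgue measure under radial projection gives this at
  once; the origin is removed because it has no direction.\<close>

lemma sphere_measure_eq:
  "sphere_measure = scale_measure (of_nat DIM('a))
     (distr (restrict_space lborel (cball 0 1 - {0})) (restrict_space borel (sphere 0 1))
       (\<lambda>x::'a::euclidean_space. x /\<^sub>R norm x))" (is "_ = ?N")
proof -
  let ?S = "restrict_space borel (sphere (0::'a) 1)"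
  let ?B = "cball (0::'a) 1 - {0}"
  have sp: "space ?N = sphere 0 1" "sets ?N = sets ?S"
    by (simp_all add: space_scale_measure space_restrict_space)
  have m: "(\<lambda>x::'a. x /\<^sub>R norm x) \<in> measurable (restrict_space lborel ?B) ?S"
    by (intro measurable_restrict_space2 measurable_restrict_space1)
       (auto simp: space_restrict_space)
  have "sphere_measure = measure_of (sphere 0 1) (sets ?S) (emeasure ?N)"
    unfolding sphere_measure_def
  proof (rule measure_of_eq)
    show "sets ?S \<subseteq> Pow (sphere 0 1)" using sets.sets_into_space[of _ ?S] by (auto simp: space_restrict_space)
    fix A assume "A \<in> sigma_sets (sphere 0 1) (sets ?S)"
    then have A: "A \<in> sets ?S"
      using sets.sigma_sets_eq[of ?S] by (simp add: space_restrict_space)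
    then have AS: "A \<subseteq> sphere 0 1" using sets.sets_into_space[of A ?S] by (auto simp: space_restrict_space)
    \<comment> \<open>The cone over A is the preimage of A under radial projection.\<close>
    have eq: "{t *\<^sub>R x | t x. t \<in> {0<..1} \<and> x \<in> A} = (\<lambda>x. x /\<^sub>R norm x) -` A \<inter> ?B"
    proof (intro set_eqI iffI)
      fix y assume "y \<in> {t *\<^sub>R x | t x. t \<in> {0<..1} \<and> x \<in> A}"
      then obtain t x where y: "y = t *\<^sub>R x" "0 < t" "t \<le> 1" "x \<in> A" by auto
      then have "norm x = 1" using AS by auto
      then show "y \<in> (\<lambda>x. x /\<^sub>R norm x) -` A \<inter> ?B" using y by auto
    next
      fix y assume "y \<in> (\<lambda>x. x /\<^sub>R norm x) -` A \<inter> ?B"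
      then show "y \<in> {t *\<^sub>R x | t x. t \<in> {0<..1} \<and> x \<in> A}"
        by (intro CollectI exI[of _ "norm y"] exI[of _ "y /\<^sub>R norm y"]) auto
    qed
    have "emeasure ?N A = of_nat DIM('a) * emeasure (restrict_space lborel ?B) ((\<lambda>x. x /\<^sub>R norm x) -` A \<inter> ?B)"
      using emeasure_distr[OF m A] by (simp add: space_restrict_space)
    also have "\<dots> = of_nat DIM('a) * emeasure lborel ((\<lambda>x. x /\<^sub>R norm x) -` A \<inter> ?B)"
      by (subst emeasure_restrict_space) auto
    finally show "of_nat DIM('a) * emeasure lborel {t *\<^sub>R x | t x. t \<in> {0<..1} \<and> x \<in> A} = emeasure ?N A"
      by (simp only: eq)
  qed
  also have "\<dots> = ?N" using measure_of_of_measure[of ?N] by (simp only: sp)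
  finally show ?thesis .
qed

lemma sets_sphere_measure: "sets sphere_measure = sets (restrict_space borel (sphere (0::'a::euclidean_space) 1))"
  by (simp add: sphere_measure_eq)

lemma space_sphere_measure: "space sphere_measure = sphere (0::'a::euclidean_space) 1"
  by (simp add: sphere_measure_eq space_scale_measure space_restrict_space)

lemma emeasure_sphere_measure:
  "emeasure sphere_measure (sphere (0::'a::euclidean_space) 1) = of_nat DIM('a) * emeasure lborel (cball (0::'a) 1)"
proof -
  let ?S = "restrict_space borel (sphere (0::'a) 1)"
  let ?B = "cball (0::'a) 1 - {0}"
  have m: "(\<lambda>x::'a. x /\<^sub>R norm x) \<in> measurable (restrict_space lborel ?B) ?S"
    by (intro measurable_restrict_space2 measurable_restrict_space1)
       (auto simp: space_restrict_space)
  have S: "sphere 0 1 \<in> sets ?S" using sets.top[of ?S] by (simp add: space_restrict_space)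
  have "(\<lambda>x::'a. x /\<^sub>R norm x) -` sphere 0 1 \<inter> ?B = ?B" by auto
  then have "emeasure sphere_measure (sphere (0::'a) 1) = of_nat DIM('a) * emeasure (restrict_space lborel ?B) ?B"
    using emeasure_distr[OF m S] by (simp add: sphere_measure_eq space_restrict_space)
  also have "emeasure (restrict_space lborel ?B) ?B = emeasure lborel ?B"
    by (subst emeasure_restrict_space) auto
  also have "\<dots> = emeasure lborel (cball (0::'a) 1)"
    by (subst emeasure_Diff) auto
  finally show ?thesis .
qed

lemma finite_measure_sphere_measure: "finite_measure (sphere_measure :: 'a::euclidean_space measure)"
  using emeasure_lborel_cball_finite[of "0::'a" 1]
  by (intro finite_measureI)
     (simp add: space_sphere_measure emeasure_sphere_measure ennreal_mult_eq_top_iff less_top)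

lemma measure_sphere_measure_pos: "0 < measure (sphere_measure :: 'a::euclidean_space measure) (space sphere_measure)"
proof -
  interpret finite_measure "sphere_measure :: 'a measure" by (rule finite_measure_sphere_measure)
  have "emeasure lborel (cball (0::'a) 1) \<noteq> 0"
    using content_cball_pos[of 1 "0::'a"] by (auto simp: measure_def)
  then have "emeasure (sphere_measure :: 'a measure) (space sphere_measure) \<noteq> 0"
    by (simp add: space_sphere_measure emeasure_sphere_measure)
  then show ?thesis by (simp add: emeasure_eq_measure ennreal_eq_0_iff zero_less_measure_iff)
qed

subsection \<open>Minimising the energy on a finite-dimensional space\<close>

lemma powr_sum_integrable:
  fixes f :: "'i \<Rightarrow> 'a \<Rightarrow> real"
  assumes "finite I" "0 < q" and meas: "\<And>k. k \<in> I \<Longrightarrow> f k \<in> borel_measurable M"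
    and pos: "\<And>k x. 0 \<le> f k x" and int: "\<And>k. k \<in> I \<Longrightarrow> integrable M (\<lambda>x. f k x powr q)"
  shows "integrable M (\<lambda>x. (\<Sum>k\<in>I. f k x) powr q)"
  using assms(1) meas int
proof (induction I rule: finite_induct)
  case (insert i I)
  note [measurable] = insert(4)[OF insertI1] insert(4)[OF insertI2]
  have "integrable M (\<lambda>x. 2 powr q * (f i x powr q + (\<Sum>k\<in>I. f k x) powr q))"
    using insert by (intro integrable_mult_right Bochner_Integration.integrable_add) auto
  then show ?case
  proof (rule Bochner_Integration.integrable_bound)
    show "AE x in M. norm ((\<Sum>k\<in>insert i I. f k x) powr q) \<le> norm (2 powr q * (f i x powr q + (\<Sum>k\<in>I. f k x) powr q))"
      using powr_add_le[of "f i x" "\<Sum>k\<in>I. f k x" q for x] assms(2) pos insert(1,2)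
      by (intro AE_I2) (simp add: sum_nonneg)
    have [measurable]: "(\<lambda>x. \<Sum>k\<in>insert i I. f k x) \<in> borel_measurable M"
      by (intro borel_measurable_sum insert(4))
    show "(\<lambda>x. (\<Sum>k\<in>insert i I. f k x) powr q) \<in> borel_measurable M" by measurable
  qed
qed simp

text \<open>After division by s^p the lower-order terms carry negative exponents and tend to
  0.\<close>

lemma coercive_polynomial:
  fixes a b e p q :: real
  assumes "0 < a" "0 \<le> b" "0 \<le> e" "1 < q" "q < p"
  obtains R where "0 < R" "\<And>s. R \<le> s \<Longrightarrow> 0 < a * s powr p - b * s powr q - e * s"
proof -
  have "((\<lambda>s. b * s powr (q - p) + e * s powr (1 - p)) \<longlongrightarrow> b * 0 + e * 0) at_top"
    using assms by (intro tendsto_add tendsto_mult tendsto_const tendsto_neg_powr filterlim_ident) auto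
  then have "eventually (\<lambda>s. b * s powr (q - p) + e * s powr (1 - p) < a) at_top"
    using assms(1) by (intro order_tendstoD(2)[of _ 0]) auto
  then obtain R0 where R0: "\<And>s. R0 \<le> s \<Longrightarrow> b * s powr (q - p) + e * s powr (1 - p) < a"
    by (auto simp: eventually_at_top_linorder)
  \<comment> \<open>Taking at least 1 keeps s positive, so that s^p can be cancelled.\<close>
  show thesis
  proof (rule that[of "max R0 1"])
    fix s assume s: "max R0 1 \<le> s"
    then have "(b * s powr (q - p) + e * s powr (1 - p)) * s powr p < a * s powr p"
      using R0[of s] by (intro mult_strict_right_mono) auto
    moreover have "s powr (q - p) * s powr p = s powr q" "s powr (1 - p) * s powr p = s"
      using s by (simp_all add: powr_add[symmetric])
    ultimately show "0 < a * s powr p - b * s powr q - e * s"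
      by (simp add: algebra_simps)
  qed simp
qed

text \<open>The variational problem in coordinates: \<open>M\<close> stands for Lebesgue measure on
  \<Omega>, \<open>G k\<close> for the gradient of \<open>w k\<close>, \<open>\<beta> k\<close> for
  the integral of \<open>f\<close> against \<open>w k\<close>, and \<open>\<gamma>\<close> for the
  p-th power of the constant in the energy. The analysis of Sobolev functions enters only through
  \<open>G_pos\<close> and \<open>w_pos\<close>.\<close>

locale energy_family =
  fixes M :: "'b measure" and \<sigma> :: "'a::euclidean_space measure" and I :: "nat set"
    and w :: "nat \<Rightarrow> 'b \<Rightarrow> real" and G :: "nat \<Rightarrow> 'b \<Rightarrow> 'a" and p \<alpha> \<gamma> n :: real and \<beta> :: "nat \<Rightarrow> real"
  assumes I: "finite I" "I \<noteq> {}" and \<alpha>: "1 < \<alpha>" "\<alpha> < p" and \<gamma>: "0 < \<gamma>" and n: "0 < n"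
    and w_meas: "\<And>k. k \<in> I \<Longrightarrow> w k \<in> borel_measurable M"
    and G_meas: "\<And>k. k \<in> I \<Longrightarrow> G k \<in> borel_measurable M"
    and w_int: "\<And>k. k \<in> I \<Longrightarrow> integrable M (\<lambda>x. \<bar>w k x\<bar> powr \<alpha>)"
    and G_int: "\<And>k. k \<in> I \<Longrightarrow> integrable M (\<lambda>x. norm (G k x) powr p)"
    and \<sigma>_finite: "finite_measure \<sigma>" and \<sigma>_sets: "sets \<sigma> = sets (restrict_space borel (sphere 0 1))"
    and \<sigma>_pos: "0 < measure \<sigma> (space \<sigma>)"
    and G_pos: "\<And>c \<xi>. \<exists>k\<in>I. c k \<noteq> 0 \<Longrightarrow> norm \<xi> = 1 \<Longrightarrow> 0 < (\<integral>x. \<bar>(\<Sum>k\<in>I. c k *\<^sub>R G k x) \<bullet> \<xi>\<bar> powr p \<partial>M)"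
    and w_pos: "\<And>c. \<exists>k\<in>I. c k \<noteq> 0 \<Longrightarrow> 0 < (\<integral>x. \<bar>\<Sum>k\<in>I. c k * w k x\<bar> powr \<alpha> \<partial>M)"
begin

definition u :: "(nat \<Rightarrow> real) \<Rightarrow> 'b \<Rightarrow> real" where "u c x = (\<Sum>k\<in>I. c k * w k x)"
definition v :: "(nat \<Rightarrow> real) \<Rightarrow> 'b \<Rightarrow> 'a" where "v c x = (\<Sum>k\<in>I. c k *\<^sub>R G k x)"
text \<open>The l^1 norm of the coefficients in I, the yardstick for all estimates; \<open>h\<close>
  and \<open>H\<close> below are majorants that do not depend on the coefficients.\<close>

definition s :: "(nat \<Rightarrow> real) \<Rightarrow> real" where "s c = (\<Sum>k\<in>I. \<bar>c k\<bar>)"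
definition h :: "'b \<Rightarrow> real" where "h x = (\<Sum>k\<in>I. \<bar>w k x\<bar>)"
definition H :: "'b \<Rightarrow> real" where "H x = (\<Sum>k\<in>I. norm (G k x))"
text \<open>\<open>N\<close> is the p-th power of the directional norm, so the exponent
  \<open>- n / p\<close> in \<open>P\<close> amounts to -n on the norm itself, and \<open>J\<close>
  is the p-th power of the affine energy up to its constant.\<close>

definition N :: "(nat \<Rightarrow> real) \<Rightarrow> 'a \<Rightarrow> real" where "N c \<xi> = (\<integral>x. \<bar>v c x \<bullet> \<xi>\<bar> powr p \<partial>M)"
definition P :: "(nat \<Rightarrow> real) \<Rightarrow> real" where "P c = (\<integral>\<xi>. N c \<xi> powr (- n / p) \<partial>\<sigma>)"
definition J :: "(nat \<Rightarrow> real) \<Rightarrow> real" where "J c = P c powr (- p / n)"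
definition B :: "(nat \<Rightarrow> real) \<Rightarrow> real" where "B c = (\<integral>x. \<bar>u c x\<bar> powr \<alpha> \<partial>M)"
definition L :: "(nat \<Rightarrow> real) \<Rightarrow> real" where "L c = (\<Sum>k\<in>I. c k * \<beta> k)"
definition \<Phi> :: "(nat \<Rightarrow> real) \<Rightarrow> real" where "\<Phi> c = \<gamma> / p * J c - B c / \<alpha> - L c"
definition A :: real where "A = (\<integral>x. H x powr p \<partial>M)"

lemma p: "1 < p" using \<alpha> by simp

lemma meas [measurable]: "u c \<in> borel_measurable M" "v c \<in> borel_measurable M"
    "h \<in> borel_measurable M" "H \<in> borel_measurable M"
proof -
  note [measurable] = w_meas G_meas
  show "u c \<in> borel_measurable M" "v c \<in> borel_measurable M"
    "h \<in> borel_measurable M" "H \<in> borel_measurable M"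
    unfolding u_def[abs_def] v_def[abs_def] h_def[abs_def] H_def[abs_def] by measurable
qed

lemma h0: "0 \<le> h x" and H0: "0 \<le> H x" and s0: "0 \<le> s c"
  by (auto simp: h_def H_def s_def intro: sum_nonneg)

lemma h_int: "integrable M (\<lambda>x. h x powr \<alpha>)"
  unfolding h_def using I \<alpha> w_meas w_int by (intro powr_sum_integrable) auto

lemma H_int: "integrable M (\<lambda>x. H x powr p)"
  unfolding H_def using I p G_meas G_int by (intro powr_sum_integrable) auto

lemma abs_le_s: "k \<in> I \<Longrightarrow> \<bar>c k\<bar> \<le> s c"
  unfolding s_def using I by (intro member_le_sum) auto

lemma u_bound: "\<bar>u c x\<bar> \<le> s c * h x"
  unfolding u_def h_def sum_distrib_left
  by (rule order_trans[OF sum_abs]) (auto intro!: sum_mono mult_right_mono abs_le_s simp: abs_mult)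

lemma v_bound: "norm (v c x) \<le> s c * H x"
  unfolding v_def H_def sum_distrib_left
  by (rule sum_norm_le) (auto intro!: mult_right_mono abs_le_s)

lemma v_inner_bound: "norm \<xi> = 1 \<Longrightarrow> \<bar>v c x \<bullet> \<xi>\<bar> \<le> s c * H x"
  using Cauchy_Schwarz_ineq2[of "v c x" \<xi>] v_bound[of c x] by simp

lemma s_zero_iff: "s c = 0 \<longleftrightarrow> (\<forall>k\<in>I. c k = 0)"
  unfolding s_def using I by (subst sum_nonneg_eq_0_iff) auto

lemma s_pos_iff: "0 < s c \<longleftrightarrow> (\<exists>k\<in>I. c k \<noteq> 0)"
  using s_zero_iff[of c] s0[of c] by (auto simp: less_le)

lemma u_lin: "u (\<lambda>k. c k + t * d k) x = u c x + t * u d x"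
  by (simp add: u_def sum_distrib_left sum.distrib algebra_simps)
lemma v_lin: "v (\<lambda>k. c k + t * d k) x = v c x + t *\<^sub>R v d x"
  by (simp add: v_def scaleR_sum_right sum.distrib scaleR_add_left)
lemma L_lin: "L (\<lambda>k. c k + t * d k) = L c + t * L d"
  by (simp add: L_def sum_distrib_left sum.distrib algebra_simps)
lemma u_scale: "u (\<lambda>k. t * c k) x = t * u c x"
  by (simp add: u_def sum_distrib_left mult.assoc)
lemma v_scale: "v (\<lambda>k. t * c k) x = t *\<^sub>R v c x"
  by (simp add: v_def scaleR_sum_right)
lemma s_scale: "s (\<lambda>k. t * c k) = \<bar>t\<bar> * s c"
  by (simp add: s_def sum_distrib_left abs_mult)
lemma L_scale: "L (\<lambda>k. t * c k) = t * L c"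
  by (simp add: L_def sum_distrib_left mult.assoc)
lemma N_scale: "N (\<lambda>k. t * c k) \<xi> = \<bar>t\<bar> powr p * N c \<xi>"
  by (simp add: N_def v_scale abs_mult powr_mult)
lemma B_scale: "B (\<lambda>k. t * c k) = \<bar>t\<bar> powr \<alpha> * B c"
  by (simp add: B_def u_scale abs_mult powr_mult)

text \<open>Coefficient functions are defined on all of \<open>nat\<close>; this permits passing to
  representatives that vanish off I, for which compactness is available.\<close>

lemma cong_on_I:
  assumes "\<And>k. k \<in> I \<Longrightarrow> c k = d k"
  shows "u c = u d" "v c = v d" "s c = s d" "L c = L d"
  using assms by (auto simp: u_def v_def s_def L_def fun_eq_iff)

lemma \<Phi>_cong: "(\<And>k. k \<in> I \<Longrightarrow> c k = d k) \<Longrightarrow> \<Phi> c = \<Phi> d"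
  using cong_on_I[of c d] by (simp add: \<Phi>_def J_def P_def N_def B_def)

section \<open>Bounds and continuity in the coefficients\<close>

lemma N_nonneg: "0 \<le> N c \<xi>" by (simp add: N_def)

lemma N_le: "norm \<xi> = 1 \<Longrightarrow> N c \<xi> \<le> s c powr p * A"
  unfolding N_def A_def using p v_inner_bound s0 H0 H_int
  by (intro abs_powr_integrable_bound(2)) auto

lemma B_le: "B c \<le> s c powr \<alpha> * (\<integral>x. h x powr \<alpha> \<partial>M)"
  unfolding B_def using \<alpha> u_bound s0 h0 h_int
  by (intro abs_powr_integrable_bound(2)) auto

lemma L_le: "\<bar>L c\<bar> \<le> s c * (\<Sum>k\<in>I. \<bar>\<beta> k\<bar>)"
  unfolding L_def sum_distrib_left
  by (rule order_trans[OF sum_abs]) (auto intro!: sum_mono mult_right_mono abs_le_s simp: abs_mult)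

lemma N_pos: "0 < s c \<Longrightarrow> norm \<xi> = 1 \<Longrightarrow> 0 < N c \<xi>"
  using G_pos[of c \<xi>] by (simp add: s_pos_iff N_def v_def)

lemma B_pos: "0 < s c \<Longrightarrow> 0 < B c"
  using w_pos[of c] by (simp add: s_pos_iff B_def u_def)

lemma s_tendsto: "(\<And>k. k \<in> I \<Longrightarrow> (\<lambda>j. c j k) \<longlonglongrightarrow> d k) \<Longrightarrow> (\<lambda>j. s (c j)) \<longlonglongrightarrow> s d"
  unfolding s_def by (intro tendsto_sum tendsto_rabs)

lemma L_tendsto: "(\<And>k. k \<in> I \<Longrightarrow> (\<lambda>j. c j k) \<longlonglongrightarrow> d k) \<Longrightarrow> (\<lambda>j. L (c j)) \<longlonglongrightarrow> L d"
  unfolding L_def by (intro tendsto_sum tendsto_mult tendsto_const)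

lemma B_tendsto:
  assumes "\<And>k. k \<in> I \<Longrightarrow> (\<lambda>j. c j k) \<longlonglongrightarrow> d k" "\<And>j. s (c j) \<le> K"
  shows "(\<lambda>j. B (c j)) \<longlonglongrightarrow> B d"
  unfolding B_def
proof (rule abs_powr_integral_tendsto[where K=K and h=h])
  show "\<bar>u (c j) x\<bar> \<le> K * h x" for j x
    using u_bound[of "c j" x] mult_right_mono[OF assms(2)[of j] h0[of x]] by linarith
  show "(\<lambda>j. u (c j) x) \<longlonglongrightarrow> u d x" for x
    unfolding u_def using assms(1) by (intro tendsto_sum tendsto_mult tendsto_const)
  show "0 \<le> K" using assms(2)[of 0] s0[of "c 0"] by linarith
qed (use \<alpha> h0 h_int in auto)

lemma N_tendsto:
  assumes "\<And>k. k \<in> I \<Longrightarrow> (\<lambda>j. c j k) \<longlonglongrightarrow> d k" "\<And>j. s (c j) \<le> K" "\<xi> \<longlonglongrightarrow> \<zeta>" "\<And>j. norm (\<xi> j) = 1"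
  shows "(\<lambda>j. N (c j) (\<xi> j)) \<longlonglongrightarrow> N d \<zeta>"
  unfolding N_def
proof (rule abs_powr_integral_tendsto[where K=K and h=H])
  show "\<bar>v (c j) x \<bullet> \<xi> j\<bar> \<le> K * H x" for j x
    using v_inner_bound[OF assms(4), of "c j" x j] mult_right_mono[OF assms(2)[of j] H0[of x]] by linarith
  show "(\<lambda>j. v (c j) x \<bullet> \<xi> j) \<longlonglongrightarrow> v d x \<bullet> \<zeta>" for x
    unfolding v_def using assms(1,3) by (intro tendsto_inner tendsto_sum tendsto_scaleR tendsto_const)
  show "0 \<le> K" using assms(2)[of 0] s0[of "c 0"] by linarith
qed (use p H0 H_int in auto)

lemma s_continuous: "continuous_on UNIV s"
  unfolding s_def[abs_def] by (intro continuous_intros continuous_on_product_coordinates)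

text \<open>In the product topology the set is a closed part of a product of intervals and
  singletons. The set T is left general to cover both the unit sphere \<open>{1}\<close> and the
  ball \<open>{..R0}\<close>.\<close>

lemma compact_level:
  assumes "closed T" "T \<subseteq> {..R}"
  shows "compact {c. (\<forall>k. k \<notin> I \<longrightarrow> c k = 0) \<and> s c \<in> T}"
proof -
  let ?S = "\<lambda>k. if k \<in> I then {-R..R} else {0}"
  let ?K = "PiE UNIV ?S"
  have "compactin (product_topology (\<lambda>i. euclidean) UNIV) ?K"
    unfolding compactin_PiE by (auto simp: compactin_euclidean_iff)
  then have "compact ?K" by (simp add: euclidean_product_topology compactin_euclidean_iff)
  moreover have "closed (s -` T)"
    using s_continuous assms(1) by (simp add: closed_vimage)
  ultimately have "compact (?K \<inter> s -` T)" by (rule compact_Int_closed)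
  moreover have "{c. (\<forall>k. k \<notin> I \<longrightarrow> c k = 0) \<and> s c \<in> T} = ?K \<inter> s -` T"
  proof (intro set_eqI iffI)
    fix c assume c: "c \<in> {c. (\<forall>k. k \<notin> I \<longrightarrow> c k = 0) \<and> s c \<in> T}"
    have "c k \<in> {-R..R}" if "k \<in> I" for k using abs_le_s[OF that, of c] c assms(2) by force
    then show "c \<in> ?K \<inter> s -` T" using c by (auto simp: PiE_iff)
  qed (auto simp: PiE_iff split: if_splits)
  ultimately show ?thesis by simp
qed

lemma coordinate_tendsto:
  fixes c :: "nat \<Rightarrow> nat \<Rightarrow> real"
  assumes "c \<longlonglongrightarrow> d" shows "(\<lambda>j. c j k) \<longlonglongrightarrow> d k"
  using continuous_on_tendsto_compose[OF continuous_on_product_coordinates assms] by simp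

text \<open>The minimum is taken jointly over normalised coefficients and directions, which makes it
  uniform in the direction; homogeneity of degree p extends it to all coefficients.\<close>

lemma N_lower_bound: obtains \<delta> where "0 < \<delta>" "\<And>c \<xi>. norm \<xi> = 1 \<Longrightarrow> \<delta> * s c powr p \<le> N c \<xi>"
proof -
  define C where "C = {c. (\<forall>k. k \<notin> I \<longrightarrow> c k = 0) \<and> s c \<in> {1}}"
  have comp: "compact (C \<times> sphere (0::'a) 1)"
    unfolding C_def by (intro compact_Times compact_level[of _ 1]) auto
  obtain i where i: "i \<in> I" using I by auto
  have "(\<lambda>k. if k = i then 1 else 0) \<in> C"
    using i I by (auto simp: C_def s_def if_distrib cong: if_cong)
  moreover obtain b :: 'a where "b \<in> sphere 0 1" using norm_Basis nonempty_Basis by fastforce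
  ultimately have ne: "C \<times> sphere (0::'a) 1 \<noteq> {}" by blast
  have "continuous_on (C \<times> sphere 0 1) (\<lambda>z. N (fst z) (snd z))"
  proof (rule continuous_on_sequentiallyI)
    fix z and a :: "(nat \<Rightarrow> real) \<times> 'a"
    assume z: "\<forall>j. z j \<in> C \<times> sphere 0 1" "z \<longlonglongrightarrow> a"
    have "(\<lambda>j. fst (z j)) \<longlonglongrightarrow> fst a" "(\<lambda>j. snd (z j)) \<longlonglongrightarrow> snd a"
      using tendsto_fst[OF z(2)] tendsto_snd[OF z(2)] by auto
    moreover have "s (fst (z j)) \<le> 1" "norm (snd (z j)) = 1" for j
      using z(1)[rule_format, of j] by (auto simp: C_def mem_Times_iff)
    ultimately show "(\<lambda>j. N (fst (z j)) (snd (z j))) \<longlonglongrightarrow> N (fst a) (snd a)"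
      by (intro N_tendsto[where K=1] coordinate_tendsto) auto
  qed
  then obtain z where z: "z \<in> C \<times> sphere 0 1"
      "\<And>y. y \<in> C \<times> sphere 0 1 \<Longrightarrow> N (fst z) (snd z) \<le> N (fst y) (snd y)"
    using continuous_attains_inf[OF comp ne] by blast
  let ?\<delta> = "N (fst z) (snd z)"
  show thesis
  proof (rule that[of ?\<delta>])
    show "0 < ?\<delta>" using z(1) by (intro N_pos) (auto simp: C_def mem_Times_iff)
    fix c :: "nat \<Rightarrow> real" and \<xi> :: 'a assume \<xi>: "norm \<xi> = 1"
    show "?\<delta> * s c powr p \<le> N c \<xi>"
    proof (cases "s c = 0")
      case False
      then have sc: "0 < s c" using s0[of c] by linarith
      \<comment> \<open>Scaling to \<open>s e = 1\<close> and cutting off outside I puts the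
        coefficients into the compact set; neither change affects \<open>N\<close> beyond the factor
        \<open>s c powr p\<close>.\<close>
      define e where "e k = (if k \<in> I then (1 / s c) * c k else 0)" for k
      have se: "s e = 1" using cong_on_I(3)[of e "\<lambda>k. (1 / s c) * c k"] sc
        by (simp only: e_def s_scale) simp
      then have "(e, \<xi>) \<in> C \<times> sphere 0 1" using \<xi> by (auto simp: C_def e_def)
      then have "?\<delta> \<le> N e \<xi>" using z(2) by fastforce
      then have "?\<delta> * s c powr p \<le> s c powr p * N e \<xi>" by (simp add: mult.commute mult_left_mono)
      also have "\<dots> = N (\<lambda>k. s c * e k) \<xi>" using sc by (simp add: N_scale)
      also have "\<dots> = N c \<xi>"
        using cong_on_I(2)[of "\<lambda>k. s c * e k" c] sc by (simp add: N_def e_def)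
      finally show ?thesis .
    qed (simp add: N_nonneg)
  qed
qed

lemma \<sigma>_space: "space \<sigma> = sphere 0 1"
  using sets_eq_imp_space_eq[OF \<sigma>_sets] by (simp add: space_restrict_space)

text \<open>Continuity in the direction is enough and avoids joint measurability on the
  product.\<close>

lemma N_meas [measurable]: "N c \<in> borel_measurable \<sigma>"
proof -
  have "continuous_on (sphere 0 1) (N c)"
    by (rule continuous_on_sequentiallyI) (auto intro!: N_tendsto[where K="s c"])
  then have "N c \<in> borel_measurable (restrict_space borel (sphere 0 1))"
    by (rule borel_measurable_continuous_on_restrict)
  then show ?thesis by (simp add: measurable_cong_sets[OF \<sigma>_sets refl])
qed

lemma A_pos: "0 < A"
proof -
  obtain i where i: "i \<in> I" using I by auto
  define c :: "nat \<Rightarrow> real" where "c k = (if k = i then 1 else 0)" for k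
  have c: "0 < s c" using i by (auto simp: s_pos_iff c_def)
  obtain b :: 'a where b: "norm b = 1" using norm_Basis nonempty_Basis by fastforce
  have "0 < s c powr p * A" using N_pos[OF c b] N_le[OF b, of c] by linarith
  then show ?thesis by (simp add: zero_less_mult_iff)
qed

lemma N_zero: "s c = 0 \<Longrightarrow> norm \<xi> = 1 \<Longrightarrow> N c \<xi> = 0"
  using N_le[of \<xi> c] N_nonneg[of c \<xi>] by simp

text \<open>Powers of 0 are 0 here even for negative exponents, so \<open>P c\<close> and
  \<open>J c\<close> both vanish, in agreement with the convention that the energy of 0 is
  0.\<close>

lemma J_zero: "s c = 0 \<Longrightarrow> J c = 0"
proof -
  assume "s c = 0"
  then have "P c = (\<integral>\<xi>. 0 \<partial>\<sigma>)" unfolding P_def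
    by (intro Bochner_Integration.integral_cong) (auto simp: \<sigma>_space N_zero)
  then show ?thesis by (simp add: J_def)
qed

lemma J_nonneg: "0 \<le> J c" by (simp add: J_def)

lemma N_powr_bound:
  assumes "0 < d" "d \<le> N c \<xi>" "e \<le> 0" shows "N c \<xi> powr e \<le> d powr e"
  using assms by (intro powr_mono2') auto

lemma P_integrable:
  assumes "0 < s c" "e \<le> 0" shows "integrable \<sigma> (\<lambda>\<xi>. N c \<xi> powr e)"
proof -
  interpret finite_measure \<sigma> by (rule \<sigma>_finite)
  obtain \<delta> where \<delta>: "0 < \<delta>" "\<And>c \<xi>. norm \<xi> = 1 \<Longrightarrow> \<delta> * s c powr p \<le> N c \<xi>"
    using N_lower_bound by metis
  show ?thesis
    by (rule integrable_const_bound[where B="(\<delta> * s c powr p) powr e"])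
       (use assms \<delta> in \<open>auto simp: \<sigma>_space intro!: N_powr_bound AE_I2\<close>)
qed

text \<open>The negative exponent reverses inequalities: the upper bound \<open>N_le\<close> yields
  the lower bound, and a lower bound \<open>d\<close> for \<open>N\<close> yields the upper one.
  Positivity rests on the positive mass of \<sigma> and on \<open>A_pos\<close>.\<close>

lemma P_bounds:
  assumes c: "0 < s c" and d: "0 < d" "\<And>\<xi>. norm \<xi> = 1 \<Longrightarrow> d \<le> N c \<xi>"
  shows "(s c powr p * A) powr (- n / p) * measure \<sigma> (space \<sigma>) \<le> P c"
    and "P c \<le> d powr (- n / p) * measure \<sigma> (space \<sigma>)"
    and "0 < P c"
proof -
  interpret finite_measure \<sigma> by (rule \<sigma>_finite)
  have neg: "- n / p \<le> 0" using n p by simp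
  have "(\<integral>\<xi>. (s c powr p * A) powr (- n / p) \<partial>\<sigma>) \<le> P c"
    unfolding P_def
    using P_integrable[OF c neg] neg N_le[of _ c] N_pos[OF c]
    by (intro integral_mono) (auto simp: \<sigma>_space intro!: powr_mono2')
  then show 1: "(s c powr p * A) powr (- n / p) * measure \<sigma> (space \<sigma>) \<le> P c"
    by (simp add: mult.commute)
  have "0 < (s c powr p * A) powr (- n / p) * measure \<sigma> (space \<sigma>)"
    using \<sigma>_pos c A_pos by simp
  then show "0 < P c" using 1 by linarith
  have "P c \<le> (\<integral>\<xi>. d powr (- n / p) \<partial>\<sigma>)"
    unfolding P_def using P_integrable[OF c neg] d neg
    by (intro integral_mono) (auto simp: \<sigma>_space intro!: N_powr_bound)
  then show "P c \<le> d powr (- n / p) * measure \<sigma> (space \<sigma>)" by (simp add: mult.commute)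
qed

text \<open>The lower constant gives coercivity, the upper one continuity at zero
  coefficients.\<close>

lemma J_bounds:
  obtains c1 c2 where "0 < c1" "\<And>c. c1 * s c powr p \<le> J c" "\<And>c. J c \<le> c2 * s c powr p"
proof -
  define m where "m = measure \<sigma> (space \<sigma>)"
  have m: "0 < m" using \<sigma>_pos by (simp add: m_def)
  obtain \<delta> where \<delta>: "0 < \<delta>" "\<And>c \<xi>. norm \<xi> = 1 \<Longrightarrow> \<delta> * s c powr p \<le> N c \<xi>"
    using N_lower_bound by metis
  \<comment> \<open>The exponents \<open>- n / p\<close> and \<open>- p / n\<close> multiply to 1,
    so bounds on \<open>P\<close> turn into bounds on \<open>J\<close> linear in x.\<close>
  have pw: "(x powr (- n / p) * m) powr (- p / n) = x * m powr (- p / n)" if "0 < x" for x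
  proof -
    have "- n / p * (- p / n) = 1" using n p by simp
    then show ?thesis using that m by (simp add: powr_mult powr_powr)
  qed
  have neg: "- p / n \<le> 0" using n p by simp
  have lo: "m powr (- p / n) * \<delta> * s c powr p \<le> J c" for c
  proof (cases "s c = 0")
    case False
    then have c: "0 < s c" using s0[of c] by linarith
    have x: "0 < \<delta> * s c powr p" using \<delta>(1) c by simp
    note b = P_bounds[OF c x \<delta>(2), folded m_def]
    have "((\<delta> * s c powr p) powr (- n / p) * m) powr (- p / n) \<le> J c"
      unfolding J_def using b neg by (intro powr_mono2') auto
    then show ?thesis unfolding pw[OF x] by (simp add: mult_ac)
  qed (simp add: J_zero)
  have hi: "J c \<le> (m powr (- p / n) * A) * s c powr p" for c
  proof (cases "s c = 0")
    case False
    then have c: "0 < s c" using s0[of c] by linarith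
    have x: "0 < \<delta> * s c powr p" and y: "0 < s c powr p * A" using \<delta>(1) c A_pos by simp_all
    note b = P_bounds[OF c x \<delta>(2), folded m_def]
    have "0 < (s c powr p * A) powr (- n / p) * m"
      by (intro mult_pos_pos m, unfold powr_gt_zero) (use y in linarith)
    then have "J c \<le> ((s c powr p * A) powr (- n / p) * m) powr (- p / n)"
      unfolding J_def using b neg by (intro powr_mono2') auto
    then show ?thesis unfolding pw[OF y] by (simp add: mult_ac)
  qed (simp add: J_zero)
  show thesis using that[OF _ lo hi] m \<delta>(1) by simp
qed

lemma P_tendsto:
  assumes lim: "\<And>k. k \<in> I \<Longrightarrow> (\<lambda>j. c j k) \<longlonglongrightarrow> d k" and K: "\<And>j. s (c j) \<le> K" and d: "0 < s d"
  shows "(\<lambda>j. P (c j)) \<longlonglongrightarrow> P d"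
proof -
  interpret finite_measure \<sigma> by (rule \<sigma>_finite)
  obtain \<delta> where \<delta>: "0 < \<delta>" "\<And>c \<xi>. norm \<xi> = 1 \<Longrightarrow> \<delta> * s c powr p \<le> N c \<xi>"
    using N_lower_bound by metis
  have "eventually (\<lambda>j. s d / 2 < s (c j)) sequentially"
    using d by (intro order_tendstoD(1)[OF s_tendsto[OF lim]]) auto
  then obtain j0 where j0: "\<And>j. j0 \<le> j \<Longrightarrow> s d / 2 < s (c j)" by (auto simp: eventually_sequentially)
  \<comment> \<open>On the tail from j0 the norms \<open>s (c j)\<close> exceed half of
    \<open>s d\<close>, so \<open>e\<close> is a common lower bound for \<open>N\<close>, and its
    negative power is a constant majorant on the sphere.\<close>
  define e where "e = \<delta> * (s d / 2) powr p"
  have e: "0 < e" using \<delta>(1) d by (simp add: e_def)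
  have neg: "- n / p \<le> 0" using n p by simp
  have "(\<lambda>j. P (c (j + j0))) \<longlonglongrightarrow> P d"
    unfolding P_def
  proof (rule integral_dominated_convergence[where w="\<lambda>_. e powr (- n / p)"])
    show "AE \<xi> in \<sigma>. (\<lambda>j. N (c (j + j0)) \<xi> powr (- n / p)) \<longlonglongrightarrow> N d \<xi> powr (- n / p)"
    proof (rule AE_I2)
      fix \<xi> assume "\<xi> \<in> space \<sigma>"
      then have \<xi>: "norm \<xi> = 1" by (simp add: \<sigma>_space)
      have "(\<lambda>j. N (c (j + j0)) \<xi>) \<longlonglongrightarrow> N d \<xi>"
        using lim K \<xi> LIMSEQ_ignore_initial_segment[OF lim] by (intro N_tendsto[where K=K]) auto
      then show "(\<lambda>j. N (c (j + j0)) \<xi> powr (- n / p)) \<longlonglongrightarrow> N d \<xi> powr (- n / p)"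
        using N_pos[OF d \<xi>] by (intro tendsto_powr tendsto_const) auto
    qed
    show "AE \<xi> in \<sigma>. norm (N (c (j + j0)) \<xi> powr (- n / p)) \<le> e powr (- n / p)" for j
    proof (rule AE_I2)
      fix \<xi> assume "\<xi> \<in> space \<sigma>"
      then have \<xi>: "norm \<xi> = 1" by (simp add: \<sigma>_space)
      have "e \<le> \<delta> * s (c (j + j0)) powr p"
        unfolding e_def using \<delta>(1) d p j0[of "j + j0"] by (intro mult_left_mono powr_mono2) auto
      then have "e \<le> N (c (j + j0)) \<xi>" using \<delta>(2)[OF \<xi>, of "c (j + j0)"] by linarith
      then show "norm (N (c (j + j0)) \<xi> powr (- n / p)) \<le> e powr (- n / p)"
        using N_powr_bound[OF e _ neg] by simp
    qed
  qed measurable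
  then show ?thesis by (rule LIMSEQ_offset)
qed

text \<open>At zero coefficients no lower bound on \<open>N\<close> survives and convergence of
  \<open>P\<close> is not at hand; there the upper bound in \<open>J_bounds\<close> squeezes
  \<open>J\<close> to 0.\<close>

lemma J_tendsto:
  assumes lim: "\<And>k. k \<in> I \<Longrightarrow> (\<lambda>j. c j k) \<longlonglongrightarrow> d k" and K: "\<And>j. s (c j) \<le> K"
  shows "(\<lambda>j. J (c j)) \<longlonglongrightarrow> J d"
proof (cases "s d = 0")
  case True
  obtain c2 where c2: "\<And>c. J c \<le> c2 * s c powr p" using J_bounds by metis
  have "(\<lambda>j. c2 * s (c j) powr p) \<longlonglongrightarrow> c2 * s d powr p"
    using p s0 by (intro tendsto_mult tendsto_const tendsto_powr' s_tendsto lim) auto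
  then have "(\<lambda>j. c2 * s (c j) powr p) \<longlonglongrightarrow> 0" using True by simp
  then have "(\<lambda>j. J (c j)) \<longlonglongrightarrow> 0"
    by (rule Lim_null_comparison[rotated]) (use c2 J_nonneg in auto)
  then show ?thesis using True by (simp add: J_zero)
next
  case False
  then have d: "0 < s d" using s0[of d] by linarith
  obtain \<delta> where \<delta>: "0 < \<delta>" "\<And>c \<xi>. norm \<xi> = 1 \<Longrightarrow> \<delta> * s c powr p \<le> N c \<xi>"
    using N_lower_bound by metis
  have "0 < P d" using P_bounds(3)[OF d, of "\<delta> * s d powr p"] \<delta> d by simp
  then show ?thesis unfolding J_def using P_tendsto[OF lim K d] by (intro tendsto_powr tendsto_const) auto
qed

lemma \<Phi>_tendsto:
  assumes "\<And>k. k \<in> I \<Longrightarrow> (\<lambda>j. c j k) \<longlonglongrightarrow> d k" "\<And>j. s (c j) \<le> K"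
  shows "(\<lambda>j. \<Phi> (c j)) \<longlonglongrightarrow> \<Phi> d"
  unfolding \<Phi>_def using \<alpha> p
  by (intro tendsto_diff tendsto_mult tendsto_divide tendsto_const J_tendsto[where K=K] B_tendsto[where K=K] L_tendsto assms) auto

section \<open>Homogeneity and existence of a nonzero minimiser\<close>

lemma P_scale: "t \<noteq> 0 \<Longrightarrow> P (\<lambda>k. t * c k) = \<bar>t\<bar> powr (- n) * P c"
  using p by (simp add: P_def N_scale powr_mult powr_powr)

lemma J_scale: "t \<noteq> 0 \<Longrightarrow> J (\<lambda>k. t * c k) = \<bar>t\<bar> powr p * J c"
  using n by (simp add: J_def P_scale powr_mult powr_powr)

lemma \<Phi>_zero: "s c = 0 \<Longrightarrow> \<Phi> c = 0"
proof -
  assume s: "s c = 0"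
  have "B c \<le> 0" using B_le[of c] s by simp
  moreover have "0 \<le> B c" by (simp add: B_def)
  moreover have "\<bar>L c\<bar> \<le> 0" using L_le[of c] s by simp
  ultimately show ?thesis using s by (simp add: \<Phi>_def J_zero)
qed

text \<open>The sign \<epsilon> makes the linear term nonpositive in \<Phi>. After division by
  t^\<alpha> the energy term has the positive exponent p - \<alpha> and is beaten by
  \<open>B c / \<alpha>\<close> for small t.\<close>

lemma \<Phi>_negative:
  obtains c where "\<Phi> c < 0"
proof -
  obtain i where i: "i \<in> I" using I by auto
  define c0 :: "nat \<Rightarrow> real" where "c0 k = (if k = i then 1 else 0)" for k
  define \<epsilon> :: real where "\<epsilon> = (if 0 \<le> L c0 then 1 else -1)"
  define c where "c = (\<lambda>k. \<epsilon> * c0 k)"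
  have "s c0 > 0" using i by (auto simp: s_pos_iff c0_def)
  then have c: "0 < s c" by (simp add: c_def s_scale \<epsilon>_def)
  have Lc: "0 \<le> L c" by (simp add: c_def L_scale \<epsilon>_def)
  have "((\<lambda>t. t powr (p - \<alpha>)) \<longlongrightarrow> 0 powr (p - \<alpha>)) (at_right 0)"
    using \<alpha> by (intro tendsto_powr' tendsto_ident_at tendsto_const) (auto simp: eventually_at_right_less intro: eventually_at_right_less[THEN eventually_mono])
  then have "((\<lambda>t. \<gamma> / p * J c * t powr (p - \<alpha>)) \<longlongrightarrow> \<gamma> / p * J c * 0) (at_right 0)"
    by (intro tendsto_mult tendsto_const) simp
  then have "eventually (\<lambda>t. \<gamma> / p * J c * t powr (p - \<alpha>) < B c / \<alpha>) (at_right 0)"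
    using B_pos[OF c] \<alpha> by (intro order_tendstoD(2)) auto
  then have "eventually (\<lambda>t::real. \<gamma> / p * J c * t powr (p - \<alpha>) < B c / \<alpha> \<and> 0 < t) (at_right 0)"
    using eventually_at_right_less[of "0::real"] by (rule eventually_conj)
  then obtain t :: real where t: "0 < t" "\<gamma> / p * J c * t powr (p - \<alpha>) < B c / \<alpha>"
    using eventually_happens'[OF trivial_limit_at_right_real] by blast
  have "\<gamma> / p * J c * t powr (p - \<alpha>) * t powr \<alpha> < B c / \<alpha> * t powr \<alpha>"
    using t by (intro mult_strict_right_mono) auto
  moreover have "t powr p = t powr (p - \<alpha>) * t powr \<alpha>" by (simp add: powr_add[symmetric])
  then have "\<gamma> / p * (t powr p * J c) = \<gamma> / p * J c * t powr (p - \<alpha>) * t powr \<alpha>" by simp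
  ultimately have "\<gamma> / p * (t powr p * J c) < B c / \<alpha> * t powr \<alpha>" by linarith
  moreover have "0 \<le> t * L c" using t Lc by simp
  moreover have "\<Phi> (\<lambda>k. t * c k) = \<gamma> / p * (t powr p * J c) - B c / \<alpha> * t powr \<alpha> - t * L c"
    using t by (simp add: \<Phi>_def J_scale B_scale L_scale)
  ultimately have "\<Phi> (\<lambda>k. t * c k) < 0" by linarith
  then show thesis using that by blast
qed

text \<open>The ball is chosen so that \<Phi> is positive on and beyond its boundary while its
  minimum is negative; the minimiser is therefore interior, which the first variation
  requires.\<close>

lemma minimizer:
  obtains c R where "0 < s c" "s c < R" "\<And>d. s d \<le> R \<Longrightarrow> \<Phi> c \<le> \<Phi> d"
proof -
  obtain c1 where c1: "0 < c1" "\<And>c. c1 * s c powr p \<le> J c" using J_bounds by metis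
  have "0 < \<gamma> / p * c1" using c1 \<gamma> p by simp
  moreover have "0 \<le> (\<integral>x. h x powr \<alpha> \<partial>M) / \<alpha>" "0 \<le> (\<Sum>k\<in>I. \<bar>\<beta> k\<bar>)" using \<alpha> by (auto intro: sum_nonneg)
  ultimately obtain R0 where R0: "0 < R0" "\<And>s. R0 \<le> s \<Longrightarrow>
      0 < \<gamma> / p * c1 * s powr p - (\<integral>x. h x powr \<alpha> \<partial>M) / \<alpha> * s powr \<alpha> - (\<Sum>k\<in>I. \<bar>\<beta> k\<bar>) * s"
    using coercive_polynomial[OF _ _ _ \<alpha>] by metis
  have pos: "0 < \<Phi> c" if "R0 \<le> s c" for c
  proof -
    have "\<gamma> / p * c1 * s c powr p \<le> \<gamma> / p * J c"
      using mult_left_mono[OF c1(2)[of c], of "\<gamma> / p"] \<gamma> p by (simp add: mult.assoc)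
    moreover have "B c / \<alpha> \<le> (\<integral>x. h x powr \<alpha> \<partial>M) / \<alpha> * s c powr \<alpha>"
      using divide_right_mono[OF B_le[of c], of \<alpha>] \<alpha> by (simp add: mult.commute)
    moreover have "L c \<le> (\<Sum>k\<in>I. \<bar>\<beta> k\<bar>) * s c" using L_le[of c] by (simp add: mult.commute)
    ultimately show ?thesis using R0(2)[OF that] unfolding \<Phi>_def by linarith
  qed
  define D where "D = {c. (\<forall>k. k \<notin> I \<longrightarrow> c k = 0) \<and> s c \<in> {..R0}}"
  have comp: "compact D" unfolding D_def by (rule compact_level[of _ R0]) auto
  have "(\<lambda>_. 0) \<in> D" using R0(1) s_zero_iff[of "\<lambda>_. 0"] by (simp add: D_def)
  then have ne: "D \<noteq> {}" by blast
  have "continuous_on D \<Phi>"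
  proof (rule continuous_on_sequentiallyI)
    fix c d assume "\<forall>j. c j \<in> D" "c \<longlonglongrightarrow> d"
    then show "(\<lambda>j. \<Phi> (c j)) \<longlonglongrightarrow> \<Phi> d"
      by (intro \<Phi>_tendsto[where K=R0] coordinate_tendsto) (simp_all add: D_def)
  qed
  then obtain c where c: "c \<in> D" "\<And>d. d \<in> D \<Longrightarrow> \<Phi> c \<le> \<Phi> d"
    using continuous_attains_inf[OF comp ne] by blast
  \<comment> \<open>Compactness was used only for coefficients vanishing off I; the others are
    reduced to these by cutting off.\<close>
  have min: "\<Phi> c \<le> \<Phi> d" if "s d \<le> R0" for d
  proof -
    define e where "e k = (if k \<in> I then d k else 0)" for k
    have "e \<in> D" using that cong_on_I(3)[of e d] by (simp add: D_def e_def)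
    then show ?thesis using c(2)[of e] \<Phi>_cong[of e d] by (simp add: e_def)
  qed
  obtain c' where c': "\<Phi> c' < 0" using \<Phi>_negative .
  have "s c' < R0" using pos[of c'] c' by linarith
  then have "\<Phi> c < 0" using min[of c'] c' by simp
  \<comment> \<open>\<Phi> is 0 at zero coefficients and positive from radius R0 on, so a negative
    value excludes both.\<close>
  then have "s c \<noteq> 0" "s c < R0" using \<Phi>_zero[of c] pos[of c] by (auto simp: not_le[symmetric])
  then show thesis using that[of c R0] min s0[of c] by auto
qed

section \<open>First variation\<close>

lemma s_perturb: "s c - \<bar>t\<bar> * s d \<le> s (\<lambda>k. c k + t * d k)"
proof -
  have "s c \<le> (\<Sum>k\<in>I. \<bar>c k + t * d k\<bar> + \<bar>t\<bar> * \<bar>d k\<bar>)"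
    unfolding s_def by (intro sum_mono) (simp add: abs_mult[symmetric])
  then show ?thesis by (simp add: s_def sum.distrib sum_distrib_left)
qed

lemma perturb_radius:
  assumes "0 < s c"
  obtains r where "0 < r" "r \<le> 1" "\<And>t. \<bar>t\<bar> < r \<Longrightarrow> s c / 2 \<le> s (\<lambda>k. c k + t * d k)"
proof (rule that[of "min 1 (s c / (2 * (s d + 1)))"])
  \<comment> \<open>The summand 1 keeps the radius meaningful when \<open>s d\<close> is 0; the cap
    at 1 is what the increment bound in \<open>N_deriv\<close> asks for.\<close>
  have d: "0 < s d + 1" using s0[of d] by linarith
  then show "0 < min 1 (s c / (2 * (s d + 1)))" using assms by simp
  fix t assume "\<bar>t\<bar> < min 1 (s c / (2 * (s d + 1)))"
  then have "\<bar>t\<bar> * (s d + 1) \<le> s c / 2" using d by (simp add: field_simps)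
  then have "\<bar>t\<bar> * s d \<le> s c / 2" using abs_ge_zero[of t] unfolding distrib_left by linarith
  then show "s c / 2 \<le> s (\<lambda>k. c k + t * d k)" using s_perturb[of c t d] by linarith
qed simp

text \<open>The inner integral of \<open>a_form\<close>: up to the factor p, the derivative of
  \<open>N\<close> at c along d.\<close>

definition D :: "(nat \<Rightarrow> real) \<Rightarrow> (nat \<Rightarrow> real) \<Rightarrow> 'a \<Rightarrow> real" where
  "D c d \<xi> = (\<integral>x. sgnpow (v c x \<bullet> \<xi>) (p - 1) * (v d x \<bullet> \<xi>) \<partial>M)"

lemma N_deriv:
  assumes \<xi>: "norm \<xi> = 1"
  shows "((\<lambda>t. N (\<lambda>k. c k + t * d k) \<xi>) has_real_derivative p * D c d \<xi>) (at 0)"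
    and "\<bar>t\<bar> \<le> 1 \<Longrightarrow> \<bar>N (\<lambda>k. c k + t * d k) \<xi> - N c \<xi>\<bar>
      \<le> (p * 2 powr (p - 1) * ((s c + s d) powr p * A)) * \<bar>t\<bar>"
proof -
  let ?h = "\<lambda>x. (s c + s d) * H x"
  have eq: "?h x powr p = (s c + s d) powr p * H x powr p" for x
    using s0 H0 by (simp add: powr_mult)
  have 1: "\<bar>v c x \<bullet> \<xi>\<bar> \<le> ?h x" "\<bar>v d x \<bullet> \<xi>\<bar> \<le> ?h x" for x
    using v_inner_bound[OF \<xi>, of c x] v_inner_bound[OF \<xi>, of d x]
      mult_nonneg_nonneg[OF s0[of c] H0[of x]] mult_nonneg_nonneg[OF s0[of d] H0[of x]]
    unfolding distrib_right by linarith+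
  have 2: "integrable M (\<lambda>x. ?h x powr p)" unfolding eq using H_int by simp
  have 3: "(\<integral>x. ?h x powr p \<partial>M) = (s c + s d) powr p * A" unfolding eq A_def by simp
  have N: "N (\<lambda>k. c k + t * d k) \<xi> = (\<integral>x. \<bar>v c x \<bullet> \<xi> + t * (v d x \<bullet> \<xi>)\<bar> powr p \<partial>M)" for t
    by (simp add: N_def v_lin inner_add_left)
  show "((\<lambda>t. N (\<lambda>k. c k + t * d k) \<xi>) has_real_derivative p * D c d \<xi>) (at 0)"
    unfolding N D_def using 1 2 p by (intro abs_powr_integral_deriv(1)[where h="?h"]) auto
  show "\<bar>t\<bar> \<le> 1 \<Longrightarrow> \<bar>N (\<lambda>k. c k + t * d k) \<xi> - N c \<xi>\<bar>
      \<le> (p * 2 powr (p - 1) * ((s c + s d) powr p * A)) * \<bar>t\<bar>"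
    unfolding N 3[symmetric] unfolding N_def
    using 1 2 p by (intro abs_powr_integral_deriv(2)[where h="?h"]) auto
qed

lemma B_deriv:
  "((\<lambda>t. B (\<lambda>k. c k + t * d k)) has_real_derivative
     \<alpha> * (\<integral>x. sgnpow (u c x) (\<alpha> - 1) * u d x \<partial>M)) (at 0)"
proof -
  let ?h = "\<lambda>x. (s c + s d) * h x"
  have eq: "?h x powr \<alpha> = (s c + s d) powr \<alpha> * h x powr \<alpha>" for x
    using s0 h0 by (simp add: powr_mult)
  have 1: "\<bar>u c x\<bar> \<le> ?h x" "\<bar>u d x\<bar> \<le> ?h x" for x
    using u_bound[of c x] u_bound[of d x]
      mult_nonneg_nonneg[OF s0[of c] h0[of x]] mult_nonneg_nonneg[OF s0[of d] h0[of x]]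
    unfolding distrib_right by linarith+
  have 2: "integrable M (\<lambda>x. ?h x powr \<alpha>)" unfolding eq using h_int by simp
  show ?thesis unfolding B_def u_lin
    using 1 2 \<alpha> by (intro abs_powr_integral_deriv(1)[where h="?h"]) auto
qed

text \<open>A second differentiation under the integral, now over the sphere. Since c is nonzero,
  \<open>N\<close> stays above a constant \<open>e\<close> for small t, and there the negative power
  is Lipschitz.\<close>

lemma P_deriv:
  assumes c: "0 < s c"
  shows "((\<lambda>t. P (\<lambda>k. c k + t * d k)) has_real_derivative
     - n * (\<integral>\<xi>. N c \<xi> powr (- n / p - 1) * D c d \<xi> \<partial>\<sigma>)) (at 0)"
proof -
  interpret finite_measure \<sigma> by (rule \<sigma>_finite)
  obtain \<delta> where \<delta>: "0 < \<delta>" "\<And>c \<xi>. norm \<xi> = 1 \<Longrightarrow> \<delta> * s c powr p \<le> N c \<xi>"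
    using N_lower_bound by metis
  obtain r where r: "0 < r" "r \<le> 1" "\<And>t. \<bar>t\<bar> < r \<Longrightarrow> s c / 2 \<le> s (\<lambda>k. c k + t * d k)"
    using perturb_radius[OF c] by metis
  define e where "e = \<delta> * (s c / 2) powr p"
  have e: "0 < e" using \<delta>(1) c by (simp add: e_def)
  have neg: "- n / p \<le> 0" using n p by simp
  let ?N = "\<lambda>t. N (\<lambda>k. c k + t * d k)"
  have lo: "e \<le> ?N t \<xi>" if "\<bar>t\<bar> < r" "norm \<xi> = 1" for t \<xi>
  proof -
    have "e \<le> \<delta> * s (\<lambda>k. c k + t * d k) powr p"
      unfolding e_def using \<delta>(1) c p r(3)[OF that(1)] by (intro mult_left_mono powr_mono2) auto
    then show ?thesis using \<delta>(2)[OF that(2), of "\<lambda>k. c k + t * d k"] by linarith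
  qed
  \<comment> \<open>The increment bound of \<open>N_deriv\<close>, the same for all directions;
    multiplied by the Lipschitz constant of the power it gives a constant majorant, integrable
    because \<sigma> is finite.\<close>
  define K where "K = p * 2 powr (p - 1) * ((s c + s d) powr p * A)"
  have "((\<lambda>t. \<integral>\<xi>. ?N t \<xi> powr (- n / p) \<partial>\<sigma>) has_real_derivative
     (\<integral>\<xi>. (- n / p) * N c \<xi> powr (- n / p - 1) * (p * D c d \<xi>) \<partial>\<sigma>)) (at 0)"
  proof (rule has_real_derivative_integral(1)[OF r(1), where g="\<lambda>_. \<bar>- n / p\<bar> * e powr (- n / p - 1) * K"])
    show "integrable \<sigma> (\<lambda>\<xi>. ?N t \<xi> powr (- n / p))" if "\<bar>t\<bar> < r" for t
      using r(3)[OF that] c neg by (intro P_integrable) auto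
    show "((\<lambda>t. ?N t \<xi> powr (- n / p)) has_real_derivative
        (- n / p) * N c \<xi> powr (- n / p - 1) * (p * D c d \<xi>)) (at 0)" if "\<xi> \<in> space \<sigma>" for \<xi>
    proof -
      have \<xi>: "norm \<xi> = 1" using that by (simp add: \<sigma>_space)
      show ?thesis
        using DERIV_chain2[where f="\<lambda>z. z powr (- n / p)" and g="\<lambda>t. ?N t \<xi>" and x=0,
            OF has_real_derivative_powr N_deriv(1)[OF \<xi>]] N_pos[OF c \<xi>] by simp
    qed
    show "\<bar>?N t \<xi> powr (- n / p) - ?N 0 \<xi> powr (- n / p)\<bar> \<le> \<bar>- n / p\<bar> * e powr (- n / p - 1) * K * \<bar>t\<bar>"
      if "\<bar>t\<bar> < r" "\<xi> \<in> space \<sigma>" for t \<xi>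
    proof -
      have \<xi>: "norm \<xi> = 1" using that by (simp add: \<sigma>_space)
      have "\<bar>?N t \<xi> powr (- n / p) - ?N 0 \<xi> powr (- n / p)\<bar>
          \<le> \<bar>- n / p\<bar> * e powr (- n / p - 1) * \<bar>?N t \<xi> - ?N 0 \<xi>\<bar>"
        using lo[OF that(1) \<xi>] lo[of 0, OF _ \<xi>] r(1) by (intro powr_lipschitz_away_from_zero e neg) auto
      also have "\<dots> \<le> \<bar>- n / p\<bar> * e powr (- n / p - 1) * (K * \<bar>t\<bar>)"
        using N_deriv(2)[OF \<xi>, of t c d] that(1) r(2) by (intro mult_left_mono) (auto simp: K_def)
      finally show ?thesis by (simp add: mult_ac)
    qed
  qed simp
  moreover have "(\<integral>\<xi>. (- n / p) * N c \<xi> powr (- n / p - 1) * (p * D c d \<xi>) \<partial>\<sigma>)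
     = (\<integral>\<xi>. (- n) * (N c \<xi> powr (- n / p - 1) * D c d \<xi>) \<partial>\<sigma>)"
    using p by (intro Bochner_Integration.integral_cong) auto
  ultimately show ?thesis unfolding P_def by simp
qed

lemma \<Phi>_deriv:
  assumes c: "0 < s c"
  shows "((\<lambda>t. \<Phi> (\<lambda>k. c k + t * d k)) has_real_derivative
     \<gamma> * P c powr (- p / n - 1) * (\<integral>\<xi>. N c \<xi> powr (- n / p - 1) * D c d \<xi> \<partial>\<sigma>)
     - (\<integral>x. sgnpow (u c x) (\<alpha> - 1) * u d x \<partial>M) - L d) (at 0)"
proof -
  obtain \<delta> where \<delta>: "0 < \<delta>" "\<And>c \<xi>. norm \<xi> = 1 \<Longrightarrow> \<delta> * s c powr p \<le> N c \<xi>"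
    using N_lower_bound by metis
  have P: "0 < P c" using P_bounds(3)[OF c, of "\<delta> * s c powr p"] \<delta> c by simp
  let ?X = "\<integral>\<xi>. N c \<xi> powr (- n / p - 1) * D c d \<xi> \<partial>\<sigma>"
  let ?Y = "\<integral>x. sgnpow (u c x) (\<alpha> - 1) * u d x \<partial>M"
  have J: "((\<lambda>t. J (\<lambda>k. c k + t * d k)) has_real_derivative
     (- p / n * P c powr (- p / n - 1)) * (- n * ?X)) (at 0)"
    unfolding J_def
    using DERIV_chain2[where f="\<lambda>z. z powr (- p / n)" and g="\<lambda>t. P (\<lambda>k. c k + t * d k)" and x=0,
            OF has_real_derivative_powr P_deriv[OF c]] P by simp
  have "((\<lambda>t. \<Phi> (\<lambda>k. c k + t * d k)) has_real_derivative
     \<gamma> / p * ((- p / n * P c powr (- p / n - 1)) * (- n * ?X)) - \<alpha> * ?Y / \<alpha> - L d) (at 0)"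
    unfolding \<Phi>_def L_lin
    by (intro DERIV_diff DERIV_cmult DERIV_cdivide J B_deriv) (auto intro!: derivative_eq_intros)
  \<comment> \<open>The factors p and n from the two chain rules cancel against the normalisation
    1/p of the energy.\<close>
  moreover have "\<gamma> / p * ((- p / n * P c powr (- p / n - 1)) * (- n * ?X)) = \<gamma> * P c powr (- p / n - 1) * ?X"
    using n p by simp
  ultimately show ?thesis using \<alpha> by simp
qed

lemma critical_point:
  obtains c where "\<exists>k\<in>I. c k \<noteq> 0" "0 < P c" "\<And>d.
     \<gamma> * P c powr (- p / n - 1) * (\<integral>\<xi>. N c \<xi> powr (- n / p - 1) * D c d \<xi> \<partial>\<sigma>)
     - (\<integral>x. sgnpow (u c x) (\<alpha> - 1) * u d x \<partial>M) - L d = 0"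
proof -
  obtain c R where c: "0 < s c" "s c < R" and min: "\<And>d. s d \<le> R \<Longrightarrow> \<Phi> c \<le> \<Phi> d"
    using minimizer by metis
  obtain \<delta> where \<delta>: "0 < \<delta>" "\<And>c \<xi>. norm \<xi> = 1 \<Longrightarrow> \<delta> * s c powr p \<le> N c \<xi>"
    using N_lower_bound by metis
  show thesis
  proof (rule that[of c])
    show "\<exists>k\<in>I. c k \<noteq> 0" using c(1) by (simp add: s_pos_iff)
    show "0 < P c" using P_bounds(3)[OF c(1), of "\<delta> * s c powr p"] \<delta> c by simp
    fix d
    \<comment> \<open>Any perturbation along d with |t| below this radius remains in the ball on
      which c is minimal; both signs of t are allowed, so the derivative vanishes.\<close>
    let ?r = "(R - s c) / (s d + 1)"
    have d: "0 < s d + 1" using s0[of d] by linarith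
    have "\<Phi> (\<lambda>k. c k + 0 * d k) \<le> \<Phi> (\<lambda>k. c k + t * d k)" if "\<bar>0 - t\<bar> < ?r" for t
    proof -
      have "\<bar>t\<bar> * (s d + 1) \<le> R - s c" using that d by (simp add: field_simps)
      then have "\<bar>t\<bar> * s d \<le> R - s c" using abs_ge_zero[of t] unfolding distrib_left by linarith
      moreover have "s (\<lambda>k. c k + t * d k) \<le> s c + \<bar>t\<bar> * s d"
        unfolding s_def sum_distrib_left sum.distrib[symmetric]
        by (intro sum_mono) (simp add: abs_mult[symmetric])
      ultimately show ?thesis using min[of "\<lambda>k. c k + t * d k"] by simp
    qed
    then show "\<gamma> * P c powr (- p / n - 1) * (\<integral>\<xi>. N c \<xi> powr (- n / p - 1) * D c d \<xi> \<partial>\<sigma>)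
     - (\<integral>x. sgnpow (u c x) (\<alpha> - 1) * u d x \<partial>M) - L d = 0"
      using c(2) d by (intro DERIV_local_min[OF \<Phi>_deriv[OF c(1)], of ?r]) auto
  qed
qed

end

subsection \<open>Existence of a critical point\<close>

text \<open>The hypotheses keep the real dimensions p - 1 and N + p - 2 nonnegative, where ball
  volumes are positive.\<close>

lemma gamma_np_pos:
  assumes "1 \<le> N" "1 < p" shows "0 < gamma_np N p"
  unfolding gamma_np_def
proof -
  have "unit_ball_vol (real N) \<noteq> 0" using unit_ball_vol_pos[of "real N"] by linarith
  then show "0 < real N * unit_ball_vol (real N) * unit_ball_vol (p - 1) * (real N * unit_ball_vol (real N)) powr (p / real N)
      / (2 * unit_ball_vol (real N + p - 2))"
    using assms by (intro divide_pos_pos mult_pos_pos) auto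
qed

lemma integrable_powr_smaller_exponent:
  fixes u :: "'a \<Rightarrow> real"
  assumes "finite_measure M" and [measurable]: "u \<in> borel_measurable M"
    and int: "integrable M (\<lambda>x. \<bar>u x\<bar> powr p)" and q: "0 \<le> q" "q \<le> p"
  shows "integrable M (\<lambda>x. \<bar>u x\<bar> powr q)"
proof (rule Bochner_Integration.integrable_bound)
  interpret finite_measure M by fact
  show "integrable M (\<lambda>x. 1 + \<bar>u x\<bar> powr p)" using int by simp
  have "\<bar>y\<bar> powr q \<le> 1 + \<bar>y\<bar> powr p" for y :: real
  proof (cases "\<bar>y\<bar> \<le> 1")
    case True
    then have "\<bar>y\<bar> powr q \<le> 1" using q powr_mono2[of q "\<bar>y\<bar>" 1] by simp
    then show ?thesis by (simp add: add_increasing2)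
  next
    case False
    then have "\<bar>y\<bar> powr q \<le> \<bar>y\<bar> powr p" using q by (intro powr_mono) auto
    then show ?thesis by simp
  qed
  then show "AE x in M. norm (\<bar>u x\<bar> powr q) \<le> norm (1 + \<bar>u x\<bar> powr p)"
    by (intro AE_I2) (simp add: add_nonneg_nonneg)
qed measurable

lemma set_integral_restrict_space:
  fixes h :: "'a \<Rightarrow> real"
  assumes "\<Omega> \<in> sets M"
  shows "(LINT x:\<Omega>|M. h x) = (\<integral>x. h x \<partial>restrict_space M \<Omega>)"
  using assms by (simp add: set_lebesgue_integral_def integral_restrict_space)

lemma Lp_norm_eq_integral:
  assumes \<Omega>: "\<Omega> \<in> sets borel" and int: "integrable (restrict_space lborel \<Omega>) (\<lambda>x. \<bar>v x\<bar> powr p)"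
  shows "Lp_norm \<Omega> p v = (\<integral>x. \<bar>v x\<bar> powr p \<partial>restrict_space lborel \<Omega>) powr (1 / p)"
proof -
  have "(\<integral>\<^sup>+x\<in>\<Omega>. ennreal (\<bar>v x\<bar> powr p) \<partial>lborel) = (\<integral>\<^sup>+x. ennreal (\<bar>v x\<bar> powr p) \<partial>restrict_space lborel \<Omega>)"
    using \<Omega> by (subst nn_integral_restrict_space) auto
  also have "\<dots> = ennreal (\<integral>x. \<bar>v x\<bar> powr p \<partial>restrict_space lborel \<Omega>)"
    using int by (intro nn_integral_eq_integral) auto
  finally show ?thesis by (simp add: Lp_norm_def)
qed

lemma Lp_norm_cong_AE:
  assumes "AE x in lborel. u x = v x"
  shows "Lp_norm \<Omega> p u = Lp_norm \<Omega> p v"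
proof -
  have "(\<integral>\<^sup>+x\<in>\<Omega>. ennreal (\<bar>u x\<bar> powr p) \<partial>lborel) = (\<integral>\<^sup>+x\<in>\<Omega>. ennreal (\<bar>v x\<bar> powr p) \<partial>lborel)"
    by (rule nn_integral_cong_AE) (use assms in \<open>eventually_elim, simp\<close>)
  then show ?thesis by (simp add: Lp_norm_def)
qed

lemma integrable_mult_conjugate:
  fixes f g :: "'a \<Rightarrow> real"
  assumes [measurable]: "f \<in> borel_measurable M" "g \<in> borel_measurable M"
    and "1 < p" "1 < q" "1 / p + 1 / q = 1"
    and "integrable M (\<lambda>x. \<bar>f x\<bar> powr q)" "integrable M (\<lambda>x. \<bar>g x\<bar> powr p)"
  shows "integrable M (\<lambda>x. f x * g x)"
proof (rule Bochner_Integration.integrable_bound)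
  show "integrable M (\<lambda>x. \<bar>g x\<bar> powr p / p + \<bar>f x\<bar> powr q / q)" using assms by simp
  show "AE x in M. norm (f x * g x) \<le> norm (\<bar>g x\<bar> powr p / p + \<bar>f x\<bar> powr q / q)"
  proof (rule AE_I2)
    fix x
    have "\<bar>g x\<bar> * \<bar>f x\<bar> \<le> \<bar>g x\<bar> powr p / p + \<bar>f x\<bar> powr q / q"
      using assms by (intro Youngs_inequality) auto
    then show "norm (f x * g x) \<le> norm (\<bar>g x\<bar> powr p / p + \<bar>f x\<bar> powr q / q)"
      by (simp add: abs_mult mult.commute)
  qed
qed measurable

text \<open>Holds also at y = 0 when q < 2, since both sides are then 0; this identifies the
  lower-order term of the equation with the derivative of \<open>B\<close>.\<close>

lemma powr_times_eq_sgnpow: "\<bar>y\<bar> powr (q - 2) * y = sgnpow y (q - 1)" for y q :: real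
proof (cases "y = 0")
  case False
  have "\<bar>y\<bar> powr (q - 2) * y = \<bar>y\<bar> powr (q - 2) * \<bar>y\<bar> powr 1 * sgn y"
    using False by (simp add: abs_mult_sgn mult.assoc)
  then show ?thesis unfolding powr_add[symmetric] by (simp add: sgnpow_def)
qed (simp add: sgnpow_def)

theorem theorem3p2:
  fixes \<Omega> :: "'a::euclidean_space set" and p \<alpha> p' :: real and w :: "nat \<Rightarrow> 'a \<Rightarrow> real"
    and m :: nat and f :: "'a \<Rightarrow> real"
  assumes "DIM('a) \<ge> 2" and "p > 1"
    and "bounded \<Omega>" and "open \<Omega>"
    and "schauder_basis \<Omega> p w"
    and "m \<ge> 1" and "1 < \<alpha>" and "\<alpha> < p"
    and "1 / p + 1 / p' = 1"
    and "in_Lp \<Omega> p' f"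
    and "\<not> (AE x in lborel. x \<in> \<Omega> \<longrightarrow> f x = 0)"
  shows "\<exists>u\<in>Wm w m. sob_norm \<Omega> p u \<noteq> 0 \<and>
           (\<forall>\<phi>\<in>Wm w m. a_form \<Omega> p u \<phi>
              - (LINT x:\<Omega>|lborel. \<bar>u x\<bar> powr (\<alpha> - 2) * u x * \<phi> x)
              - (LINT x:\<Omega>|lborel. f x * \<phi> x) = 0)"
proof -
  \<comment> \<open>Keeps the index set in the form \<open>{1..m}\<close>.\<close>
  note One_nat_def [simp del]
  define M where "M = restrict_space (lborel :: 'a measure) \<Omega>"
  define G where "G k = wgrad \<Omega> p (w k)" for k
  define \<gamma> where "\<gamma> = gamma_np DIM('a) p"
  define n where "n = real DIM('a)"
  have \<gamma>: "0 < \<gamma>" unfolding \<gamma>_def using assms(1,2) by (intro gamma_np_pos) auto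
  have n: "0 < n" by (simp add: n_def)
  have \<Omega>[measurable]: "\<Omega> \<in> sets borel" using assms(4) by simp
  have finM: "finite_measure M" unfolding M_def
    using emeasure_bounded_finite[OF assms(3)]
    by (intro finite_measureI) (simp add: space_restrict_space emeasure_restrict_space less_top)
  have pair: "sob0_pair \<Omega> p (\<lambda>x. \<Sum>k\<in>{1..m}. c k * w k x) (\<lambda>x. \<Sum>k\<in>{1..m}. c k *\<^sub>R G k x)" for c
    using assms(2,5) by (intro sob0_pair_sum) (auto simp: G_def schauder_basis_def intro!: sob0_pair_wgrad)
  have spair: "sobolev_pair \<Omega> p (\<lambda>x. \<Sum>k\<in>{1..m}. c k * w k x) (\<lambda>x. \<Sum>k\<in>{1..m}. c k *\<^sub>R G k x)" for c
    using assms(2,3,4) pair by unfold_locales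
  have kpair: "sobolev_pair \<Omega> p (w k) (G k)" if "k \<in> {1..m}" for k
    using assms(2-5) that by unfold_locales (auto simp: G_def schauder_basis_def intro!: sob0_pair_wgrad)
  have measM: "h \<in> borel_measurable M" if "h \<in> borel_measurable borel" for h :: "'a \<Rightarrow> 'b::topological_space"
    using that unfolding M_def by (intro measurable_restrict_space1) simp
  have intM: "integrable M h" if "integrable lborel h" for h :: "'a \<Rightarrow> real"
    unfolding M_def using that by (intro integrable_restrict_spaceI) auto
  have u_int: "integrable M (\<lambda>x. \<bar>\<Sum>k\<in>{1..m}. c k * w k x\<bar> powr q)" if "0 \<le> q" "q \<le> p" for c q
    using finM measM[OF sobolev_pair.measurable_u[OF spair]] intM[OF sobolev_pair.u_powr_integrable[OF spair]] that
    by (rule integrable_powr_smaller_exponent)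
  \<comment> \<open>The lemma also speaks of a direction, for which any basis vector serves. The
    exponent \<alpha> is needed for the minimisation, the exponent p for nontriviality of u.\<close>
  have u_pos: "0 < (\<integral>x. \<bar>\<Sum>k\<in>{1..m}. c k * w k x\<bar> powr q \<partial>M)" if "\<exists>k\<in>{1..m}. c k \<noteq> 0" "0 < q" "q \<le> p" for c q
    using directional_norm_positive(2)[OF assms(2-5) that(1), of "SOME b. b \<in> Basis" q] u_int[of q c] that
    by (simp add: M_def some_in_eq nonzero_Basis)
  define \<beta> where "\<beta> k = (\<integral>x. f x * w k x \<partial>M)" for k
  \<comment> \<open>The constant is \<open>\<gamma> powr p\<close> because the p-th power of the
    energy is \<gamma>^p times \<open>J\<close>.\<close>
  interpret energy_family M sphere_measure "{1..m}" w G p \<alpha> "\<gamma> powr p" n \<beta>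
  proof (rule energy_family.intro)
    fix k assume k: "k \<in> {1..m}"
    show wk: "w k \<in> borel_measurable M" and "G k \<in> borel_measurable M"
      using sobolev_pair.measurable_u[OF kpair[OF k]] sobolev_pair.measurable_g[OF kpair[OF k]]
      by (auto intro: measM)
    show "integrable M (\<lambda>x. \<bar>w k x\<bar> powr \<alpha>)"
      by (rule integrable_powr_smaller_exponent[OF finM wk intM[OF sobolev_pair.u_powr_integrable[OF kpair[OF k]]]])
         (use assms(7,8) in simp_all)
    show "integrable M (\<lambda>x. norm (G k x) powr p)"
      using intM[OF sobolev_pair.g_powr_integrable[OF kpair[OF k]]] .
  next
    fix c :: "nat \<Rightarrow> real" assume c: "\<exists>k\<in>{1..m}. c k \<noteq> 0"
    show "0 < (\<integral>x. \<bar>\<Sum>k\<in>{1..m}. c k * w k x\<bar> powr \<alpha> \<partial>M)" using u_pos[OF c] assms(7,8) by simp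
    fix \<xi> :: 'a assume "norm \<xi> = 1"
    then have "\<xi> \<noteq> 0" by auto
    then show "0 < (\<integral>x. \<bar>(\<Sum>k\<in>{1..m}. c k *\<^sub>R G k x) \<bullet> \<xi>\<bar> powr p \<partial>M)"
      unfolding M_def G_def by (rule directional_norm_positive(1)[OF assms(2-5) c])
  qed (use assms(6-8) \<gamma> n finite_measure_sphere_measure measure_sphere_measure_pos in \<open>simp_all add: sets_sphere_measure\<close>)
  \<comment> \<open>Only almost everywhere does the chosen gradient of \<open>u c\<close> agree with
    the combination \<open>v c\<close> of basis gradients; under the integrals below this allows
    replacing one by the other.\<close>
  have wg: "AE x in lborel. wgrad \<Omega> p (u c) x = v c x" for c
    using wgrad_AE_eq[OF assms(2-4) pair[of c]] by (simp only: u_def[abs_def] v_def)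
  have uW: "u c \<in> W0 \<Omega> p" for c using pair[of c] by (auto simp: W0_def u_def[abs_def])
  have vm: "v c \<in> borel_measurable borel" and um: "u c \<in> borel_measurable borel" for c
    using pair[of c] by (auto simp: sob0_pair_def u_def[abs_def] v_def[abs_def])
  have wm: "wgrad \<Omega> p (u c) \<in> borel_measurable borel" for c
    using sob0_pair_wgrad[OF uW] by (auto simp: sob0_pair_def)
  have Nint: "integrable M (\<lambda>x. \<bar>v c x \<bullet> \<xi>\<bar> powr p)" if "norm \<xi> = 1" for c \<xi>
    using p v_inner_bound[OF that] s0 H0 H_int
    by (intro abs_powr_integrable_bound(1)[where K="s c" and h=H]) auto
  have Lp: "Lp_norm \<Omega> p (dir_grad \<Omega> p (u c) \<xi>) = N c \<xi> powr (1 / p)" if "norm \<xi> = 1" for c \<xi>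
  proof -
    have "Lp_norm \<Omega> p (dir_grad \<Omega> p (u c) \<xi>) = Lp_norm \<Omega> p (\<lambda>x. v c x \<bullet> \<xi>)"
      using wg[of c] by (intro Lp_norm_cong_AE) (auto simp: dir_grad_def)
    then show ?thesis
      using Lp_norm_eq_integral[OF \<Omega> Nint[OF that, of c, unfolded M_def], folded M_def] by (simp add: N_def)
  qed
  have Lp_powr: "Lp_norm \<Omega> p (dir_grad \<Omega> p (u c) \<xi>) powr e = N c \<xi> powr (e / p)" if "norm \<xi> = 1" for c \<xi> e
    by (simp add: Lp[OF that] powr_powr)
  have D: "(LINT x:\<Omega>|lborel. sgnpow (dir_grad \<Omega> p (u c) \<xi> x) (p - 1) * (wgrad \<Omega> p (u d) x \<bullet> \<xi>)) = D c d \<xi>" for c d \<xi>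
  proof -
    note [measurable] = vm wm
    have "(LINT x:\<Omega>|lborel. sgnpow (dir_grad \<Omega> p (u c) \<xi> x) (p - 1) * (wgrad \<Omega> p (u d) x \<bullet> \<xi>))
      = (LINT x:\<Omega>|lborel. sgnpow (v c x \<bullet> \<xi>) (p - 1) * (v d x \<bullet> \<xi>))"
      unfolding set_lebesgue_integral_def dir_grad_def
    proof (rule integral_cong_AE)
      show "AE x in lborel. indicator \<Omega> x *\<^sub>R (sgnpow (wgrad \<Omega> p (u c) x \<bullet> \<xi>) (p - 1) * (wgrad \<Omega> p (u d) x \<bullet> \<xi>))
         = indicator \<Omega> x *\<^sub>R (sgnpow (v c x \<bullet> \<xi>) (p - 1) * (v d x \<bullet> \<xi>))"
        using wg[of c] wg[of d] by eventually_elim simp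
    qed measurable
    then show ?thesis by (simp add: set_integral_restrict_space D_def M_def[symmetric])
  qed
  obtain c where c: "\<exists>k\<in>{1..m}. c k \<noteq> 0" "0 < P c" and crit: "\<And>d.
     \<gamma> powr p * P c powr (- p / n - 1) * (\<integral>\<xi>. N c \<xi> powr (- n / p - 1) * D c d \<xi> \<partial>sphere_measure)
     - (\<integral>x. sgnpow (u c x) (\<alpha> - 1) * u d x \<partial>M) - L d = 0"
    by (rule critical_point) blast
  have sob: "sob_norm \<Omega> p (u c) \<noteq> 0"
  proof -
    have "0 < Lp_norm \<Omega> p (u c)"
      using Lp_norm_eq_integral[OF \<Omega> u_int[of p c, unfolded M_def], folded M_def] u_pos[OF c(1), of p] p
      by (simp add: u_def[abs_def])
    moreover have "0 \<le> Lp_norm \<Omega> p (\<lambda>x. norm (wgrad \<Omega> p (u c) x))" by (simp add: Lp_norm_def)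
    ultimately show ?thesis by (simp add: sob_norm_def)
  qed
  have int_sphere: "(\<integral>\<xi>. Lp_norm \<Omega> p (dir_grad \<Omega> p (u c) \<xi>) powr e * k \<xi> \<partial>sphere_measure)
      = (\<integral>\<xi>. N c \<xi> powr (e / p) * k \<xi> \<partial>sphere_measure)" for e and k :: "'a \<Rightarrow> real"
    by (intro Bochner_Integration.integral_cong) (auto simp: space_sphere_measure Lp_powr)
  have E: "affine_energy \<Omega> p (u c) = \<gamma> * P c powr (- 1 / n)"
    using sob int_sphere[of "- n" "\<lambda>_. 1"] by (simp add: affine_energy_def P_def \<gamma>_def[symmetric] n_def[symmetric])
  have a: "a_form \<Omega> p (u c) (u d)
     = \<gamma> powr p * P c powr (- p / n - 1) * (\<integral>\<xi>. N c \<xi> powr (- n / p - 1) * D c d \<xi> \<partial>sphere_measure)" for d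
  proof -
    have "a_form \<Omega> p (u c) (u d) = \<gamma> powr (- n) * (\<gamma> * P c powr (- 1 / n)) powr (n + p)
        * (\<integral>\<xi>. N c \<xi> powr ((- n - p) / p) * D c d \<xi> \<partial>sphere_measure)"
      unfolding a_form_def E D n_def[symmetric] \<gamma>_def[symmetric] int_sphere by simp
    moreover have "\<gamma> powr (- n) * (\<gamma> * P c powr (- 1 / n)) powr (n + p)
        = (\<gamma> powr (- n) * \<gamma> powr (n + p)) * P c powr (- 1 / n * (n + p))"
      using \<gamma> by (simp add: powr_mult powr_powr)
    \<comment> \<open>The powers of \<gamma> combine to p and those of \<open>P\<close> to - p/n -
      1, the coefficients in the critical point equation.\<close>
    moreover have "- 1 / n * (n + p) = - p / n - 1" "(- n - p) / p = - n / p - 1"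
      using n p by (simp_all add: field_simps)
    ultimately show ?thesis by (simp add: powr_add[symmetric])
  qed
  have fw: "integrable M (\<lambda>x. f x * w k x)" if k: "k \<in> {1..m}" for k
  proof -
    \<comment> \<open>As 1/p lies strictly between 0 and 1, so does 1/p'; hence p' > 1, as the Young
      inequality demands.\<close>
    have "0 < 1 / p" "1 / p < 1" using assms(2) by simp_all
    then have "0 < 1 / p'" "1 / p' < 1" using assms(9) by linarith+
    then have p': "1 < p'" by (simp add: divide_less_eq_1_pos)
    have fm: "f \<in> borel_measurable borel" using assms(10) by (simp add: in_Lp_def)
    have "(\<integral>\<^sup>+x. ennreal (\<bar>f x\<bar> powr p') \<partial>M) < \<infinity>"
      using assms(10) by (simp add: M_def in_Lp_def nn_integral_restrict_space)
    then have "integrable M (\<lambda>x. \<bar>f x\<bar> powr p')"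
      using measM[OF fm] by (intro integrableI_nonneg) auto
    then show ?thesis
      using measM[OF fm] w_meas[OF k] p p' assms(9) intM[OF sobolev_pair.u_powr_integrable[OF kpair[OF k]]]
      by (intro integrable_mult_conjugate[where p=p and q=p']) auto
  qed
  have Ld: "(LINT x:\<Omega>|lborel. f x * u d x) = L d" for d
  proof -
    have "(LINT x:\<Omega>|lborel. f x * u d x) = (\<integral>x. f x * u d x \<partial>M)"
      by (simp add: set_integral_restrict_space M_def[symmetric])
    also have "\<dots> = (\<integral>x. (\<Sum>k\<in>{1..m}. d k * (f x * w k x)) \<partial>M)"
      by (simp add: u_def sum_distrib_left mult_ac)
    also have "\<dots> = (\<Sum>k\<in>{1..m}. d k * \<beta> k)"
      using fw by (subst Bochner_Integration.integral_sum) (auto simp: \<beta>_def)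
    finally show ?thesis by (simp add: L_def)
  qed
  have Bd: "(LINT x:\<Omega>|lborel. \<bar>u c x\<bar> powr (\<alpha> - 2) * u c x * u d x) = (\<integral>x. sgnpow (u c x) (\<alpha> - 1) * u d x \<partial>M)" for d
    by (simp add: set_integral_restrict_space M_def[symmetric] powr_times_eq_sgnpow)
  \<comment> \<open>Every test function in the span is \<open>u d\<close> for some d, so vanishing
    along all coefficient directions is the full equation.\<close>
  have Wm: "Wm w m = range u"
    by (auto simp: Wm_def u_def[abs_def])
  show ?thesis
    unfolding Wm using sob crit by (intro bexI[of _ "u c"]) (auto simp: a Bd Ld)
qed

end
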